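(* Let $1<p<N$. Let $a:\mathbb{R}^N\to\mathbb{R}$ be measurable with $|a(x)|\le c_a\frac{1}{1+|x|^{N+\alpha}}$ for some $c_a,\alpha>0$, put $w(x)=\frac{1}{1+|x|^{N+\alpha}}$, and let $g:\mathbb{R}^N\times\mathbb{R}\to\mathbb{R}$ be a Carathéodory function satisfying either (i) $|g(x,s)|\le c_g(1+|s|^{q-1})$ for a.e. $x\in\mathbb{R}^N$ and all $s\in\mathbb{R}$, with some $1<q<p$ and $c_g>0$, or (ii) $|g(x,s)|\le c_g(1+|s|^{p-1})$ for a.e. $x\in\mathbb{R}^N$ and all $s\in\mathbb{R}$, with $c_g>0$ such that $c_ac_g<\frac{1}{\|i_w\|^p}$, where $\|i_w\|$ denotes the norm of the embedding operator $i_w:X\to L^p(\mathbb{R}^N,w)$. Then the equation $-\Delta_p u=a(x)g(x,u)$ in $\mathbb{R}^N$ admits at least one solution $u\in X=D^{1,p}(\mathbb{R}^N)$.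
   Context: $X=D^{1,p}(\mathbb{R}^N)$ is the completion of $C_c^\infty(\mathbb{R}^N)$ under $\|u\|_X=\left(\int_{\mathbb{R}^N}|\nabla u|^p\right)^{1/p}$. $\Delta_p u=\operatorname{div}(|\nabla u|^{p-2}\nabla u)$. A solution of $-\Delta_p u=a(x)g(x,u)$ is a function $u\in X$ with $\int_{\mathbb{R}^N}|\nabla u|^{p-2}\nabla u\cdot\nabla\varphi\,dx=\int_{\mathbb{R}^N}a(x)g(x,u)\varphi\,dx$ for all $\varphi\in X$. For $1<\sigma<\infty$, $L^\sigma(\mathbb{R}^N,w)$ is the weighted Lebesgue space of measurable $u:\mathbb{R}^N\to\mathbb{R}$ with $|u|_{\sigma,w}=\left(\int_{\mathbb{R}^N}w|u|^\sigma dx\right)^{1/\sigma}<\infty$. The space $X$ embeds continuously (indeed compactly) into $L^\sigma(\mathbb{R}^N,w)$ for $1<\sigma<p^*=\frac{Np}{N-p}$. Carathéodory: measurable in $x$ for every $s$, continuous in $s$ for a.e. $x$. *)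

theory Defs
  imports "HOL-Analysis.Analysis"
begin

primrec C_k :: "nat \<Rightarrow> ('a::euclidean_space \<Rightarrow> real) \<Rightarrow> bool" where
  "C_k 0 f \<longleftrightarrow> continuous_on UNIV f"
| "C_k (Suc k) f \<longleftrightarrow> (\<forall>x. f differentiable (at x)) \<and>
     (\<forall>i\<in>Basis. C_k k (\<lambda>x. frechet_derivative f (at x) i))"

definition test_function :: "('a::euclidean_space \<Rightarrow> real) \<Rightarrow> bool" where
  "test_function \<phi> \<longleftrightarrow> (\<forall>k. C_k k \<phi>) \<and> compact (closure {x. \<phi> x \<noteq> 0})"

definition classical_grad :: "('a::euclidean_space \<Rightarrow> real) \<Rightarrow> 'a \<Rightarrow> 'a" where
  "classical_grad f x = (THE D. GDERIV f x :> D)"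

text \<open>
  The completion of the test functions under the \<open>L\<^sup>p\<close> norm of the gradient is realised as a
  space of functions.  For \<open>1 < p < N\<close> the Sobolev inequality makes a gradient-Cauchy sequence of
  test functions converge in \<open>L\<^bsup>Np/(N-p)\<^esup>\<close>, so a subsequence converges almost everywhere, and
  equivalent Cauchy sequences have the same limit.  An element of the completion is thus the
  same thing as the a.e. limit \<open>u\<close> of a gradient-Cauchy, a.e. convergent sequence of test
  functions; the \<open>L\<^sup>p\<close> limit \<open>G\<close> of the gradients is the gradient of \<open>u\<close>, and it is determined by
  \<open>u\<close> up to null sets.
  Functions are not quotiented by a.e. equality.
\<close>

definition has_D1p_grad :: "real \<Rightarrow> ('a::euclidean_space \<Rightarrow> real) \<Rightarrow> ('a \<Rightarrow> 'a) \<Rightarrow> bool" where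
  "has_D1p_grad p u G \<longleftrightarrow>
     u \<in> borel_measurable lebesgue \<and> G \<in> borel_measurable lebesgue \<and>
     (\<exists>\<phi> :: nat \<Rightarrow> 'a \<Rightarrow> real.
        (\<forall>n. test_function (\<phi> n)) \<and>
        (\<lambda>n. \<integral>\<^sup>+ x. ennreal (norm (classical_grad (\<phi> n) x - G x) powr p) \<partial>lebesgue)
          \<longlonglongrightarrow> 0 \<and>
        (AE x in lebesgue. (\<lambda>n. \<phi> n x) \<longlonglongrightarrow> u x))"

definition D1p :: "real \<Rightarrow> ('a::euclidean_space \<Rightarrow> real) set" where
  "D1p p = {u. \<exists>G. has_D1p_grad p u G}"

definition D1p_grad :: "real \<Rightarrow> ('a::euclidean_space \<Rightarrow> real) \<Rightarrow> 'a \<Rightarrow> 'a" where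
  "D1p_grad p u = (SOME G. has_D1p_grad p u G)"

definition D1p_norm :: "real \<Rightarrow> ('a::euclidean_space \<Rightarrow> real) \<Rightarrow> real" where
  "D1p_norm p u = (\<integral>x. norm (D1p_grad p u x) powr p \<partial>lebesgue) powr (1 / p)"

definition weighted_Lnorm ::
    "real \<Rightarrow> ('a::euclidean_space \<Rightarrow> real) \<Rightarrow> ('a \<Rightarrow> real) \<Rightarrow> real" where
  "weighted_Lnorm \<sigma> w u = (\<integral>x. w x * \<bar>u x\<bar> powr \<sigma> \<partial>lebesgue) powr (1 / \<sigma>)"

text \<open>
  Operator norm of the embedding of \<open>D1p p\<close> into \<open>L\<^sup>p(w)\<close>.  The supremum is meaningful whenever
  the embedding exists and is continuous, as for the weights \<open>decay_weight \<alpha>\<close> below.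
\<close>

definition embedding_norm :: "real \<Rightarrow> ('a::euclidean_space \<Rightarrow> real) \<Rightarrow> real" where
  "embedding_norm p w = Sup {weighted_Lnorm p w u | u. u \<in> D1p p \<and> D1p_norm p u \<le> 1}"

definition decay_weight :: "real \<Rightarrow> 'a::euclidean_space \<Rightarrow> real" where
  "decay_weight \<alpha> x = 1 / (1 + norm x powr (real DIM('a) + \<alpha>))"

definition caratheodory :: "('a::euclidean_space \<Rightarrow> real \<Rightarrow> real) \<Rightarrow> bool" where
  "caratheodory g \<longleftrightarrow>
     (\<forall>s. (\<lambda>x. g x s) \<in> borel_measurable lebesgue) \<and>
     (AE x in lebesgue. continuous_on UNIV (g x))"

text \<open>
  Weak solutions of \<open>-\<Delta>\<^sub>p u = h(x, u)\<close>.  Integrability is demanded explicitly because the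
  Bochner integral of a non-integrable function is \<open>0\<close>.
\<close>

definition p_laplace_solution ::
    "real \<Rightarrow> ('a::euclidean_space \<Rightarrow> real \<Rightarrow> real) \<Rightarrow> ('a \<Rightarrow> real) \<Rightarrow> bool" where
  "p_laplace_solution p h u \<longleftrightarrow> u \<in> D1p p \<and>
     (\<forall>\<phi>\<in>D1p p.
        integrable lebesgue
          (\<lambda>x. (norm (D1p_grad p u x) powr (p - 2) *\<^sub>R D1p_grad p u x) \<bullet> D1p_grad p \<phi> x) \<and>
        integrable lebesgue (\<lambda>x. h x (u x) * \<phi> x) \<and>
        (\<integral>x. (norm (D1p_grad p u x) powr (p - 2) *\<^sub>R D1p_grad p u x) \<bullet> D1p_grad p \<phi> x
           \<partial>lebesgue) =
        (\<integral>x. h x (u x) * \<phi> x \<partial>lebesgue))"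

end

theory Submission
  imports Defs "HOL-Complex_Analysis.Great_Picard" "HOL-Library.Diagonal_Subsequence"
begin

text \<open>
  The solution minimises \<open>J(u) = (1/p) \<integral> \<bar>\<nabla>u\<bar>\<^sup>p - \<integral> F(x, u)\<close>, where \<open>F\<close> is a primitive of \<open>a g\<close>; the growth
  condition makes \<open>J\<close> coercive.  Reflexivity and weak convergence are avoided: a minimising sequence of
  test functions has a subsequence converging in the weighted space by compactness of the embedding, so
  \<open>\<integral> F\<close> converges along it, and \<open>J((u\<^sub>m + u\<^sub>n)/2) \<ge> inf J\<close> together with the uniform convexity of
  \<open>\<bar>\<cdot>\<bar>\<^sup>p\<close> forces the gradients to be Cauchy in \<open>L\<^sup>p\<close>.  The embedding comes from a Hardy inequality
  (proved by comparing \<open>u(x)\<close> with \<open>u(2x)\<close>), whose weight dominates \<open>w\<close> at infinity, and its compactness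
  from the translation estimate \<open>\<bar>u(\<cdot> + z) - u\<bar>\<^sub>p \<le> \<bar>z\<bar> \<bar>\<nabla>u\<bar>\<^sub>p\<close>, averages over small balls and
  the Arzela-Ascoli theorem.
\<close>

section \<open>Convexity of powers of the norm\<close>

text \<open>Integrals are kept as p-th powers and their roots are avoided. Minkowski's inequality is
  replaced by \<open>norm_add_powr_le\<close>, whose two weights can be played off against each
  other, and Hoelder's by the splitting \<open>mult_powr_le_eps\<close> with a free parameter. The
  functional is minimised over test functions only: elements of \<open>D1p\<close> are limits of
  test functions, so estimates are proved for these and passed to the limit, and the minimiser
  arises as such a limit. Two definitions shape the rest: \<open>D1p_grad\<close> chooses a
  gradient, harmless only once gradients are unique almost everywhere; \<open>embedding_norm\<close>
  is a real \<open>Sup\<close>, which says nothing until a crude embedding constant bounds the set.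
  The smallness condition is coercivity: a growth \<open>A + B |s|^(p-1)\<close> has a primitive at
  most \<open>A |s| + (B/p) |s|^p\<close>, so with \<open>K\<close> the p-th power of the embedding
  norm the functional keeps the share \<open>(1 - B K)/p\<close> of the gradient integral, up to
  lower-order terms. Growth (i) is the same case with \<open>B\<close> as small as desired.\<close>

lemma powr_tangent_strict:
  fixes x y p :: real
  assumes "1 < p" "0 \<le> x" "0 \<le> y" "x \<noteq> y"
  shows "x powr p + p * x powr (p - 1) * (y - x) < y powr p"
proof -
  \<comment> \<open>At 0 the power is only known to be continuous, which is all that the mean value
    theorem asks of an endpoint.\<close>
  have cont: "continuous_on {a..b} (\<lambda>z. z powr p)" if "0 \<le> a" for a b :: real
    using that assms by (intro continuous_on_powr' continuous_intros) auto
  have der: "((\<lambda>z. z powr p) has_derivative (\<lambda>h. p * z powr (p - 1) * h)) (at z)" if "0 < z" for z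
    using has_real_derivative_powr[OF that, of p] by (simp add: has_field_derivative_def)
  show ?thesis
  proof (cases "x < y")
    case True
    then obtain z where "x < z" "z < y" "y powr p - x powr p = p * z powr (p - 1) * (y - x)"
      using mvt[OF True cont der] assms by (metis order.strict_trans1)
    moreover have "p * x powr (p - 1) * (y - x) < p * z powr (p - 1) * (y - x)"
      using assms \<open>x < z\<close> True by (intro mult_strict_right_mono mult_strict_left_mono powr_less_mono2) auto
    ultimately show ?thesis by linarith
  next
    case False
    then have yx: "y < x" using assms by simp
    then obtain z where "y < z" "z < x" "x powr p - y powr p = p * z powr (p - 1) * (x - y)"
      using mvt[OF yx cont der] assms by (metis order.strict_trans1)
    moreover have "p * z powr (p - 1) * (x - y) < p * x powr (p - 1) * (x - y)"
      using assms \<open>z < x\<close> \<open>y < z\<close> yx by (intro mult_strict_right_mono mult_strict_left_mono powr_less_mono2) auto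
    ultimately show ?thesis by (simp add: algebra_simps)
  qed
qed

lemma powr_tangent:
  fixes x y p :: real
  assumes "1 < p" "0 \<le> x" "0 \<le> y"
  shows "x powr p + p * x powr (p - 1) * (y - x) \<le> y powr p"
  using powr_tangent_strict[OF assms] by (cases "x = y") auto

text \<open>The tangents at the convex combination are added with the weights \<open>t\<close> and
  \<open>1 - t\<close>; their linear parts cancel.\<close>

lemma powr_convex_combination:
  fixes a b p t :: real
  assumes "1 < p" "0 \<le> a" "0 \<le> b" "0 \<le> t" "t \<le> 1"
  shows "(t * a + (1 - t) * b) powr p \<le> t * a powr p + (1 - t) * b powr p"
proof -
  define m where "m = t * a + (1 - t) * b"
  have m: "0 \<le> m" using assms by (simp add: m_def)
  have "t * (m powr p + p * m powr (p - 1) * (a - m)) \<le> t * a powr p"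
    using assms m by (intro mult_left_mono powr_tangent) auto
  moreover have "(1 - t) * (m powr p + p * m powr (p - 1) * (b - m)) \<le> (1 - t) * b powr p"
    using assms m by (intro mult_left_mono powr_tangent) auto
  moreover have "t * (m powr p + p * m powr (p - 1) * (a - m)) + (1 - t) * (m powr p + p * m powr (p - 1) * (b - m))
    = m powr p + p * m powr (p - 1) * (t * a + (1 - t) * b - m)"
    by (simp add: algebra_simps)
  ultimately show ?thesis by (simp add: m_def)
qed

lemma powr_midpoint_strict:
  fixes a b p :: real
  assumes "1 < p" "0 \<le> a" "0 \<le> b" "a \<noteq> b"
  shows "((a + b) / 2) powr p < (a powr p + b powr p) / 2"
proof -
  define m where "m = (a + b) / 2"
  have "m powr p + p * m powr (p - 1) * (a - m) < a powr p"
    using assms by (intro powr_tangent_strict) (auto simp: m_def)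
  moreover have "m powr p + p * m powr (p - 1) * (b - m) < b powr p"
    using assms by (intro powr_tangent_strict) (auto simp: m_def)
  moreover have "p * m powr (p - 1) * (a - m) + p * m powr (p - 1) * (b - m) = 0"
    by (simp add: m_def field_simps)
  ultimately have "2 * m powr p < a powr p + b powr p" by linarith
  then show ?thesis by (simp add: m_def)
qed

text \<open>Convexity at the points \<open>norm a / t\<close> and \<open>norm b / (1 - t)\<close>.
  The free \<open>t\<close> matters: near 1 it leaves almost no loss on \<open>a\<close> and puts
  the cost on \<open>b\<close>. The absorption in the Hardy inequality and the continuity of the
  norm rely on this.\<close>

lemma norm_add_powr_le:
  fixes a b :: "'c::real_normed_vector"
  assumes "1 < p" "0 < t" "t < 1"
  shows "norm (a + b) powr p \<le> t powr (1 - p) * norm a powr p + (1 - t) powr (1 - p) * norm b powr p"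
proof -
  have "norm (a + b) powr p \<le> (t * (norm a / t) + (1 - t) * (norm b / (1 - t))) powr p"
    using assms norm_triangle_ineq[of a b] by (intro powr_mono2) auto
  also have "\<dots> \<le> t * (norm a / t) powr p + (1 - t) * (norm b / (1 - t)) powr p"
    using assms by (intro powr_convex_combination) auto
  also have "\<dots> = t powr (1 - p) * norm a powr p + (1 - t) powr (1 - p) * norm b powr p"
    using assms by (simp add: powr_divide powr_diff)
  finally show ?thesis .
qed

lemma norm_add_powr_le2:
  fixes a b :: "'c::real_normed_vector"
  assumes "1 < p"
  shows "norm (a + b) powr p \<le> 2 powr (p - 1) * (norm a powr p + norm b powr p)"
proof -
  have "(1 - 1 / 2 :: real) powr (1 - p) = 2 powr (p - 1)"
    by (simp add: powr_minus_divide powr_divide powr_diff)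
  then show ?thesis using norm_add_powr_le[of p "1/2" a b] assms by (simp add: algebra_simps powr_divide powr_diff)
qed

lemma norm_diff_powr_le2:
  fixes a b :: "'c::real_normed_vector"
  assumes "1 < p"
  shows "norm (a - b) powr p \<le> 2 powr (p - 1) * (norm a powr p + norm b powr p)"
  using norm_add_powr_le2[OF assms, of a "- b"] by simp

lemma norm_add_powr_le_eps:
  fixes e p :: real
  assumes "1 < p" "0 < e"
  obtains C where "0 < C"
    "\<And>a b :: 'c::real_normed_vector. norm (a + b) powr p \<le> (1 + e) * norm a powr p + C * norm b powr p"
proof -
  \<comment> \<open>Solves \<open>t powr (1 - p) = 1 + e\<close>, the coefficient wanted for
    \<open>a\<close>; \<open>p > 1\<close> puts it below 1.\<close>
  define t where "t = (1 + e) powr (- 1 / (p - 1))"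
  have t: "0 < t" "t < 1" using assms by (auto simp: t_def powr_less_one)
  have "- (1 / (p - 1)) * (1 - p) = 1" using assms by (simp add: field_simps)
  then have te: "t powr (1 - p) = 1 + e"
    using assms by (simp add: t_def powr_powr)
  show ?thesis
    by (rule that[of "(1 - t) powr (1 - p)"]) (use t te norm_add_powr_le[OF assms(1) t] in auto)
qed

text \<open>Young's inequality without the sharp constant: the larger of \<open>b\<close> and
  \<open>e * a\<close> replaces the smaller. The parameter is taken small in continuity arguments,
  and large when \<open>e powr (1 - p)\<close> has to be small.\<close>

lemma mult_powr_le_eps:
  fixes a b e p :: real
  assumes "1 < p" "0 < e" "0 \<le> a" "0 \<le> b"
  shows "a powr (p - 1) * b \<le> e * a powr p + e powr (1 - p) * b powr p"
proof (cases "b \<le> e * a")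
  case True
  have "a powr (p - 1) * b \<le> a powr (p - 1) * (e * a)"
    using True by (intro mult_left_mono) auto
  also have "\<dots> = e * a powr p" using assms by (cases "a = 0") (auto simp: powr_diff)
  finally show ?thesis by (smt (verit) mult_nonneg_nonneg powr_ge_zero)
next
  case False
  then have b: "0 < b" "a \<le> b / e" using assms by (auto simp: field_simps mult_less_0_iff) (smt (verit) mult_nonneg_nonneg)
  have "a powr (p - 1) * b \<le> (b / e) powr (p - 1) * b"
    using b assms by (intro mult_right_mono powr_mono2) auto
  also have "\<dots> = e powr (1 - p) * b powr p" using assms b by (simp add: powr_divide powr_diff)
  finally show ?thesis using assms by (smt (verit) mult_nonneg_nonneg powr_ge_zero)
qed

text \<open>Cauchy-Schwarz reduces the claim to the scalar tangent at \<open>norm a\<close>. At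
  \<open>a = 0\<close> the gradient term vanishes whatever the exponent \<open>p - 2\<close>
  does.\<close>

lemma norm_powr_tangent:
  fixes a b :: "'c::real_inner"
  assumes "1 < p"
  shows "norm a powr p + p * ((norm a powr (p - 2) *\<^sub>R a) \<bullet> b) \<le> norm (a + b) powr p"
proof (cases "a = 0")
  case False
  have "(norm a powr (p - 2) *\<^sub>R a) \<bullet> b = norm a powr (p - 2) * (a \<bullet> (a + b) - norm a ^ 2)"
    by (simp add: algebra_simps power2_norm_eq_inner)
  also have "\<dots> \<le> norm a powr (p - 2) * (norm a * norm (a + b) - norm a ^ 2)"
    by (intro mult_left_mono diff_right_mono norm_cauchy_schwarz) auto
  also have "\<dots> = norm a powr (p - 1) * (norm (a + b) - norm a)"
    using False by (simp add: powr_diff power2_eq_square field_simps)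
  finally have "p * ((norm a powr (p - 2) *\<^sub>R a) \<bullet> b) \<le> p * norm a powr (p - 1) * (norm (a + b) - norm a)"
    using assms by (simp add: mult.assoc)
  also have "norm a powr p + \<dots> \<le> norm (a + b) powr p"
    by (rule powr_tangent) (use assms in auto)
  finally show ?thesis by simp
qed (use assms in auto)

text \<open>Strictness has two sources: for equal norms the triangle inequality is strict because
  the norm comes from an inner product, for different norms the scalar power is strictly
  convex.\<close>

lemma norm_midpoint_strict:
  fixes a b :: "'c::real_inner"
  assumes "1 < p" "a \<noteq> b"
  shows "norm ((a + b) /\<^sub>R 2) powr p < (norm a powr p + norm b powr p) / 2"
proof (cases "norm a = norm b")
  case True
  have "norm (a + b) \<noteq> norm a + norm b"
    using norm_triangle_eq[of a b] True assms by auto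
  then have "norm (a + b) < norm a + norm b" using norm_triangle_ineq[of a b] by simp
  then have "norm ((a + b) /\<^sub>R 2) < norm b" using True by simp
  then have "norm ((a + b) /\<^sub>R 2) powr p < norm b powr p" using assms by (intro powr_less_mono2) auto
  then show ?thesis using True by simp
next
  case False
  have "norm ((a + b) /\<^sub>R 2) powr p \<le> ((norm a + norm b) / 2) powr p"
    using norm_triangle_ineq[of a b] assms by (intro powr_mono2) auto
  also have "\<dots> < (norm a powr p + norm b powr p) / 2"
    using False assms by (intro powr_midpoint_strict) auto
  finally show ?thesis .
qed

text \<open>Off the diagonal the midpoint defect is bounded below on the compact set
  \<open>\<bar>a\<bar>\<^sup>p + \<bar>b\<bar>\<^sup>p = 1\<close>, and both sides are homogeneous of degree \<open>p\<close>.\<close>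

lemma uniform_convexity_powr:
  fixes e p :: real
  assumes "1 < p" "0 < e"
  obtains C where "0 < C" "\<And>a b :: 'c::euclidean_space. norm (a - b) powr p \<le> e * (norm a powr p + norm b powr p)
      + C * ((norm a powr p + norm b powr p) / 2 - norm ((a + b) /\<^sub>R 2) powr p)"
proof -
  define S where "S z = norm (fst z) powr p + norm (snd z) powr p" for z :: "'c \<times> 'c"
  define D where "D z = S z / 2 - norm ((fst z + snd z) /\<^sub>R 2) powr p" for z :: "'c \<times> 'c"
  define E where "E z = norm (fst z - snd z) powr p" for z :: "'c \<times> 'c"
  define K where "K = {z. S z = 1 \<and> E z \<ge> e}"
  have contS: "continuous_on UNIV S" and contD: "continuous_on UNIV D" and contE: "continuous_on UNIV E"
    unfolding S_def D_def E_def using assms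
    by (auto intro!: continuous_intros continuous_on_powr')
  have D0: "0 \<le> D z" for z
    unfolding D_def S_def using norm_midpoint_strict[OF assms(1), of "fst z" "snd z"]
    by (cases "fst z = snd z") (auto simp: scaleR_2[symmetric] less_imp_le)
  have E2: "E z \<le> 2 powr (p - 1) * S z" for z
    unfolding E_def S_def by (rule norm_diff_powr_le2[OF assms(1)])
  have "closed K"
  proof -
    have "K = S -` {1} \<inter> E -` {e..}" by (auto simp: K_def)
    then show ?thesis using contS contE by (auto intro!: closed_Int closed_vimage)
  qed
  moreover have "bounded K"
  proof (rule boundedI)
    fix z assume "z \<in> K"
    then have "norm (fst z) powr p \<le> 1" "norm (snd z) powr p \<le> 1"
      unfolding K_def S_def by (auto) (smt (verit) powr_ge_zero)+
    then have "norm (fst z) \<le> 1" "norm (snd z) \<le> 1"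
      using assms powr_less_mono2[of p 1 "norm (fst z)"] powr_less_mono2[of p 1 "norm (snd z)"]
      by (smt (verit) powr_one_eq_one)+
    then show "norm z \<le> 2" using norm_Pair_le[of "fst z" "snd z"] by simp
  qed
  ultimately have K: "compact K" by (simp add: compact_eq_bounded_closed)
  have "\<exists>d>0. \<forall>z\<in>K. d \<le> D z"
  proof (cases "K = {}")
    case False
    obtain z where z: "z \<in> K" "\<And>y. y \<in> K \<Longrightarrow> D z \<le> D y"
      using continuous_attains_inf[OF K False continuous_on_subset[OF contD]] by auto
    have "0 < D z"
    proof -
      have "fst z \<noteq> snd z" using z(1) assms by (auto simp: K_def E_def)
      from norm_midpoint_strict[OF assms(1) this] show ?thesis by (simp add: D_def S_def)
    qed
    then show ?thesis using z by blast
  qed (auto intro: exI[of _ 1])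
  then obtain d where d: "0 < d" "\<And>z. z \<in> K \<Longrightarrow> d \<le> D z" by blast
  \<comment> \<open>On \<open>K\<close> the left-hand side is at most
    \<open>2 powr (p - 1) = C * d\<close>; outside \<open>K\<close> the term with \<open>e\<close>
    suffices alone.\<close>
  define C where "C = 2 powr (p - 1) / d"
  have C: "0 < C" using d by (simp add: C_def)
  have unit: "E z \<le> e * S z + C * D z" if "S z = 1" for z
  proof (cases "z \<in> K")
    case True
    have "E z \<le> 2 powr (p - 1)" using E2[of z] that by simp
    also have "\<dots> = C * d" using d by (simp add: C_def)
    also have "\<dots> \<le> C * D z" using d(2)[OF True] C by simp
    finally show ?thesis using that assms by simp
  next
    case False
    then have "E z \<le> e" using that by (simp add: K_def)
    moreover have "0 \<le> C * D z" using C D0[of z] by simp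
    ultimately show ?thesis using that by simp
  qed
  have all: "E z \<le> e * S z + C * D z" for z
  proof (cases "S z = 0")
    case True
    then have "norm (fst z) powr p = 0" "norm (snd z) powr p = 0"
      unfolding S_def by (simp_all add: add_nonneg_eq_0_iff)
    then have "z = 0" by (simp add: prod_eq_iff)
    then show ?thesis using assms by (simp add: E_def S_def D_def)
  next
    case False
    moreover have "0 \<le> S z" by (simp add: S_def)
    ultimately have S: "0 < S z" by simp
    define r where "r = S z powr (- 1 / p)"
    have r: "0 < r" using S by (simp add: r_def)
    have rp: "r powr p = 1 / S z" using S assms powr_minus_divide[of "S z" 1] unfolding r_def powr_powr by simp
    have hS: "S (r *\<^sub>R z) = r powr p * S z" using r by (simp add: S_def powr_mult algebra_simps)
    have "r *\<^sub>R fst z - r *\<^sub>R snd z = r *\<^sub>R (fst z - snd z)"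
      by (rule scaleR_diff_right[symmetric])
    then have hE: "E (r *\<^sub>R z) = r powr p * E z" using r
      by (simp only: E_def fst_scaleR snd_scaleR norm_scaleR) (simp add: powr_mult)
    have "(r *\<^sub>R fst z + r *\<^sub>R snd z) /\<^sub>R 2 = r *\<^sub>R ((fst z + snd z) /\<^sub>R 2)"
      by (simp add: algebra_simps)
    then have "norm ((r *\<^sub>R fst z + r *\<^sub>R snd z) /\<^sub>R 2) powr p
        = r powr p * norm ((fst z + snd z) /\<^sub>R 2) powr p"
      using r by (simp only: norm_scaleR powr_mult abs_ge_zero norm_ge_zero mult_nonneg_nonneg)
    then have hD: "D (r *\<^sub>R z) = r powr p * D z"
      by (simp only: D_def hS fst_scaleR snd_scaleR) (simp add: algebra_simps)
    have "E (r *\<^sub>R z) \<le> e * S (r *\<^sub>R z) + C * D (r *\<^sub>R z)"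
      using unit[of "r *\<^sub>R z"] S rp hS by simp
    then have "r powr p * E z \<le> r powr p * (e * S z + C * D z)" unfolding hS hE hD by (simp add: algebra_simps)
    then show ?thesis using r by simp
  qed
  show ?thesis by (rule that[OF C]) (use all[of "(a, b)" for a b] in \<open>simp add: E_def S_def D_def\<close>)
qed

section \<open>The spaces \<open>L\<^sup>p\<close>\<close>

definition Lp_space :: "real \<Rightarrow> 'x measure \<Rightarrow> ('x \<Rightarrow> 'c::euclidean_space) set" where
  "Lp_space p M = {f \<in> borel_measurable M. integrable M (\<lambda>x. norm (f x) powr p)}"

text \<open>The p-th power of the norm rather than the norm itself, so that integrals simply add up;
  the price is a factor \<open>2 powr (p - 1)\<close> in the triangle inequality.\<close>

definition Lp_int :: "real \<Rightarrow> 'x measure \<Rightarrow> ('x \<Rightarrow> 'c::euclidean_space) \<Rightarrow> real" where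
  "Lp_int p M f = (\<integral>x. norm (f x) powr p \<partial>M)"

lemma Lp_measurable: "f \<in> Lp_space p M \<Longrightarrow> f \<in> borel_measurable M"
  and Lp_integrable: "f \<in> Lp_space p M \<Longrightarrow> integrable M (\<lambda>x. norm (f x) powr p)"
  by (auto simp: Lp_space_def)

lemma Lp_int_nonneg [simp]: "0 \<le> Lp_int p M f"
  by (simp add: Lp_int_def)

lemma nn_integral_Lp:
  "f \<in> Lp_space p M \<Longrightarrow> (\<integral>\<^sup>+x. ennreal (norm (f x) powr p) \<partial>M) = ennreal (Lp_int p M f)"
  unfolding Lp_int_def by (intro nn_integral_eq_integral Lp_integrable) auto

lemma Lp_spaceI_nn:
  assumes "f \<in> borel_measurable M" "(\<integral>\<^sup>+x. ennreal (norm (f x) powr p) \<partial>M) < \<infinity>"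
  shows "f \<in> Lp_space p M"
  unfolding Lp_space_def using assms by (auto intro!: integrableI_nonneg)

lemma Lp_space_le:
  assumes "f \<in> borel_measurable M" "integrable M h" "\<And>x. norm (f x) powr p \<le> h x"
  shows "f \<in> Lp_space p M" "Lp_int p M f \<le> (\<integral>x. h x \<partial>M)"
proof -
  have [measurable]: "f \<in> borel_measurable M" by fact
  show f: "f \<in> Lp_space p M"
    unfolding Lp_space_def
    by (auto intro!: Bochner_Integration.integrable_bound[OF assms(2)] AE_I2 order_trans[OF assms(3) abs_ge_self])
  show "Lp_int p M f \<le> (\<integral>x. h x \<partial>M)"
    unfolding Lp_int_def by (intro integral_mono Lp_integrable f assms)
qed

lemma Lp_scaleR: "f \<in> Lp_space p M \<Longrightarrow> (\<lambda>x. c *\<^sub>R f x) \<in> Lp_space p M"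
  by (auto simp: Lp_space_def powr_mult)

lemma Lp_int_scaleR: "Lp_int p M (\<lambda>x. c *\<^sub>R f x) = \<bar>c\<bar> powr p * Lp_int p M f"
  by (simp add: Lp_int_def powr_mult)

lemma Lp_add:
  assumes "1 < p" "f \<in> Lp_space p M" "g \<in> Lp_space p M"
  shows "(\<lambda>x. f x + g x) \<in> Lp_space p M"
    "Lp_int p M (\<lambda>x. f x + g x) \<le> 2 powr (p - 1) * (Lp_int p M f + Lp_int p M g)"
proof -
  note [measurable] = assms(2,3)[THEN Lp_measurable]
  have i: "integrable M (\<lambda>x. 2 powr (p - 1) * (norm (f x) powr p + norm (g x) powr p))"
    using assms(2,3) by (intro integrable_mult_right Bochner_Integration.integrable_add Lp_integrable)
  have e: "(\<integral>x. 2 powr (p - 1) * (norm (f x) powr p + norm (g x) powr p) \<partial>M) = 2 powr (p - 1) * (Lp_int p M f + Lp_int p M g)"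
    unfolding Lp_int_def using assms(2,3)[THEN Lp_integrable] by simp
  note * = Lp_space_le[OF _ i, of "\<lambda>x. f x + g x" p]
  show "(\<lambda>x. f x + g x) \<in> Lp_space p M"
    by (rule *) (auto intro: norm_add_powr_le2 assms)
  show "Lp_int p M (\<lambda>x. f x + g x) \<le> 2 powr (p - 1) * (Lp_int p M f + Lp_int p M g)"
    unfolding e[symmetric] by (rule *) (auto intro: norm_add_powr_le2 assms)
qed

lemma Lp_diff:
  assumes "1 < p" "f \<in> Lp_space p M" "g \<in> Lp_space p M"
  shows "(\<lambda>x. f x - g x) \<in> Lp_space p M"
    "Lp_int p M (\<lambda>x. f x - g x) \<le> 2 powr (p - 1) * (Lp_int p M f + Lp_int p M g)"
  using Lp_add[OF assms(1,2) Lp_scaleR[OF assms(3), of "- 1"]]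
    Lp_int_scaleR[of p M "-1" g] by simp_all

lemma Lp_int_diff_commute: "Lp_int p M (\<lambda>x. f x - g x) = Lp_int p M (\<lambda>x. g x - f x)"
  by (simp add: Lp_int_def norm_minus_commute)

lemma Lp_int_triangle:
  assumes "1 < p" "f \<in> Lp_space p M" "g \<in> Lp_space p M" "h \<in> Lp_space p M"
  shows "Lp_int p M (\<lambda>x. f x - h x) \<le> 2 powr (p - 1) * (Lp_int p M (\<lambda>x. f x - g x) + Lp_int p M (\<lambda>x. g x - h x))"
  using Lp_add(2)[OF assms(1) Lp_diff(1)[OF assms(1,2,3)] Lp_diff(1)[OF assms(1,3,4)]] by simp

text \<open>Fatou's lemma for the p-th powers. It yields membership of the limit together with its
  bound, so nothing about the integrability of \<open>G\<close> has to be known beforehand.\<close>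

lemma Lp_fatou:
  assumes F: "\<And>n. F n \<in> Lp_space p M" and G[measurable]: "G \<in> borel_measurable M"
    and lim: "AE x in M. (\<lambda>n. F n x) \<longlonglongrightarrow> G x" and p: "1 < p"
    and c: "\<forall>\<^sub>F n in sequentially. Lp_int p M (F n) \<le> c"
  shows "G \<in> Lp_space p M" "Lp_int p M G \<le> c"
proof -
  note [measurable] = F[THEN Lp_measurable]
  obtain n where "Lp_int p M (F n) \<le> c" using eventually_happens[OF c] by auto
  then have c0: "0 \<le> c" by (rule order_trans[OF Lp_int_nonneg])
  have "(\<integral>\<^sup>+x. ennreal (norm (G x) powr p) \<partial>M) = (\<integral>\<^sup>+x. liminf (\<lambda>n. ennreal (norm (F n x) powr p)) \<partial>M)"
  proof (intro nn_integral_cong_AE, use lim in eventually_elim)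
    fix x assume "(\<lambda>n. F n x) \<longlonglongrightarrow> G x"
    then have "(\<lambda>n. ennreal (norm (F n x) powr p)) \<longlonglongrightarrow> ennreal (norm (G x) powr p)"
      using p by (intro tendsto_ennrealI tendsto_powr' tendsto_norm) auto
    then show "ennreal (norm (G x) powr p) = liminf (\<lambda>n. ennreal (norm (F n x) powr p))"
      using lim_imp_Liminf[OF trivial_limit_sequentially] by metis
  qed
  also have "\<dots> \<le> liminf (\<lambda>n. \<integral>\<^sup>+x. ennreal (norm (F n x) powr p) \<partial>M)"
    by (rule nn_integral_liminf) auto
  also have "\<dots> \<le> ennreal c"
    unfolding nn_integral_Lp[OF F] using c
    by (intro Liminf_le) (auto elim!: eventually_mono intro: ennreal_leI)
  finally have *: "(\<integral>\<^sup>+x. ennreal (norm (G x) powr p) \<partial>M) \<le> ennreal c" .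
  then show "G \<in> Lp_space p M" by (intro Lp_spaceI_nn) (auto simp: le_less_trans ennreal_less_top top_unique)
  then show "Lp_int p M G \<le> c" using * c0 by (simp add: nn_integral_Lp)
qed

section \<open>Completeness and continuity of the norm\<close>

definition Lp_Cauchy :: "real \<Rightarrow> 'x measure \<Rightarrow> (nat \<Rightarrow> 'x \<Rightarrow> 'c::euclidean_space) \<Rightarrow> bool" where
  "Lp_Cauchy p M F \<longleftrightarrow> (\<forall>e>0. \<exists>N. \<forall>m\<ge>N. \<forall>n\<ge>N. Lp_int p M (\<lambda>x. F m x - F n x) < e)"

lemma Lp_AE_convergent_subseq:
  assumes F: "\<And>n. F n \<in> Lp_space p M" and p: "1 < p" and C: "Lp_Cauchy p M F"
  obtains r :: "nat \<Rightarrow> nat" where "strict_mono r" "AE x in M. convergent (\<lambda>n. F (r n) x)"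
proof -
  note [measurable] = F[THEN Lp_measurable]
  \<comment> \<open>The second factor is the inverse of the weight \<open>2 powr (p * k)\<close>
    used in \<open>h\<close>, and the first makes the weighted increments summable. A weighted
    increment below 1 then means an increment of norm below \<open>(1/2)^k\<close>.\<close>
  define d where "d k = (1 / 2) ^ k * (1 / 2) powr (p * real k)" for k :: nat
  have "\<exists>r. \<forall>k. (\<forall>m\<ge>r k. Lp_int p M (\<lambda>x. F m x - F (r k) x) < d k) \<and> r k < r (Suc k)"
  proof (rule dependent_nat_choice)
    have ex: "\<exists>N. \<forall>m\<ge>N. \<forall>n\<ge>N. Lp_int p M (\<lambda>x. F m x - F n x) < d k" for k
      using C unfolding Lp_Cauchy_def by (auto simp: d_def)
    show "\<exists>r. \<forall>m\<ge>r. Lp_int p M (\<lambda>x. F m x - F r x) < d 0" using ex by blast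
    show "\<exists>s. (\<forall>m\<ge>s. Lp_int p M (\<lambda>x. F m x - F s x) < d (Suc k)) \<and> r < s" for r k
    proof -
      obtain N where "\<forall>m\<ge>N. \<forall>n\<ge>N. Lp_int p M (\<lambda>x. F m x - F n x) < d (Suc k)" using ex by blast
      then show ?thesis by (intro exI[of _ "max N (Suc r)"]) auto
    qed
  qed
  then obtain r where r: "\<And>k m. m \<ge> r k \<Longrightarrow> Lp_int p M (\<lambda>x. F m x - F (r k) x) < d k" "\<And>k. r k < r (Suc k)"
    by blast
  define h where "h k x = 2 powr (p * real k) * norm (F (r (Suc k)) x - F (r k) x) powr p" for k x
  have [measurable]: "h k \<in> borel_measurable M" for k unfolding h_def by measurable
  have hk: "(\<integral>\<^sup>+x. ennreal (h k x) \<partial>M) \<le> ennreal ((1/2)^k)" for k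
  proof -
    have L: "(\<lambda>x. F (r (Suc k)) x - F (r k) x) \<in> Lp_space p M" by (intro Lp_diff p F)
    have "(\<integral>\<^sup>+x. ennreal (h k x) \<partial>M) = ennreal (2 powr (p * real k)) * ennreal (Lp_int p M (\<lambda>x. F (r (Suc k)) x - F (r k) x))"
      unfolding h_def nn_integral_Lp[OF L, symmetric]
      by (simp add: ennreal_mult nn_integral_cmult)
    also have "\<dots> \<le> ennreal (2 powr (p * real k)) * ennreal (d k)"
      using r(1)[of k "r (Suc k)"] r(2)[of k] by (intro mult_left_mono ennreal_leI) auto
    also have "\<dots> = ennreal ((1/2)^k)"
      by (simp add: ennreal_mult[symmetric] d_def powr_divide)
    finally show ?thesis .
  qed
  have "(\<integral>\<^sup>+x. (\<Sum>k. ennreal (h k x)) \<partial>M) = (\<Sum>k. \<integral>\<^sup>+x. ennreal (h k x) \<partial>M)"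
    by (rule nn_integral_suminf) auto
  also have "\<dots> \<le> (\<Sum>k. ennreal ((1/2)^k))" by (intro suminf_le hk) auto
  also have "\<dots> = ennreal (\<Sum>k. (1/2)^k)" by (intro suminf_ennreal2) (auto simp: summable_geometric)
  also have "\<dots> < \<infinity>" by simp
  finally have "AE x in M. (\<Sum>k. ennreal (h k x)) \<noteq> \<infinity>"
    by (intro nn_integral_PInf_AE) auto
  then have "AE x in M. convergent (\<lambda>n. F (r n) x)"
  proof eventually_elim
    fix x assume "(\<Sum>k. ennreal (h k x)) \<noteq> \<infinity>"
    then have "summable (\<lambda>k. h k x)"
      by (intro summable_suminf_not_top) (auto simp: h_def)
    then have "(\<lambda>k. h k x) \<longlonglongrightarrow> 0" by (rule summable_LIMSEQ_zero)
    then have ev: "\<forall>\<^sub>F k in sequentially. h k x < 1" by (rule order_tendstoD) auto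
    have le: "norm (F (r (Suc k)) x - F (r k) x) \<le> (1/2)^k" if "h k x < 1" for k
    proof -
      have eq: "2 powr (p * real k) = (2 ^ k) powr p"
        by (simp add: powr_powr powr_realpow[symmetric] mult.commute)
      then have "(2 ^ k * norm (F (r (Suc k)) x - F (r k) x)) powr p < 1 powr p"
        using that by (simp add: h_def powr_mult)
      then have "2 ^ k * norm (F (r (Suc k)) x - F (r k) x) < 1"
        using p powr_mono2[of p 1 "2 ^ k * norm (F (r (Suc k)) x - F (r k) x)"] by (force simp: not_less[symmetric])
      then show ?thesis by (simp add: field_simps power_divide)
    qed
    have "summable (\<lambda>k. F (r (Suc k)) x - F (r k) x)"
      by (rule summable_comparison_test_ev[OF _ summable_geometric[of "1/2::real"]])
        (use ev le in \<open>auto elim!: eventually_mono\<close>)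
    then have "convergent (\<lambda>n. \<Sum>k<n. F (r (Suc k)) x - F (r k) x)" by (simp add: summable_iff_convergent)
    moreover have "(\<Sum>k<n. F (r (Suc k)) x - F (r k) x) = F (r n) x - F (r 0) x" for n
      by (rule sum_lessThan_telescope)
    ultimately show "convergent (\<lambda>n. F (r n) x)"
      by (simp add: convergent_diff_const_right_iff)
  qed
  then show ?thesis using r(2) by (intro that[of r]) (auto simp: strict_mono_Suc_iff)
qed

text \<open>Fatou in one index of the Cauchy condition gives convergence of the whole sequence. The
  almost everywhere convergent subsequence is returned as well, because \<open>has_D1p_grad\<close>
  asks for pointwise limits.\<close>

lemma Lp_complete:
  assumes F: "\<And>n. F n \<in> Lp_space p M" and p: "1 < p" and C: "Lp_Cauchy p M F"
  obtains G r where "G \<in> Lp_space p M" "(\<lambda>n. Lp_int p M (\<lambda>x. F n x - G x)) \<longlonglongrightarrow> 0"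
    "strict_mono (r :: nat \<Rightarrow> nat)" "AE x in M. (\<lambda>n. F (r n) x) \<longlonglongrightarrow> G x"
proof -
  note [measurable] = F[THEN Lp_measurable]
  obtain r :: "nat \<Rightarrow> nat" where r: "strict_mono r" "AE x in M. convergent (\<lambda>n. F (r n) x)"
    by (rule Lp_AE_convergent_subseq[OF F p C])
  define G where "G x = lim (\<lambda>n. F (r n) x)" for x
  have [measurable]: "G \<in> borel_measurable M" unfolding G_def by measurable
  have lim: "AE x in M. (\<lambda>n. F (r n) x) \<longlonglongrightarrow> G x"
    using r(2) by eventually_elim (simp add: G_def convergent_LIMSEQ_iff)
  have e: "\<exists>N. \<forall>n\<ge>N. (\<lambda>x. F n x - G x) \<in> Lp_space p M \<and> Lp_int p M (\<lambda>x. F n x - G x) \<le> e" if "0 < e" for e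
  proof -
    have "\<exists>N. \<forall>m\<ge>N. \<forall>n\<ge>N. Lp_int p M (\<lambda>x. F m x - F n x) < e"
      using C that by (simp add: Lp_Cauchy_def)
    then obtain N where N: "\<And>m n. m \<ge> N \<Longrightarrow> n \<ge> N \<Longrightarrow> Lp_int p M (\<lambda>x. F m x - F n x) < e"
      by auto
    have "(\<lambda>x. F n x - G x) \<in> Lp_space p M \<and> Lp_int p M (\<lambda>x. F n x - G x) \<le> e" if n: "n \<ge> N" for n
    proof -
      have L: "(\<lambda>x. F n x - F (r k) x) \<in> Lp_space p M" for k by (intro Lp_diff p F)
      have "AE x in M. (\<lambda>k. F n x - F (r k) x) \<longlonglongrightarrow> F n x - G x"
        using lim by eventually_elim (intro tendsto_intros)
      moreover have "\<forall>\<^sub>F k in sequentially. Lp_int p M (\<lambda>x. F n x - F (r k) x) \<le> e"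
        using eventually_ge_at_top[of N]
      proof eventually_elim
        fix k assume "N \<le> k"
        then have "N \<le> r k" using seq_suble[OF r(1), of k] by linarith
        then show "Lp_int p M (\<lambda>x. F n x - F (r k) x) \<le> e" using N[OF n] by (simp add: less_imp_le)
      qed
      ultimately show ?thesis
        using Lp_fatou[OF L, where G = "\<lambda>x. F n x - G x" and c = e] p by auto
    qed
    then show ?thesis by blast
  qed
  obtain n where "(\<lambda>x. F n x - G x) \<in> Lp_space p M" using e[of 1] by auto
  from Lp_diff(1)[OF p F[of n] this] have G: "G \<in> Lp_space p M" by simp
  have "(\<lambda>n. Lp_int p M (\<lambda>x. F n x - G x)) \<longlonglongrightarrow> 0"
  proof (rule LIMSEQ_I)
    fix e :: real assume "0 < e"
    then show "\<exists>N. \<forall>n\<ge>N. norm (Lp_int p M (\<lambda>x. F n x - G x) - 0) < e"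
      using e[of "e/2"] by (force intro: le_less_trans)
  qed
  with G r(1) lim show ?thesis by (intro that)
qed

lemma Lp_CauchyI:
  assumes F: "\<And>n. F n \<in> Lp_space p M" and G: "G \<in> Lp_space p M" and p: "1 < p"
    and lim: "(\<lambda>n. Lp_int p M (\<lambda>x. F n x - G x)) \<longlonglongrightarrow> 0"
  shows "Lp_Cauchy p M F"
  unfolding Lp_Cauchy_def
proof (intro allI impI)
  fix e :: real assume e: "0 < e"
  define d where "d = e / (2 * 2 powr (p - 1))"
  have d: "0 < d" using e by (simp add: d_def)
  have "\<forall>\<^sub>F n in sequentially. Lp_int p M (\<lambda>x. F n x - G x) < d" using lim d by (rule order_tendstoD)
  then obtain N where N: "\<And>n. n \<ge> N \<Longrightarrow> Lp_int p M (\<lambda>x. F n x - G x) < d" by (auto simp: eventually_sequentially)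
  have "Lp_int p M (\<lambda>x. F m x - F n x) < e" if "m \<ge> N" "n \<ge> N" for m n
  proof -
    have "Lp_int p M (\<lambda>x. F m x - F n x) \<le> 2 powr (p - 1) * (Lp_int p M (\<lambda>x. F m x - G x) + Lp_int p M (\<lambda>x. F n x - G x))"
      using Lp_int_triangle[OF p F[of m] G F[of n]] by (simp add: Lp_int_diff_commute[of _ _ G])
    also have "\<dots> < 2 powr (p - 1) * (d + d)" using N that by (intro mult_strict_left_mono add_strict_mono) auto
    also have "\<dots> = e" by (simp add: d_def)
    finally show ?thesis .
  qed
  then show "\<exists>N. \<forall>m\<ge>N. \<forall>n\<ge>N. Lp_int p M (\<lambda>x. F m x - F n x) < e" by blast
qed

text \<open>A factor arbitrarily close to 1 in front of \<open>g\<close> is what the constant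
  \<open>2 powr (p - 1)\<close> cannot give; it makes the p-th powers continuous along convergent
  sequences.\<close>

lemma Lp_int_le_eps:
  assumes "1 < p" "0 < e"
  obtains C where "0 < C" "\<And>f g :: 'x \<Rightarrow> 'c::euclidean_space. f \<in> Lp_space p M \<Longrightarrow> g \<in> Lp_space p M \<Longrightarrow>
    Lp_int p M f \<le> (1 + e) * Lp_int p M g + C * Lp_int p M (\<lambda>x. f x - g x)"
proof -
  obtain C where C: "0 < C" "\<And>a b :: 'c. norm (a + b) powr p \<le> (1 + e) * norm a powr p + C * norm b powr p"
    by (rule norm_add_powr_le_eps[OF assms, where 'c = 'c]) blast
  have "Lp_int p M f \<le> (1 + e) * Lp_int p M g + C * Lp_int p M (\<lambda>x. f x - g x)"
    if f: "f \<in> Lp_space p M" and g: "g \<in> Lp_space p M" for f g :: "'x \<Rightarrow> 'c"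
  proof -
    have fg: "(\<lambda>x. f x - g x) \<in> Lp_space p M" by (intro Lp_diff assms f g)
    have "Lp_int p M f \<le> (\<integral>x. (1 + e) * norm (g x) powr p + C * norm (f x - g x) powr p \<partial>M)"
      unfolding Lp_int_def using C(2)[of "g x" "f x - g x" for x] f g fg
      by (intro integral_mono) (auto intro!: Lp_integrable)
    also have "\<dots> = (1 + e) * Lp_int p M g + C * Lp_int p M (\<lambda>x. f x - g x)"
      unfolding Lp_int_def using Lp_integrable[OF g] Lp_integrable[OF fg] by simp
    finally show ?thesis .
  qed
  with C(1) that show ?thesis by blast
qed

lemma Lp_int_tendsto:
  assumes F: "\<And>n. F n \<in> Lp_space p M" and G: "G \<in> Lp_space p M" and p: "1 < p"
    and lim: "(\<lambda>n. Lp_int p M (\<lambda>x. F n x - G x)) \<longlonglongrightarrow> 0"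
  shows "(\<lambda>n. Lp_int p M (F n)) \<longlonglongrightarrow> Lp_int p M G"
proof (rule LIMSEQ_I)
  fix d :: real assume d: "0 < d"
  define g where "g = Lp_int p M G"
  have g: "0 \<le> g" by (simp add: g_def)
  define e where "e = min 1 (d / (4 * (g + 1)))"
  have "e * (g + 1) \<le> d / (4 * (g + 1)) * (g + 1)"
    using g by (intro mult_right_mono) (auto simp: e_def)
  also have "\<dots> = d / 4" using g by (simp add: field_simps)
  finally have "e * (g + 1) \<le> d / 4" .
  then have e: "0 < e" "e \<le> 1" "e * (g + 1) \<le> d / 4"
    using d g by (simp_all add: e_def)
  obtain C where C: "0 < C" "\<And>f g :: 'a \<Rightarrow> 'b. f \<in> Lp_space p M \<Longrightarrow> g \<in> Lp_space p M \<Longrightarrow>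
    Lp_int p M f \<le> (1 + e) * Lp_int p M g + C * Lp_int p M (\<lambda>x. f x - g x)"
    by (rule Lp_int_le_eps[OF p e(1), where 'x = 'a and 'c = 'b and M = M]) blast
  have "\<forall>\<^sub>F n in sequentially. Lp_int p M (\<lambda>x. F n x - G x) < d / (8 * C)"
    by (rule order_tendstoD[OF lim]) (use d C in auto)
  then have "\<forall>\<^sub>F n in sequentially. norm (Lp_int p M (F n) - g) < d"
  proof eventually_elim
    fix n assume n: "Lp_int p M (\<lambda>x. F n x - G x) < d / (8 * C)"
    define a where "a = Lp_int p M (F n)"
    have n': "C * Lp_int p M (\<lambda>x. F n x - G x) < d / 8" using n C by (simp add: field_simps)
    have 1: "a \<le> (1 + e) * g + d / 8"
      using C(2)[OF F[of n] G] n' by (simp add: a_def g_def)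
    have 2: "g \<le> (1 + e) * a + d / 8"
      using C(2)[OF G F[of n]] n' by (simp add: a_def g_def Lp_int_diff_commute[of _ _ G])
    have eg: "e * g \<le> d / 4" using e by (simp add: distrib_left)
    \<comment> \<open>The second estimate has the factor \<open>1 + e\<close> on \<open>a\<close>,
      for which the only available bound is the first estimate.\<close>
    have "e * a \<le> e * ((1 + e) * g + d / 8)" using 1 e by (intro mult_left_mono) auto
    also have "\<dots> = e * g + e * (e * g) + e * (d / 8)" by (simp add: algebra_simps)
    also have "\<dots> \<le> d/4 + d/4 + d/8"
      using e eg d g order_trans[OF mult_left_le_one_le[of "e * g" e] eg] mult_left_le_one_le[of "d/8" e]
      by (intro add_mono) auto
    finally have "e * a \<le> d/4 + d/4 + d/8" .
    then show "norm (Lp_int p M (F n) - g) < d"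
      using 1 2 eg d unfolding a_def[symmetric] by (auto simp: algebra_simps abs_if)
  qed
  then show "\<exists>N. \<forall>n\<ge>N. norm (Lp_int p M (F n) - Lp_int p M G) < d"
    by (simp add: eventually_sequentially g_def)
qed

section \<open>Test functions\<close>

lemma GDERIV_unique:
  assumes "GDERIV f x :> D" "GDERIV f x :> D'"
  shows "D = D'"
proof -
  have "(\<lambda>h. h \<bullet> D) = (\<lambda>h. h \<bullet> D')"
    using assms unfolding gderiv_def by (rule has_derivative_unique)
  then have "h \<bullet> D = h \<bullet> D'" for h by (rule fun_cong)
  then show ?thesis using vector_eq_ldot[of D D'] by blast
qed

lemma classical_grad_eqI: "GDERIV f x :> D \<Longrightarrow> classical_grad f x = D"
  unfolding classical_grad_def by (rule the_equality) (auto intro: GDERIV_unique)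

lemma C_k_add: "C_k k f \<Longrightarrow> C_k k g \<Longrightarrow> C_k k (\<lambda>x. f x + g x)"
proof (induction k arbitrary: f g)
  case (Suc k)
  have "frechet_derivative (\<lambda>x. f x + g x) (at x) i
      = frechet_derivative f (at x) i + frechet_derivative g (at x) i" for x i
  proof -
    have "((\<lambda>x. f x + g x) has_derivative (\<lambda>h. frechet_derivative f (at x) h + frechet_derivative g (at x) h)) (at x)"
      using Suc.prems by (intro has_derivative_add) (auto simp: frechet_derivative_works)
    from frechet_derivative_at[OF this] show ?thesis by metis
  qed
  then show ?case using Suc by (auto intro!: differentiable_add Suc.IH)
qed (auto intro: continuous_on_add)

lemma C_k_cmult: "C_k k f \<Longrightarrow> C_k k (\<lambda>x. c * f x)"
proof (induction k arbitrary: f)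
  case (Suc k)
  have "frechet_derivative (\<lambda>x. c * f x) (at x) i = c * frechet_derivative f (at x) i" for x i
  proof -
    have "((\<lambda>x. c * f x) has_derivative (\<lambda>h. c * frechet_derivative f (at x) h)) (at x)"
      using Suc.prems by (intro has_derivative_mult_right) (auto simp: frechet_derivative_works)
    from frechet_derivative_at[OF this] show ?thesis by metis
  qed
  then show ?case using Suc by (auto intro!: differentiable_mult differentiable_const Suc.IH)
qed (auto intro: continuous_on_mult_left)

lemma C_k_zero: "C_k k (\<lambda>x. 0)"
  by (induction k) auto

lemma test_function_add:
  assumes "test_function f" "test_function g"
  shows "test_function (\<lambda>x. f x + g x)"
proof -
  have "bounded ({x. f x \<noteq> 0} \<union> {x. g x \<noteq> 0})"
    using assms by (simp add: test_function_def)
  then have "bounded {x. f x + g x \<noteq> 0}" by (rule bounded_subset) auto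
  with assms show ?thesis by (simp add: test_function_def C_k_add)
qed

lemma test_function_cmult:
  assumes "test_function f"
  shows "test_function (\<lambda>x. c * f x)"
proof -
  have "compact (closure {x. c * f x \<noteq> 0})"
    using assms by (cases "c = 0") (auto simp: test_function_def)
  with assms show ?thesis by (simp add: test_function_def C_k_cmult)
qed

lemma test_function_zero: "test_function (\<lambda>x. 0)"
  by (simp add: test_function_def C_k_zero)

lemma test_function_diff:
  "test_function f \<Longrightarrow> test_function g \<Longrightarrow> test_function (\<lambda>x. f x - g x)"
  using test_function_add[of f "\<lambda>x. -1 * g x"] test_function_cmult[of g "-1"] by simp

text \<open>Joins the two notions of derivative in the definitions: \<open>C_k\<close> speaks of
  Frechet derivatives in basis directions, \<open>classical_grad\<close> of the representing vector,
  which is assembled here from the partial derivatives.\<close>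

lemma test_function_GDERIV:
  assumes "test_function f"
  shows "GDERIV f x :> classical_grad f x"
proof -
  have "C_k (Suc 0) f" using assms by (simp add: test_function_def)
  then have d: "(f has_derivative frechet_derivative f (at x)) (at x)"
    by (simp add: frechet_derivative_works)
  define D where "D = (\<Sum>i\<in>Basis. frechet_derivative f (at x) i *\<^sub>R i)"
  have "frechet_derivative f (at x) = (\<lambda>h. h \<bullet> D)"
  proof
    fix h :: 'a
    interpret linear "frechet_derivative f (at x)" using d by (rule has_derivative_linear)
    have "frechet_derivative f (at x) h = frechet_derivative f (at x) (\<Sum>i\<in>Basis. (h \<bullet> i) *\<^sub>R i)"
      by (simp add: euclidean_representation)
    also have "\<dots> = h \<bullet> D" by (simp add: sum scale D_def inner_sum_right mult.commute)
    finally show "frechet_derivative f (at x) h = h \<bullet> D" .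
  qed
  with d have "GDERIV f x :> D" by (simp add: gderiv_def)
  with classical_grad_eqI show ?thesis by metis
qed

lemma test_function_grad_add:
  assumes "test_function f" "test_function g"
  shows "classical_grad (\<lambda>x. f x + g x) x = classical_grad f x + classical_grad g x"
  by (intro classical_grad_eqI GDERIV_add test_function_GDERIV assms)

lemma test_function_grad_cmult:
  assumes "test_function f"
  shows "classical_grad (\<lambda>x. c * f x) x = c *\<^sub>R classical_grad f x"
  using GDERIV_mult[OF GDERIV_const test_function_GDERIV[OF assms], of c x]
  by (intro classical_grad_eqI) simp

lemma test_function_grad_diff:
  assumes "test_function f" "test_function g"
  shows "classical_grad (\<lambda>x. f x - g x) x = classical_grad f x - classical_grad g x"
  by (intro classical_grad_eqI GDERIV_diff test_function_GDERIV assms)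

lemma test_function_continuous:
  assumes "test_function f"
  shows "continuous_on UNIV f"
proof -
  have "C_k 0 f" using assms unfolding test_function_def by blast
  then show ?thesis by simp
qed

lemma test_function_continuous_grad:
  assumes "test_function f"
  shows "continuous_on UNIV (classical_grad f)"
proof -
  have "C_k (Suc 0) f" using assms by (simp add: test_function_def)
  then have c: "continuous_on UNIV (\<lambda>x. frechet_derivative f (at x) i)" if "i \<in> Basis" for i
    using that by simp
  have "frechet_derivative f (at x) i = classical_grad f x \<bullet> i" for x i
    using frechet_derivative_at[OF test_function_GDERIV[OF assms, of x, unfolded gderiv_def]]
    by (metis inner_commute)
  then have "continuous_on UNIV (\<lambda>x. classical_grad f x \<bullet> i)" if "i \<in> Basis" for i
    using c[OF that] by simp
  then show ?thesis by (subst continuous_on_componentwise) blast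
qed

text \<open>Off the closed support the function is zero on an open set, so its gradient vanishes
  there too and one compact set serves both.\<close>

lemma test_function_support:
  assumes "test_function f"
  obtains K where "compact K" "\<And>x. x \<notin> K \<Longrightarrow> f x = 0" "\<And>x. x \<notin> K \<Longrightarrow> classical_grad f x = 0"
proof (rule that[of "closure {x. f x \<noteq> 0}"])
  let ?K = "closure {x. f x \<noteq> 0}"
  show "compact ?K" using assms by (simp add: test_function_def)
  show f: "f x = 0" if "x \<notin> ?K" for x using that closure_subset[of "{x. f x \<noteq> 0}"] by blast
  show "classical_grad f x = 0" if "x \<notin> ?K" for x
  proof (rule classical_grad_eqI)
    have "((\<lambda>x. 0) has_derivative (\<lambda>h. 0)) (at x)" by simp
    then have "(f has_derivative (\<lambda>h. 0)) (at x)"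
    proof (rule has_derivative_transform_within_open)
      show "open (- ?K)" "x \<in> - ?K" using that by (auto simp: open_Compl)
      show "0 = f y" if "y \<in> - ?K" for y using f[of y] that by (metis ComplD)
    qed
    then show "GDERIV f x :> 0" by (simp add: gderiv_def)
  qed
qed

lemma continuous_UNIV_measurable:
  assumes "continuous_on UNIV f"
  shows "f \<in> borel_measurable borel" "f \<in> borel_measurable lborel" "f \<in> borel_measurable lebesgue"
  using borel_measurable_continuous_onI[OF assms] by (auto intro: measurable_completion)

lemmas test_function_measurable [measurable] = continuous_UNIV_measurable[OF test_function_continuous]
lemmas test_function_grad_measurable [measurable] = continuous_UNIV_measurable[OF test_function_continuous_grad]

lemma continuous_compact_support_Lp:
  fixes f :: "'a::euclidean_space \<Rightarrow> 'c::euclidean_space"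
  assumes f: "continuous_on UNIV f" and K: "compact K" "\<And>x. x \<notin> K \<Longrightarrow> f x = 0" and p: "0 < p"
  shows "f \<in> Lp_space p lebesgue"
proof -
  have cp: "continuous_on UNIV (\<lambda>x. norm (f x) powr p)"
    using f p by (intro continuous_on_powr' continuous_intros) auto
  note [measurable] = continuous_UNIV_measurable(2)[OF this]
  from cp have "integrable lborel (\<lambda>x. indicator K x *\<^sub>R (norm (f x) powr p))"
    using K(1) by (intro borel_integrable_compact) (auto intro: continuous_on_subset)
  also have "(\<lambda>x. indicator K x *\<^sub>R (norm (f x) powr p)) = (\<lambda>x. norm (f x) powr p)"
    using K(2) by (auto simp: fun_eq_iff indicator_def)
  finally show ?thesis
    using continuous_UNIV_measurable(3)[OF f] by (simp add: Lp_space_def integrable_completion)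
qed

lemma test_function_Lp:
  assumes "test_function f" "0 < p"
  shows "f \<in> Lp_space p lebesgue" "classical_grad f \<in> Lp_space p lebesgue"
proof -
  obtain K where K: "compact K" "\<And>x. x \<notin> K \<Longrightarrow> f x = 0" "\<And>x. x \<notin> K \<Longrightarrow> classical_grad f x = 0"
    by (rule test_function_support[OF assms(1)]) blast
  show "f \<in> Lp_space p lebesgue"
    by (rule continuous_compact_support_Lp[OF test_function_continuous[OF assms(1)] K(1,2) assms(2)])
  show "classical_grad f \<in> Lp_space p lebesgue"
    by (rule continuous_compact_support_Lp[OF test_function_continuous_grad[OF assms(1)] K(1,3) assms(2)])
qed

section \<open>Jensen's inequality and estimates of increments by the gradient\<close>

lemma jensen_powr:
  fixes f :: "'x \<Rightarrow> real"
  assumes "finite_measure M" and m: "0 < measure M (space M)" and p: "1 < p"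
    and f: "integrable M f" and fp: "integrable M (\<lambda>x. \<bar>f x\<bar> powr p)"
  shows "\<bar>\<integral>x. f x \<partial>M\<bar> powr p \<le> measure M (space M) powr (p - 1) * (\<integral>x. \<bar>f x\<bar> powr p \<partial>M)"
proof -
  interpret finite_measure M by fact
  define m where "m = measure M (space M)"
  define a where "a = (\<integral>x. \<bar>f x\<bar> \<partial>M) / m"
  have m0: "0 < m" using m by (simp add: m_def)
  have a: "0 \<le> a" "(\<integral>x. \<bar>f x\<bar> \<partial>M) = m * a" using m0 by (auto simp: a_def)
  \<comment> \<open>The tangent at the mean \<open>a\<close> of the absolute value is integrated;
    its linear part has integral zero.\<close>
  have "(\<integral>x. a powr p + p * a powr (p - 1) * (\<bar>f x\<bar> - a) \<partial>M) \<le> (\<integral>x. \<bar>f x\<bar> powr p \<partial>M)"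
    using f fp p a by (intro integral_mono powr_tangent) auto
  also have "(\<integral>x. a powr p + p * a powr (p - 1) * (\<bar>f x\<bar> - a) \<partial>M) = m * a powr p"
    using f a(2) by (simp add: m_def algebra_simps)
  finally have le: "m * a powr p \<le> (\<integral>x. \<bar>f x\<bar> powr p \<partial>M)" .
  have "\<bar>\<integral>x. f x \<partial>M\<bar> powr p \<le> (m * a) powr p"
    using p integral_abs_bound[of M f] a(2) by (intro powr_mono2) auto
  also have "\<dots> = m powr (p - 1) * (m * a powr p)"
    using m0 a by (simp add: powr_mult powr_diff)
  also have "\<dots> \<le> m powr (p - 1) * (\<integral>x. \<bar>f x\<bar> powr p \<partial>M)"
    using le by (intro mult_left_mono) auto
  finally show ?thesis by (simp add: m_def)
qed

text \<open>The right-hand side is a nonnegative integral, so that Tonelli's theorem and changes of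
  variables apply later without integrability proofs.\<close>

lemma jensen_powr_compact:
  fixes f :: "'a::euclidean_space \<Rightarrow> real"
  assumes S: "compact S" "0 < measure lborel S" and p: "1 < p" and f: "continuous_on S f"
  shows "ennreal (\<bar>\<integral>x. indicator S x *\<^sub>R f x \<partial>lborel\<bar> powr p)
    \<le> ennreal (measure lborel S powr (p - 1)) * (\<integral>\<^sup>+x. indicator S x * ennreal (\<bar>f x\<bar> powr p) \<partial>lborel)"
proof -
  let ?M = "restrict_space lborel S"
  have Sb: "S \<in> sets borel" using S(1) by (simp add: borel_closed compact_imp_closed)
  have cp: "continuous_on S (\<lambda>x. \<bar>f x\<bar> powr p)"
    using f p by (intro continuous_on_powr' continuous_intros) auto
  have i: "integrable ?M f" "integrable ?M (\<lambda>x. \<bar>f x\<bar> powr p)"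
    using Sb borel_integrable_compact[OF S(1) f] borel_integrable_compact[OF S(1) cp]
    by (simp_all add: integrable_restrict_space)
  have fin: "finite_measure ?M"
    using emeasure_compact_finite[OF S(1)] Sb
    by (intro finite_measureI) (auto simp: emeasure_restrict_space)
  have ms: "measure ?M (space ?M) = measure lborel S"
    using Sb by (simp add: measure_restrict_space)
  have "ennreal (\<bar>\<integral>x. f x \<partial>?M\<bar> powr p) \<le> ennreal (measure lborel S powr (p - 1) * (\<integral>x. \<bar>f x\<bar> powr p \<partial>?M))"
    using jensen_powr[OF fin _ p i] S(2) ms by (intro ennreal_leI) simp
  also have "\<dots> = ennreal (measure lborel S powr (p - 1)) * (\<integral>\<^sup>+x. ennreal (\<bar>f x\<bar> powr p) \<partial>?M)"
    using i(2) by (simp add: nn_integral_eq_integral ennreal_mult)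
  finally show ?thesis using Sb by (simp add: integral_restrict_space nn_integral_restrict_space mult.commute)
qed

lemma nn_integral_lborel_affine:
  fixes f :: "'a::euclidean_space \<Rightarrow> ennreal"
  assumes [measurable]: "f \<in> borel_measurable borel" and c: "0 < c"
  shows "(\<integral>\<^sup>+x. f (t + c *\<^sub>R x) \<partial>lborel) = ennreal (1 / c ^ DIM('a)) * (\<integral>\<^sup>+x. f x \<partial>lborel)"
proof -
  have "(\<integral>\<^sup>+x. f x \<partial>lborel) = (\<integral>\<^sup>+x. f x \<partial>density (distr lborel borel (\<lambda>x. t + c *\<^sub>R x)) (\<lambda>_. \<bar>c\<bar>^DIM('a)))"
    using lborel_affine[of c t] c by simp
  also have "\<dots> = ennreal (c ^ DIM('a)) * (\<integral>\<^sup>+x. f (t + c *\<^sub>R x) \<partial>lborel)"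
    using c by (simp add: nn_integral_density nn_integral_distr nn_integral_cmult)
  finally show ?thesis
    using c by (simp add: mult.assoc[symmetric] ennreal_mult[symmetric])
qed

lemma nn_integral_lborel_translate:
  fixes f :: "'a::euclidean_space \<Rightarrow> ennreal"
  assumes "f \<in> borel_measurable borel"
  shows "(\<integral>\<^sup>+x. f (x + t) \<partial>lborel) = (\<integral>\<^sup>+x. f x \<partial>lborel)"
  using nn_integral_lborel_affine[OF assms, of 1 t] by (simp add: add.commute)

text \<open>The fundamental theorem of calculus along the segment, then Jensen on the unit interval.
  The vector \<open>z\<close> may depend on \<open>x\<close>: translations take it constant, the
  Hardy inequality takes \<open>z = x\<close>.\<close>

lemma test_function_increment:
  assumes f: "test_function f" and p: "1 < p"
  shows "ennreal (\<bar>f (x + z) - f x\<bar> powr p)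
    \<le> (\<integral>\<^sup>+s. indicator {0..1} s * ennreal (norm z powr p * norm (classical_grad f (x + s *\<^sub>R z)) powr p) \<partial>lborel)"
proof -
  define g where "g s = z \<bullet> classical_grad f (x + s *\<^sub>R z)" for s :: real
  have cg: "continuous_on {0..1} g"
    unfolding g_def by (intro continuous_intros continuous_on_compose2[OF test_function_continuous_grad[OF f]]) auto
  have "((\<lambda>s. f (x + s *\<^sub>R z)) has_vector_derivative g s) (at s within {0..1})" for s
  proof -
    have "((\<lambda>s. f (x + s *\<^sub>R z)) has_derivative (\<lambda>h. (h *\<^sub>R z) \<bullet> classical_grad f (x + s *\<^sub>R z))) (at s within {0..1})"
      by (rule has_derivative_compose[OF _ test_function_GDERIV[OF f, unfolded gderiv_def]])
        (auto intro!: derivative_eq_intros)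
    then show ?thesis by (simp add: has_vector_derivative_def g_def)
  qed
  from integral_FTC_atLeastAtMost[OF _ this cg]
  have "f (x + z) - f x = (\<integral>s. indicator {0..1} s *\<^sub>R g s \<partial>lborel)" by simp
  then have "ennreal (\<bar>f (x + z) - f x\<bar> powr p) \<le> (\<integral>\<^sup>+s. indicator {0..1} s * ennreal (\<bar>g s\<bar> powr p) \<partial>lborel)"
    using jensen_powr_compact[OF compact_Icc _ p cg] by simp
  also have "\<dots> \<le> (\<integral>\<^sup>+s. indicator {0..1} s * ennreal (norm z powr p * norm (classical_grad f (x + s *\<^sub>R z)) powr p) \<partial>lborel)"
  proof (intro nn_integral_mono mult_left_mono ennreal_leI)
    fix s
    have "\<bar>g s\<bar> powr p \<le> (norm z * norm (classical_grad f (x + s *\<^sub>R z))) powr p"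
      unfolding g_def using p by (intro powr_mono2 Cauchy_Schwarz_ineq2) auto
    then show "\<bar>g s\<bar> powr p \<le> norm z powr p * norm (classical_grad f (x + s *\<^sub>R z)) powr p"
      by (simp add: powr_mult)
  qed auto
  finally show ?thesis .
qed

abbreviation grad_int :: "real \<Rightarrow> ('a::euclidean_space \<Rightarrow> real) \<Rightarrow> real" where
  "grad_int p f \<equiv> Lp_int p lebesgue (classical_grad f)"

lemma nn_integral_grad:
  assumes "test_function f" "0 < p"
  shows "(\<integral>\<^sup>+x. ennreal (norm (classical_grad f x) powr p) \<partial>lborel) = ennreal (grad_int p f)"
  using nn_integral_Lp[OF test_function_Lp(2)[OF assms]] by (simp add: nn_integral_completion)

text \<open>After Tonelli the inner integral is taken over a translate of the gradient, hence does
  not depend on \<open>s\<close>.\<close>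

lemma test_function_translation:
  assumes f: "test_function f" and p: "1 < p"
  shows "(\<integral>\<^sup>+x. ennreal (\<bar>f (x + z) - f x\<bar> powr p) \<partial>lborel) \<le> ennreal (norm z powr p * grad_int p f)"
proof -
  note [measurable] = test_function_measurable[OF f] test_function_grad_measurable[OF f]
  have "(\<integral>\<^sup>+x. ennreal (\<bar>f (x + z) - f x\<bar> powr p) \<partial>lborel)
    \<le> (\<integral>\<^sup>+x. \<integral>\<^sup>+s. indicator {0..1} s * ennreal (norm z powr p * norm (classical_grad f (x + s *\<^sub>R z)) powr p) \<partial>lborel \<partial>lborel)"
    by (intro nn_integral_mono test_function_increment f p)
  also have "\<dots> = (\<integral>\<^sup>+s. \<integral>\<^sup>+x. indicator {0..1} s * ennreal (norm z powr p * norm (classical_grad f (x + s *\<^sub>R z)) powr p) \<partial>lborel \<partial>lborel)"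
    by (rule lborel_pair.Fubini'[symmetric]) measurable
  also have "\<dots> = (\<integral>\<^sup>+s. indicator {0..1} (s::real) * ennreal (norm z powr p * grad_int p f) \<partial>lborel)"
  proof (rule nn_integral_cong)
    fix s :: real
    have "(\<integral>\<^sup>+x. indicator {0..1} s * ennreal (norm z powr p * norm (classical_grad f (x + s *\<^sub>R z)) powr p) \<partial>lborel)
       = indicator {0..1} s * (ennreal (norm z powr p) * (\<integral>\<^sup>+x. ennreal (norm (classical_grad f (x + s *\<^sub>R z)) powr p) \<partial>lborel))"
      by (simp add: ennreal_mult nn_integral_cmult)
    also have "(\<integral>\<^sup>+x. ennreal (norm (classical_grad f (x + s *\<^sub>R z)) powr p) \<partial>lborel) = ennreal (grad_int p f)"
      using f p by (subst nn_integral_lborel_translate[where f = "\<lambda>x. ennreal (norm (classical_grad f x) powr p)"])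
        (auto simp: nn_integral_grad)
    finally show "(\<integral>\<^sup>+x. indicator {0..1} s * ennreal (norm z powr p * norm (classical_grad f (x + s *\<^sub>R z)) powr p) \<partial>lborel)
      = indicator {0..1} s * ennreal (norm z powr p * grad_int p f)" by (simp add: ennreal_mult)
  qed
  also have "\<dots> = ennreal (norm z powr p * grad_int p f)"
    by (simp add: nn_integral_multc)
  finally show ?thesis .
qed

section \<open>A Hardy inequality and the decaying weight\<close>

lemma powr_minus_le_1:
  fixes x b :: real
  assumes "1 \<le> x" "0 \<le> b"
  shows "x powr - b \<le> 1"
  using powr_mono[of "- b" 0 x] assms by auto

abbreviation hardy_int :: "real \<Rightarrow> ('a::euclidean_space \<Rightarrow> real) \<Rightarrow> ennreal" where
  "hardy_int p f \<equiv> (\<integral>\<^sup>+x. ennreal ((1 + norm x) powr - p * \<bar>f x\<bar> powr p) \<partial>lborel)"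

text \<open>The increment estimate with \<open>z = x\<close>: the weight cancels the factor
  \<open>norm x powr p\<close>, and dilations by \<open>1 + s\<close> with \<open>s \<ge> 0\<close>
  do not increase the integral.\<close>

lemma dilation_increment:
  assumes f: "test_function f" and p: "1 < p"
  shows "(\<integral>\<^sup>+x. ennreal ((1 + norm x) powr - p * \<bar>f (2 *\<^sub>R x) - f x\<bar> powr p) \<partial>lborel) \<le> ennreal (grad_int p f)"
proof -
  note [measurable] = test_function_measurable[OF f] test_function_grad_measurable[OF f]
  have "(\<integral>\<^sup>+x. ennreal ((1 + norm x) powr - p * \<bar>f (2 *\<^sub>R x) - f x\<bar> powr p) \<partial>lborel)
    \<le> (\<integral>\<^sup>+x. \<integral>\<^sup>+s. indicator {0..1} s * ennreal (norm (classical_grad f ((1 + s) *\<^sub>R x)) powr p) \<partial>lborel \<partial>lborel)"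
  proof (rule nn_integral_mono)
    fix x :: 'a
    have "ennreal ((1 + norm x) powr - p * \<bar>f (2 *\<^sub>R x) - f x\<bar> powr p)
        = ennreal ((1 + norm x) powr - p) * ennreal (\<bar>f (x + x) - f x\<bar> powr p)"
      by (simp add: ennreal_mult scaleR_2)
    also have "\<dots> \<le> ennreal ((1 + norm x) powr - p) *
        (\<integral>\<^sup>+s. indicator {0..1} s * ennreal (norm x powr p * norm (classical_grad f (x + s *\<^sub>R x)) powr p) \<partial>lborel)"
      by (intro mult_left_mono test_function_increment f p) auto
    also have "\<dots> = (\<integral>\<^sup>+s. ennreal ((1 + norm x) powr - p) *
        (indicator {0..1} s * ennreal (norm x powr p * norm (classical_grad f (x + s *\<^sub>R x)) powr p)) \<partial>lborel)"
      by (rule nn_integral_cmult[symmetric]) measurable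
    also have "\<dots> \<le> (\<integral>\<^sup>+s. indicator {0..1} s * ennreal (norm (classical_grad f ((1 + s) *\<^sub>R x)) powr p) \<partial>lborel)"
    proof (rule nn_integral_mono)
      fix s :: real
      have "(1 + norm x) powr - p * norm x powr p = (norm x / (1 + norm x)) powr p"
        by (simp add: powr_divide powr_minus_divide)
      also have "\<dots> \<le> 1 powr p"
        using p by (intro powr_mono2) (auto simp: divide_le_eq_1 add_pos_nonneg)
      finally have "(1 + norm x) powr - p * (norm x powr p * norm (classical_grad f (x + s *\<^sub>R x)) powr p)
          \<le> norm (classical_grad f (x + s *\<^sub>R x)) powr p"
        by (simp add: mult.assoc[symmetric] mult_left_le_one_le)
      then have "ennreal ((1 + norm x) powr - p) * ennreal (norm x powr p * norm (classical_grad f (x + s *\<^sub>R x)) powr p)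
          \<le> ennreal (norm (classical_grad f ((1 + s) *\<^sub>R x)) powr p)"
        by (simp add: ennreal_mult[symmetric] scaleR_add_left ennreal_leI del: powr_mult)
      then show "ennreal ((1 + norm x) powr - p) * (indicator {0..1} s * ennreal (norm x powr p * norm (classical_grad f (x + s *\<^sub>R x)) powr p))
          \<le> indicator {0..1} s * ennreal (norm (classical_grad f ((1 + s) *\<^sub>R x)) powr p)"
        by (simp add: indicator_def)
    qed
    finally show "ennreal ((1 + norm x) powr - p * \<bar>f (2 *\<^sub>R x) - f x\<bar> powr p)
      \<le> (\<integral>\<^sup>+s. indicator {0..1} s * ennreal (norm (classical_grad f ((1 + s) *\<^sub>R x)) powr p) \<partial>lborel)" .
  qed
  also have "\<dots> = (\<integral>\<^sup>+s. \<integral>\<^sup>+x. indicator {0..1} s * ennreal (norm (classical_grad f ((1 + s) *\<^sub>R x)) powr p) \<partial>lborel \<partial>lborel)"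
    by (rule lborel_pair.Fubini'[symmetric]) measurable
  also have "\<dots> \<le> (\<integral>\<^sup>+s. indicator {0..1} (s::real) * ennreal (grad_int p f) \<partial>lborel)"
  proof (rule nn_integral_mono)
    fix s :: real
    show "(\<integral>\<^sup>+x. indicator {0..1} s * ennreal (norm (classical_grad f ((1 + s) *\<^sub>R x)) powr p) \<partial>lborel)
      \<le> indicator {0..1} s * ennreal (grad_int p f)"
    proof (cases "s \<in> {0..1}")
      case True
      then have s: "1 \<le> 1 + s" by simp
      have "(\<integral>\<^sup>+x. ennreal (norm (classical_grad f ((1 + s) *\<^sub>R x)) powr p) \<partial>lborel)
          = ennreal (1 / (1 + s) ^ DIM('a)) * ennreal (grad_int p f)"
        using nn_integral_lborel_affine[of "\<lambda>x. ennreal (norm (classical_grad f x) powr p)" "1 + s" 0] s f p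
        by (simp add: nn_integral_grad)
      also have "\<dots> \<le> 1 * ennreal (grad_int p f)"
        using one_le_power[OF s, of "DIM('a)"] s by (intro mult_right_mono) auto
      finally show ?thesis using True by simp
    qed simp
  qed
  also have "\<dots> = ennreal (grad_int p f)" by (simp add: nn_integral_multc)
  finally show ?thesis .
qed

text \<open>Since \<open>p < N\<close>, the dilation \<open>x \<mapsto> 2x\<close> contracts the weighted norm by the factor
  \<open>2\<^bsup>(p-N)/p\<^esup>\<close>, up to the increment \<open>f(2x) - f(x)\<close>; the weight \<open>1/(1+\<bar>x\<bar>)\<close> instead of \<open>1/\<bar>x\<bar>\<close>
  makes everything finite from the start.\<close>

lemma hardy_inequality:
  assumes p: "1 < p" "p < real DIM('a::euclidean_space)"
  obtains C where "0 < C" "\<And>f :: 'a \<Rightarrow> real. test_function f \<Longrightarrow>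
    hardy_int p f \<le> ennreal (C * grad_int p f)"
proof -
  define N where "N = real DIM('a)"
  \<comment> \<open>This makes \<open>t powr (1 - p)\<close> equal to
    \<open>2 powr ((N - p) / 2)\<close>: half of the gain \<open>2 powr (p - N)\<close> of the
    dilation pays for splitting off the increment, the other half keeps \<open>th\<close> below
    1.\<close>
  define t :: real where "t = 2 powr (- (N - p) / (2 * (p - 1)))"
  have t: "0 < t" "t < 1" using p by (auto simp: t_def N_def powr_less_one divide_less_0_iff)
  define th where "th = t powr (1 - p) * 2 powr (p - N)"
  have "- (N - p) / (2 * (p - 1)) * (1 - p) = (N - p) / 2"
    using p by (simp add: field_simps)
  then have "- (N - p) / (2 * (p - 1)) * (1 - p) + (p - N) = (p - N) / 2"
    by (simp add: field_simps)
  then have th_eq: "th = 2 powr ((p - N) / 2)"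
    unfolding th_def t_def powr_powr powr_add[symmetric] by (simp only:)
  have th: "0 < th" "th < 1" using p unfolding th_eq by (auto simp: N_def powr_less_one)
  define c where "c = (1 - t) powr (1 - p)"
  have c: "0 < c" using t by (simp add: c_def)
  have "hardy_int p f \<le> ennreal (c / (1 - th) * grad_int p f)"
    if f: "test_function f" for f :: "'a \<Rightarrow> real"
  proof -
    note [measurable] = test_function_measurable[OF f] test_function_grad_measurable[OF f]
    define A where "A = hardy_int p f"
    have "A \<le> (\<integral>\<^sup>+x. ennreal (norm (f x) powr p) \<partial>lebesgue)"
      unfolding A_def nn_integral_completion
    proof (intro nn_integral_mono ennreal_leI)
      fix x :: 'a
      have "(1 + norm x) powr - p \<le> 1" using p by (intro powr_minus_le_1) auto
      then show "(1 + norm x) powr - p * \<bar>f x\<bar> powr p \<le> norm (f x) powr p"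
        by (simp add: mult_left_le_one_le)
    qed
    also have "\<dots> = ennreal (Lp_int p lebesgue f)"
      using p by (intro nn_integral_Lp test_function_Lp f) auto
    finally have Afin: "A < \<infinity>" by (simp add: le_less_trans)
    define a where "a = enn2real A"
    have a: "A = ennreal a" "0 \<le> a" using Afin by (auto simp: a_def)
    \<comment> \<open>Comparing the weights at \<open>x\<close> and \<open>2x\<close> costs
      \<open>2 powr p\<close>; the Jacobian gains \<open>2 powr (- N)\<close>.\<close>
    have dil: "(\<integral>\<^sup>+x. ennreal ((1 + norm x) powr - p * \<bar>f (2 *\<^sub>R x)\<bar> powr p) \<partial>lborel) \<le> ennreal (2 powr (p - N)) * A"
    proof -
      have "(\<integral>\<^sup>+x. ennreal ((1 + norm x) powr - p * \<bar>f (2 *\<^sub>R x)\<bar> powr p) \<partial>lborel)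
        \<le> (\<integral>\<^sup>+x. ennreal (2 powr p * ((1 + norm (0 + 2 *\<^sub>R x)) powr - p * \<bar>f (0 + 2 *\<^sub>R x)\<bar> powr p)) \<partial>lborel)"
      proof (intro nn_integral_mono ennreal_leI)
        fix x :: 'a
        have "(1 + norm x) powr - p \<le> ((1 + 2 * norm x) / 2) powr - p"
          using p by (intro powr_mono2') (auto intro!: add_pos_nonneg)
        also have "\<dots> = 2 powr p * (1 + 2 * norm x) powr - p"
          by (simp add: powr_divide powr_minus_divide)
        finally show "(1 + norm x) powr - p * \<bar>f (2 *\<^sub>R x)\<bar> powr p \<le> 2 powr p * ((1 + norm (0 + 2 *\<^sub>R x)) powr - p * \<bar>f (0 + 2 *\<^sub>R x)\<bar> powr p)"
          by (simp add: mult.assoc[symmetric] mult_right_mono)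
      qed
      also have "\<dots> = ennreal (1 / 2 ^ DIM('a)) * (\<integral>\<^sup>+x. ennreal (2 powr p * ((1 + norm x) powr - p * \<bar>f x\<bar> powr p)) \<partial>lborel)"
        by (rule nn_integral_lborel_affine[where f = "\<lambda>x. ennreal (2 powr p * ((1 + norm x) powr - p * \<bar>f x\<bar> powr p))"]) auto
      also have "\<dots> = ennreal (1 / 2 ^ DIM('a)) * (ennreal (2 powr p) * A)"
        unfolding A_def by (subst nn_integral_cmult[symmetric]) (auto simp: ennreal_mult)
      also have "\<dots> = ennreal (2 powr (p - N)) * A"
        by (simp add: mult.assoc[symmetric] ennreal_mult[symmetric] N_def powr_diff powr_realpow)
      finally show ?thesis .
    qed
    have "A \<le> (\<integral>\<^sup>+x. ennreal (t powr (1 - p)) * ennreal ((1 + norm x) powr - p * \<bar>f (2 *\<^sub>R x)\<bar> powr p)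
        + ennreal c * ennreal ((1 + norm x) powr - p * \<bar>f (2 *\<^sub>R x) - f x\<bar> powr p) \<partial>lborel)"
      unfolding A_def
    proof (rule nn_integral_mono)
      fix x :: 'a
      have "\<bar>f x\<bar> powr p \<le> t powr (1 - p) * \<bar>f (2 *\<^sub>R x)\<bar> powr p + c * \<bar>f (2 *\<^sub>R x) - f x\<bar> powr p"
        using norm_add_powr_le[OF p(1) t, of "f (2 *\<^sub>R x)" "f x - f (2 *\<^sub>R x)"] by (simp add: c_def abs_minus_commute)
      then have "(1 + norm x) powr - p * \<bar>f x\<bar> powr p
          \<le> (1 + norm x) powr - p * (t powr (1 - p) * \<bar>f (2 *\<^sub>R x)\<bar> powr p + c * \<bar>f (2 *\<^sub>R x) - f x\<bar> powr p)"
        by (rule mult_left_mono) simp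
      also have "\<dots> = t powr (1 - p) * ((1 + norm x) powr - p * \<bar>f (2 *\<^sub>R x)\<bar> powr p)
          + c * ((1 + norm x) powr - p * \<bar>f (2 *\<^sub>R x) - f x\<bar> powr p)"
        by (simp add: algebra_simps)
      finally show "ennreal ((1 + norm x) powr - p * \<bar>f x\<bar> powr p)
        \<le> ennreal (t powr (1 - p)) * ennreal ((1 + norm x) powr - p * \<bar>f (2 *\<^sub>R x)\<bar> powr p)
        + ennreal c * ennreal ((1 + norm x) powr - p * \<bar>f (2 *\<^sub>R x) - f x\<bar> powr p)"
        using c by (simp add: ennreal_mult[symmetric] ennreal_plus[symmetric] ennreal_leI del: ennreal_plus)
    qed
    also have "\<dots> = ennreal (t powr (1 - p)) * (\<integral>\<^sup>+x. ennreal ((1 + norm x) powr - p * \<bar>f (2 *\<^sub>R x)\<bar> powr p) \<partial>lborel)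
        + ennreal c * (\<integral>\<^sup>+x. ennreal ((1 + norm x) powr - p * \<bar>f (2 *\<^sub>R x) - f x\<bar> powr p) \<partial>lborel)"
      by (simp add: nn_integral_add nn_integral_cmult)
    also have "\<dots> \<le> ennreal (t powr (1 - p)) * (ennreal (2 powr (p - N)) * A) + ennreal c * ennreal (grad_int p f)"
      by (intro add_mono mult_left_mono dil dilation_increment f p) auto
    also have "\<dots> = ennreal (th * a + c * grad_int p f)"
      using a c th by (simp add: th_def ennreal_mult ennreal_plus mult.assoc)
    finally have "ennreal a \<le> ennreal (th * a + c * grad_int p f)" unfolding a(1) .
    moreover have "0 \<le> th * a + c * grad_int p f" using th c a(2) by (intro add_nonneg_nonneg mult_nonneg_nonneg) auto
    ultimately have "a \<le> th * a + c * grad_int p f" by (simp only: ennreal_le_iff)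
    then have "a \<le> c / (1 - th) * grad_int p f" using th by (simp add: field_simps)
    then show ?thesis using a by (simp add: A_def[symmetric] ennreal_leI)
  qed
  then show ?thesis using c th by (intro that[of "c / (1 - th)"]) auto
qed

section \<open>Bounds and integrability of the decaying weight\<close>

lemma decay_weight_pos: "0 < decay_weight \<alpha> x"
  by (simp add: decay_weight_def add_pos_nonneg)

lemma decay_weight_le_1: "decay_weight \<alpha> x \<le> 1"
  by (simp add: decay_weight_def divide_simps add_pos_nonneg)

lemma decay_weight_measurable [measurable]: "decay_weight \<alpha> \<in> borel_measurable borel"
  unfolding decay_weight_def[abs_def] by measurable

text \<open>Brings the weight to powers of \<open>1 + norm x\<close>, the base of the Hardy weight
  with which it is compared later.\<close>

lemma decay_weight_le:
  fixes x :: "'a::euclidean_space"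
  assumes "0 < \<alpha>"
  shows "decay_weight \<alpha> x \<le> 2 powr (real DIM('a) + \<alpha>) * (1 + norm x) powr - (real DIM('a) + \<alpha>)"
proof -
  define b where "b = real DIM('a) + \<alpha>"
  have b: "0 < b" using assms by (simp add: b_def add_pos_pos)
  have "(1 + norm x) powr b \<le> (2 * max 1 (norm x)) powr b"
    using b by (intro powr_mono2) auto
  also have "\<dots> = 2 powr b * max 1 (norm x) powr b" by (simp add: powr_mult)
  also have "max 1 (norm x) powr b \<le> 1 + norm x powr b" by (simp add: max_def)
  finally have "(1 + norm x) powr b \<le> 2 powr b * (1 + norm x powr b)" by simp
  moreover have "0 < 1 + norm x powr b" by (simp add: add_pos_nonneg)
  moreover have "0 < 1 + norm x" by (simp add: add_pos_nonneg)
  then have "0 < (1 + norm x) powr b" by simp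
  moreover have "1 / Q \<le> c * (1 / P)" if "P \<le> c * Q" "0 < Q" "0 < P" for P Q c :: real
    using that by (simp add: field_simps)
  ultimately show ?thesis
    unfolding decay_weight_def b_def[symmetric] powr_minus_divide by blast
qed

text \<open>A dilation by 2 does the work of polar coordinates. The truncated integrals satisfy
  \<open>F (Suc k) \<le> c + th * F k\<close>, where \<open>th = 2 powr - \<alpha>\<close> combines
  the homogeneity factor \<open>2 powr - b\<close> with the Jacobian. They stay below the fixed
  point \<open>c / (1 - th)\<close>, and Fatou removes the truncation.\<close>

lemma nn_integral_decay_finite:
  assumes a: "0 < \<alpha>"
  shows "(\<integral>\<^sup>+x. ennreal (decay_weight \<alpha> (x::'a::euclidean_space)) \<partial>lborel) < \<infinity>"
proof -
  define b where "b = real DIM('a) + \<alpha>"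
  have b: "0 < b" using a by (simp add: b_def add_pos_pos)
  define F where "F k = (\<integral>\<^sup>+x. ennreal (indicator {x::'a. 1 \<le> norm x \<and> norm x \<le> 2 ^ k} x * norm x powr - b) \<partial>lborel)" for k :: nat
  define c where "c = measure lborel (cball (0::'a) 2)"
  define th where "th = 2 powr - \<alpha>"
  have th: "0 < th" "th < 1" using a by (auto simp: th_def powr_less_one)
  have c: "emeasure lborel (cball (0::'a) 2) = ennreal c"
    unfolding c_def using emeasure_compact_finite[OF compact_cball, of "0::'a" 2]
    by (intro emeasure_eq_ennreal_measure) auto
  have rec: "F (Suc k) \<le> ennreal c + ennreal th * F k" for k
  proof -
    have "F (Suc k) \<le> (\<integral>\<^sup>+x. indicator (cball (0::'a) 2) x
        + ennreal (indicator {x::'a. 1 \<le> norm (x /\<^sub>R 2) \<and> norm (x /\<^sub>R 2) \<le> 2 ^ k} x * norm x powr - b) \<partial>lborel)"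
      unfolding F_def
    proof (rule nn_integral_mono)
      fix x :: 'a
      have "norm x powr - b \<le> 1" if "1 \<le> norm x"
        using that b by (intro powr_minus_le_1) auto
      then show "ennreal (indicator {x::'a. 1 \<le> norm x \<and> norm x \<le> 2 ^ Suc k} x * norm x powr - b)
        \<le> indicator (cball (0::'a) 2) x + ennreal (indicator {x::'a. 1 \<le> norm (x /\<^sub>R 2) \<and> norm (x /\<^sub>R 2) \<le> 2 ^ k} x * norm x powr - b)"
        by (auto simp: indicator_def ennreal_le_1 field_simps)
    qed
    also have "\<dots> = ennreal c + (\<integral>\<^sup>+x. ennreal (indicator {x::'a. 1 \<le> norm (x /\<^sub>R 2) \<and> norm (x /\<^sub>R 2) \<le> 2 ^ k} x * norm x powr - b) \<partial>lborel)"
      by (subst nn_integral_add) (auto simp: c intro!: borel_measurable_indicator)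
    also have "(\<integral>\<^sup>+x. ennreal (indicator {x::'a. 1 \<le> norm (x /\<^sub>R 2) \<and> norm (x /\<^sub>R 2) \<le> 2 ^ k} x * norm x powr - b) \<partial>lborel)
      = ennreal (2 powr - b) * (\<integral>\<^sup>+x. ennreal (indicator {x::'a. 1 \<le> norm x \<and> norm x \<le> 2 ^ k} (0 + (1/2) *\<^sub>R x) * norm (0 + (1/2) *\<^sub>R x) powr - b) \<partial>lborel)"
      by (subst nn_integral_cmult[symmetric])
        (auto intro!: nn_integral_cong simp: indicator_def powr_divide powr_minus_divide ennreal_mult[symmetric])
    also have "(\<integral>\<^sup>+x. ennreal (indicator {x::'a. 1 \<le> norm x \<and> norm x \<le> 2 ^ k} (0 + (1/2) *\<^sub>R x) * norm (0 + (1/2) *\<^sub>R x) powr - b) \<partial>lborel)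
      = ennreal (1 / (1/2) ^ DIM('a)) * F k"
      unfolding F_def by (rule nn_integral_lborel_affine) auto
    also have "ennreal (2 powr - b) * (ennreal (1 / (1/2) ^ DIM('a)) * F k) = ennreal th * F k"
      by (simp add: mult.assoc[symmetric] ennreal_mult[symmetric] th_def b_def powr_diff powr_minus_divide powr_add powr_realpow power_divide)
    finally show ?thesis .
  qed
  have bound: "F k \<le> ennreal (c / (1 - th))" for k
  proof (induction k)
    case 0
    have "F 0 \<le> (\<integral>\<^sup>+x. indicator (cball (0::'a) 2) x \<partial>lborel)"
      unfolding F_def by (rule nn_integral_mono) (auto simp: indicator_def)
    also have "\<dots> = ennreal c" by (simp add: c)
    also have "\<dots> \<le> ennreal (c / (1 - th))" using th by (intro ennreal_leI) (simp add: field_simps c_def)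
    finally show ?case .
  next
    case (Suc k)
    have c0: "0 \<le> c" by (simp add: c_def)
    have "F (Suc k) \<le> ennreal c + ennreal th * ennreal (c / (1 - th))"
      by (rule order_trans[OF rec]) (intro add_left_mono mult_left_mono Suc, simp)
    also have "\<dots> = ennreal (c + th * (c / (1 - th)))"
      using th c0 by (simp add: ennreal_mult[symmetric] ennreal_plus[symmetric] del: ennreal_plus)
    also have "c + th * (c / (1 - th)) = c / (1 - th)" using th by (simp add: field_simps)
    finally show ?case .
  qed
  have "(\<integral>\<^sup>+x. ennreal (decay_weight \<alpha> (x::'a)) \<partial>lborel)
    \<le> (\<integral>\<^sup>+x. indicator (cball (0::'a) 2) x + liminf (\<lambda>k. ennreal (indicator {x::'a. 1 \<le> norm x \<and> norm x \<le> 2 ^ k} x * norm x powr - b)) \<partial>lborel)"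
  proof (rule nn_integral_mono)
    fix x :: 'a
    show "ennreal (decay_weight \<alpha> x) \<le> indicator (cball (0::'a) 2) x
      + liminf (\<lambda>k. ennreal (indicator {x::'a. 1 \<le> norm x \<and> norm x \<le> 2 ^ k} x * norm x powr - b))"
    proof (cases "norm x \<le> 2")
      case True
      then show ?thesis using decay_weight_le_1[of \<alpha> x] by (intro add_increasing2) (auto simp: ennreal_le_1)
    next
      case False
      have w: "decay_weight \<alpha> x \<le> norm x powr - b"
        using False unfolding decay_weight_def b_def[symmetric] powr_minus_divide by (intro divide_left_mono) (auto intro!: mult_pos_pos add_pos_nonneg)
      obtain n where n: "norm x < 2 ^ n" using real_arch_pow[of 2 "norm x"] by auto
      have "\<forall>\<^sub>F k in sequentially. ennreal (decay_weight \<alpha> x) \<le> ennreal (indicator {x::'a. 1 \<le> norm x \<and> norm x \<le> 2 ^ k} x * norm x powr - b)"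
        using eventually_ge_at_top[of n]
      proof eventually_elim
        fix k assume "n \<le> k"
        then have "(2::real) ^ n \<le> 2 ^ k" by (intro power_increasing) auto
        then show "ennreal (decay_weight \<alpha> x) \<le> ennreal (indicator {x::'a. 1 \<le> norm x \<and> norm x \<le> 2 ^ k} x * norm x powr - b)"
          using order_trans[OF less_imp_le[OF n]] False w by (intro ennreal_leI) (auto simp: indicator_def)
      qed
      then have "ennreal (decay_weight \<alpha> x) \<le> liminf (\<lambda>k. ennreal (indicator {x::'a. 1 \<le> norm x \<and> norm x \<le> 2 ^ k} x * norm x powr - b))"
        by (rule Liminf_bounded)
      then show ?thesis by (intro add_increasing) auto
    qed
  qed
  also have "\<dots> = ennreal c + (\<integral>\<^sup>+x. liminf (\<lambda>k. ennreal (indicator {x::'a. 1 \<le> norm x \<and> norm x \<le> 2 ^ k} x * norm x powr - b)) \<partial>lborel)"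
    by (subst nn_integral_add) (auto simp: c intro!: borel_measurable_indicator)
  also have "\<dots> \<le> ennreal c + liminf F"
    unfolding F_def by (intro add_left_mono nn_integral_liminf) auto
  also have "liminf F \<le> ennreal (c / (1 - th))"
    by (rule Liminf_le) (auto simp: bound)
  also have "ennreal c + ennreal (c / (1 - th)) < \<infinity>" by simp
  finally show ?thesis by (auto simp: add_left_mono)
qed

section \<open>Uniqueness of the weak gradient\<close>

text \<open>Dominated convergence: the bound on the gradient bounds the quotients, and steps of
  length at most 1 keep their supports inside one ball.\<close>

lemma difference_quotient_tendsto:
  assumes f: "test_function f" and p: "1 < p" and e: "e \<in> Basis"
    and t: "\<And>k. 0 < t k" "\<And>k. t k \<le> 1" "t \<longlonglongrightarrow> (0::real)"
  shows "(\<lambda>k. Lp_int p lebesgue (\<lambda>x. classical_grad f x \<bullet> e - (f (x + t k *\<^sub>R e) - f x) / t k)) \<longlonglongrightarrow> 0"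
proof -
  note [measurable] = test_function_measurable[OF f] test_function_grad_measurable[OF f]
  obtain K where K: "compact K" "\<And>x. x \<notin> K \<Longrightarrow> f x = 0" "\<And>x. x \<notin> K \<Longrightarrow> classical_grad f x = 0"
    by (rule test_function_support[OF f]) blast
  obtain R where R: "0 < R" "K \<subseteq> cball 0 R"
    using compact_imp_bounded[OF K(1)] bounded_pos[of K] by (auto simp: subset_iff)
  have "bounded (classical_grad f ` K)"
    by (intro compact_imp_bounded compact_continuous_image K(1) continuous_on_subset[OF test_function_continuous_grad[OF f]]) auto
  then obtain B where B0: "0 < B" "\<And>x. x \<in> K \<Longrightarrow> norm (classical_grad f x) \<le> B"
    unfolding bounded_pos by auto
  have B: "norm (classical_grad f x) \<le> B" for x
    using K(3)[of x] B0 by (cases "x \<in> K") auto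
  have lip: "\<bar>f y - f x\<bar> \<le> B * norm (y - x)" for x y
  proof -
    have "norm (f y - f x) \<le> B * norm (y - x)"
    proof (rule differentiable_bound[where S = UNIV])
      show "(f has_derivative (\<lambda>h. h \<bullet> classical_grad f x)) (at x within UNIV)" for x
        using test_function_GDERIV[OF f, of x] by (simp add: gderiv_def)
      show "onorm (\<lambda>h. h \<bullet> classical_grad f x) \<le> B" for x
      proof (rule onorm_le)
        fix h :: 'a
        have "norm (h \<bullet> classical_grad f x) \<le> norm h * norm (classical_grad f x)"
          by (simp add: Cauchy_Schwarz_ineq2)
        also have "\<dots> \<le> norm h * B" using B by (rule mult_left_mono) simp
        finally show "norm (h \<bullet> classical_grad f x) \<le> B * norm h" by (simp add: mult.commute)
      qed
    qed auto
    then show ?thesis by simp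
  qed
  have ne: "norm e = 1" using e by simp
  define D where "D k x = classical_grad f x \<bullet> e - (f (x + t k *\<^sub>R e) - f x) / t k" for k x
  have [measurable]: "D k \<in> borel_measurable lebesgue" for k
    unfolding D_def by (rule measurable_completion) measurable
  have bd: "norm (D k x) \<le> 2 * B" for k x
  proof -
    have "\<bar>classical_grad f x \<bullet> e\<bar> \<le> B"
      using Cauchy_Schwarz_ineq2[of "classical_grad f x" e] B[of x] ne by simp
    moreover have "\<bar>(f (x + t k *\<^sub>R e) - f x) / t k\<bar> \<le> B"
      using lip[of "x + t k *\<^sub>R e" x] t(1)[of k] ne by (simp add: abs_divide field_simps)
    ultimately show ?thesis unfolding D_def real_norm_def by linarith
  qed
  have supp: "D k x = 0" if "x \<notin> cball 0 (R + 1)" for k x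
  proof -
    have "norm x \<le> norm (x + t k *\<^sub>R e) + norm (t k *\<^sub>R e)"
      using norm_triangle_ineq4[of "x + t k *\<^sub>R e" "t k *\<^sub>R e"] by simp
    also have "norm (t k *\<^sub>R e) \<le> 1" using t(1,2)[of k] ne by simp
    finally have "x + t k *\<^sub>R e \<notin> K" "x \<notin> K" using that R by auto
    then show ?thesis using K by (simp add: D_def)
  qed
  have lim: "(\<lambda>k. D k x) \<longlonglongrightarrow> 0" for x
  proof -
    have "((\<lambda>s. f (x + s *\<^sub>R e)) has_derivative (\<lambda>h. (h *\<^sub>R e) \<bullet> classical_grad f x)) (at 0)"
    proof (rule has_derivative_compose[where g = f])
      show "((\<lambda>s. x + s *\<^sub>R e) has_derivative (\<lambda>h. h *\<^sub>R e)) (at (0::real))"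
        by (auto intro!: derivative_eq_intros)
      show "(f has_derivative (\<lambda>h. h \<bullet> classical_grad f x)) (at (x + 0 *\<^sub>R e))"
        using test_function_GDERIV[OF f, of x] by (simp add: gderiv_def)
    qed
    moreover have "(\<lambda>h. (h *\<^sub>R e) \<bullet> classical_grad f x) = (*) (classical_grad f x \<bullet> e)"
      by (auto simp: inner_commute mult.commute)
    ultimately have "((\<lambda>s. f (x + s *\<^sub>R e)) has_field_derivative (classical_grad f x \<bullet> e)) (at 0)"
      by (simp add: has_field_derivative_def)
    then have "((\<lambda>s. (f (x + s *\<^sub>R e) - f x) / s) \<longlongrightarrow> classical_grad f x \<bullet> e) (at 0)"
      by (simp add: DERIV_def)
    moreover have "filterlim t (at 0) sequentially"
      using t(3)
    proof (rule filterlim_atI)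
      show "\<forall>\<^sub>F k in sequentially. t k \<noteq> 0" using t(1) by (intro always_eventually allI) (metis less_irrefl)
    qed
    ultimately have "(\<lambda>k. (f (x + t k *\<^sub>R e) - f x) / t k) \<longlonglongrightarrow> classical_grad f x \<bullet> e"
      by (rule filterlim_compose)
    then show ?thesis unfolding D_def by (rule tendsto_eq_rhs[OF tendsto_diff[OF tendsto_const]]) simp
  qed
  have "(\<lambda>k. \<integral>x. norm (D k x) powr p \<partial>lebesgue) \<longlonglongrightarrow> (\<integral>x. 0 \<partial>(lebesgue :: 'a measure))"
  proof (rule integral_dominated_convergence[where w = "\<lambda>x. indicator (cball 0 (R + 1)) x * (2 * B) powr p"])
    show "integrable lebesgue (\<lambda>x::'a. indicator (cball 0 (R + 1)) x * (2 * B) powr p)"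
      using emeasure_compact_finite[OF compact_cball, of "0::'a" "R + 1"]
      by (auto simp: integrable_completion)
    show "AE x in lebesgue. (\<lambda>k. norm (D k x) powr p) \<longlonglongrightarrow> 0"
    proof (rule AE_I2)
      fix x
      have "(\<lambda>k. norm (D k x) powr p) \<longlonglongrightarrow> norm (0::real) powr p"
        using p by (intro tendsto_powr' tendsto_norm lim tendsto_const) auto
      then show "(\<lambda>k. norm (D k x) powr p) \<longlonglongrightarrow> 0" by simp
    qed
    show "AE x in lebesgue. norm (norm (D k x) powr p) \<le> indicator (cball 0 (R + 1)) x * (2 * B) powr p" for k
      using bd[of k] supp[of _ k] p by (intro AE_I2) (auto simp: indicator_def simp del: mem_cball intro!: powr_mono2)
  qed measurable
  then show ?thesis by (simp add: Lp_int_def D_def)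
qed

text \<open>The difference quotients of \<open>\<phi>\<^sub>n\<close> tend to \<open>0\<close> almost everywhere as \<open>n \<rightarrow> \<infinity>\<close>, while the
  translation estimate keeps them close, uniformly in \<open>n\<close>, to those of a fixed \<open>\<phi>\<^sub>m\<close>, which approximate
  its derivative.\<close>

lemma gradient_of_null_limit:
  fixes \<phi> :: "nat \<Rightarrow> 'a::euclidean_space \<Rightarrow> real"
  assumes \<phi>: "\<And>n. test_function (\<phi> n)" and p: "1 < p" and D: "D \<in> Lp_space p lebesgue"
    and lim: "(\<lambda>n. Lp_int p lebesgue (\<lambda>x. classical_grad (\<phi> n) x - D x)) \<longlonglongrightarrow> 0"
    and ae: "AE x in lebesgue. (\<lambda>n. \<phi> n x) \<longlonglongrightarrow> 0"
  shows "AE x in lebesgue. D x = 0"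
proof -
  have p0: "0 < p" using p by simp
  note gL = test_function_Lp(2)[OF \<phi> p0]
  note [measurable] = Lp_measurable[OF D] test_function_measurable[OF \<phi>] test_function_grad_measurable[OF \<phi>]
  have "AE x in lebesgue. D x \<bullet> e = 0" if e: "e \<in> Basis" for e
  proof -
    define T where "T t n x = (\<phi> n (x + t *\<^sub>R e) - \<phi> n x) / t" for t :: real and n x
    have [measurable]: "T t n \<in> borel_measurable borel" for t n unfolding T_def by measurable
    have Tb: "T t n \<in> borel_measurable lebesgue" for t n by (rule measurable_completion) measurable
    define De where "De x = D x \<bullet> e" for x
    define g where "g n x = classical_grad (\<phi> n) x \<bullet> e" for n x
    have comp: "(\<lambda>x. h x \<bullet> e) \<in> Lp_space p lebesgue \<and> Lp_int p lebesgue (\<lambda>x. h x \<bullet> e) \<le> Lp_int p lebesgue h"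
      if h: "h \<in> Lp_space p lebesgue" for h :: "'a \<Rightarrow> 'a"
    proof -
      have "norm (h x \<bullet> e) powr p \<le> norm (h x) powr p" for x
        using e p Basis_le_norm[OF e, of "h x"] by (intro powr_mono2) auto
      then show ?thesis
        using Lp_space_le[OF _ Lp_integrable[OF h], of "\<lambda>x. h x \<bullet> e" p] Lp_measurable[OF h]
        by (auto simp: Lp_int_def)
    qed
    have De: "De \<in> Lp_space p lebesgue" unfolding De_def using comp[OF D] by blast
    have g: "g n \<in> Lp_space p lebesgue" for n unfolding g_def using comp[OF gL] by blast
    have Tdiff: "(\<lambda>x. T t m x - T t n x) \<in> Lp_space p lebesgue \<and>
        Lp_int p lebesgue (\<lambda>x. T t m x - T t n x) \<le> Lp_int p lebesgue (\<lambda>x. classical_grad (\<phi> m) x - classical_grad (\<phi> n) x)"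
      if t: "0 < t" for t m n
    proof -
      define f where "f x = \<phi> m x - \<phi> n x" for x
      have f: "test_function f" unfolding f_def by (intro test_function_diff \<phi>)
      have tr: "(\<integral>\<^sup>+x. ennreal (\<bar>f (x + t *\<^sub>R e) - f x\<bar> powr p) \<partial>lebesgue) \<le> ennreal (t powr p * grad_int p f)"
        using test_function_translation[OF f p, of "t *\<^sub>R e"] e t by (simp add: nn_integral_completion)
      have tf: "(\<lambda>x. f (x + t *\<^sub>R e) - f x) \<in> Lp_space p lebesgue"
      proof (rule Lp_spaceI_nn)
        show "(\<lambda>x. f (x + t *\<^sub>R e) - f x) \<in> borel_measurable lebesgue"
          unfolding f_def by (rule measurable_completion) measurable
        show "(\<integral>\<^sup>+x. ennreal (norm (f (x + t *\<^sub>R e) - f x) powr p) \<partial>lebesgue) < \<infinity>"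
          using tr by (simp add: le_less_trans)
      qed
      have eq: "(\<lambda>x. T t m x - T t n x) = (\<lambda>x. (1 / t) *\<^sub>R (f (x + t *\<^sub>R e) - f x))"
        by (auto simp: T_def f_def diff_divide_distrib)
      have "Lp_int p lebesgue (\<lambda>x. f (x + t *\<^sub>R e) - f x) \<le> t powr p * grad_int p f"
        using tr nn_integral_Lp[OF tf] by (simp add: ennreal_le_iff)
      then have "Lp_int p lebesgue (\<lambda>x. T t m x - T t n x) \<le> (1 / t) powr p * (t powr p * grad_int p f)"
        unfolding eq Lp_int_scaleR using t by (auto intro!: mult_left_mono)
      also have "\<dots> = grad_int p f" using t by (simp add: powr_divide)
      also have "classical_grad f = (\<lambda>x. classical_grad (\<phi> m) x - classical_grad (\<phi> n) x)"
        unfolding f_def by (auto simp: test_function_grad_diff \<phi>)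
      finally show ?thesis unfolding eq using Lp_scaleR[OF tf] by blast
    qed
    have Tlim: "AE x in lebesgue. (\<lambda>n. T t n x) \<longlonglongrightarrow> 0" if t: "0 < t" for t
    proof -
      \<comment> \<open>The exceptional null set is moved to \<open>lborel\<close>, which equals its
        image under a translation.\<close>
      from ae have ae': "AE x in lborel. (\<lambda>n. \<phi> n x) \<longlonglongrightarrow> 0" by (simp add: AE_completion_iff)
      have "lborel = distr lborel borel (\<lambda>x. t *\<^sub>R e + x)"
        using lborel_distr_plus[of "t *\<^sub>R e"] by simp
      with ae' have "AE x in distr lborel borel (\<lambda>x. t *\<^sub>R e + x). (\<lambda>n. \<phi> n x) \<longlonglongrightarrow> 0" by metis
      then have "AE x in lborel. (\<lambda>n. \<phi> n (t *\<^sub>R e + x)) \<longlonglongrightarrow> 0"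
        by (subst (asm) AE_distr_iff) auto
      with ae' have "AE x in lborel. (\<lambda>n. T t n x) \<longlonglongrightarrow> 0"
      proof eventually_elim
        fix x assume "(\<lambda>n. \<phi> n x) \<longlonglongrightarrow> 0" "(\<lambda>n. \<phi> n (t *\<^sub>R e + x)) \<longlonglongrightarrow> 0"
        then have "(\<lambda>n. (\<phi> n (t *\<^sub>R e + x) - \<phi> n x) / t) \<longlonglongrightarrow> (0 - 0) / t"
          using t by (intro tendsto_intros) auto
        then show "(\<lambda>n. T t n x) \<longlonglongrightarrow> 0" by (simp add: T_def add.commute)
      qed
      then show ?thesis by (rule AE_completion)
    qed
    define k where "k = (2::real) powr (p - 1)"
    have k: "0 < k" by (simp add: k_def)
    have main: "Lp_int p lebesgue De \<le> d" if d: "0 < d" for d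
    proof -
      \<comment> \<open>The denominator is the total cost of the triangle inequalities below,
        \<open>k * (1 + k * (1 + 2 * k))\<close>.\<close>
      define \<eta> where "\<eta> = d / (k + k * k + k * k * (2 * k))"
      have \<eta>: "0 < \<eta>" using d k by (auto simp: \<eta>_def intro!: divide_pos_pos add_pos_pos mult_pos_pos)
      obtain m where m: "\<And>n. n \<ge> m \<Longrightarrow> Lp_int p lebesgue (\<lambda>x. classical_grad (\<phi> n) x - D x) < \<eta>"
        using order_tendstoD(2)[OF lim \<eta>] by (auto simp: eventually_sequentially)
      define t where "t j = 1 / real (Suc j)" for j
      have tp: "0 < t j" "t j \<le> 1" for j by (auto simp: t_def field_simps)
      have "t \<longlonglongrightarrow> 0" unfolding t_def by (rule LIMSEQ_Suc[OF lim_1_over_n])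
      from difference_quotient_tendsto[OF \<phi>[of m] p e tp this]
      have "(\<lambda>j. Lp_int p lebesgue (\<lambda>x. g m x - T (t j) m x)) \<longlonglongrightarrow> 0"
        unfolding g_def T_def .
      from order_tendstoD(2)[OF this \<eta>] obtain j where j: "Lp_int p lebesgue (\<lambda>x. g m x - T (t j) m x) < \<eta>"
        by (auto simp: eventually_sequentially)
      define s where "s = t j"
      have s: "0 < s" using tp by (simp add: s_def)
      have "(\<lambda>x. \<phi> m (x + s *\<^sub>R e) - \<phi> m x) \<in> Lp_space p lebesgue"
      proof (rule Lp_spaceI_nn)
        show "(\<lambda>x. \<phi> m (x + s *\<^sub>R e) - \<phi> m x) \<in> borel_measurable lebesgue"
          by (rule measurable_completion) measurable
        show "(\<integral>\<^sup>+x. ennreal (norm (\<phi> m (x + s *\<^sub>R e) - \<phi> m x) powr p) \<partial>lebesgue) < \<infinity>"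
          using test_function_translation[OF \<phi>[of m] p, of "s *\<^sub>R e"] by (simp add: nn_integral_completion le_less_trans)
      qed
      from Lp_scaleR[OF this, of "1 / s"] have Tm: "T s m \<in> Lp_space p lebesgue"
        by (simp add: T_def[abs_def] field_simps)
      have le: "Lp_int p lebesgue (\<lambda>x. De x - T s n x) \<le> d" if n: "n \<ge> m" for n
      proof -
        have 1: "Lp_int p lebesgue (\<lambda>x. g m x - De x) \<le> \<eta>"
        proof -
          have "(\<lambda>x. (classical_grad (\<phi> m) x - D x) \<bullet> e) = (\<lambda>x. g m x - De x)"
            by (auto simp: g_def De_def inner_diff_left)
          then show ?thesis using comp[OF Lp_diff(1)[OF p gL[of m] D]] m[of m] by simp
        qed
        have 2: "Lp_int p lebesgue (\<lambda>x. g m x - T s m x) \<le> \<eta>" using j by (simp add: s_def)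
        have "Lp_int p lebesgue (\<lambda>x. T s m x - T s n x)
            \<le> Lp_int p lebesgue (\<lambda>x. classical_grad (\<phi> m) x - classical_grad (\<phi> n) x)"
          using Tdiff[OF s] by blast
        also have "\<dots> \<le> k * (Lp_int p lebesgue (\<lambda>x. classical_grad (\<phi> m) x - D x) + Lp_int p lebesgue (\<lambda>x. classical_grad (\<phi> n) x - D x))"
          unfolding k_def using Lp_int_triangle[OF p gL[of m] D gL[of n]] by (simp add: Lp_int_diff_commute[of _ _ D])
        also have "\<dots> \<le> k * (\<eta> + \<eta>)" using m[of m] m[OF n] k by (intro mult_left_mono add_mono) auto
        finally have 3: "Lp_int p lebesgue (\<lambda>x. T s m x - T s n x) \<le> 2 * k * \<eta>" by simp
        have Tn: "T s n \<in> Lp_space p lebesgue"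
          using Lp_diff(1)[OF p Tm conjunct1[OF Tdiff[OF s, of m n]]] by simp
        have "Lp_int p lebesgue (\<lambda>x. De x - T s n x) \<le> k * (Lp_int p lebesgue (\<lambda>x. De x - g m x) + Lp_int p lebesgue (\<lambda>x. g m x - T s n x))"
          unfolding k_def by (rule Lp_int_triangle[OF p De g Tn])
        also have "Lp_int p lebesgue (\<lambda>x. g m x - T s n x) \<le> k * (Lp_int p lebesgue (\<lambda>x. g m x - T s m x) + Lp_int p lebesgue (\<lambda>x. T s m x - T s n x))"
          unfolding k_def by (rule Lp_int_triangle[OF p g Tm Tn])
        also have "k * (Lp_int p lebesgue (\<lambda>x. De x - g m x) + k * (Lp_int p lebesgue (\<lambda>x. g m x - T s m x) + Lp_int p lebesgue (\<lambda>x. T s m x - T s n x)))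
          \<le> k * (\<eta> + k * (\<eta> + 2 * k * \<eta>))"
          using 1 2 3 k by (intro mult_left_mono add_mono) (auto simp: Lp_int_diff_commute[of _ _ De])
        also have "\<dots> = \<eta> * (k + k * k + k * k * (2 * k))" by (simp add: algebra_simps)
        also have "\<dots> = d"
        proof -
          have "k + k * k + k * k * (2 * k) \<noteq> 0" using k by (intro less_imp_neq[symmetric] add_pos_pos mult_pos_pos) auto
          then show ?thesis by (simp add: \<eta>_def)
        qed
        finally show ?thesis using k by (simp add: mult_left_mono)
      qed
      have Tn: "T s n \<in> Lp_space p lebesgue" for n
        using Lp_diff(1)[OF p Tm conjunct1[OF Tdiff[OF s, of m n]]] by simp
      \<comment> \<open>As \<open>T s n\<close> tends to 0 almost everywhere, Fatou turns the bound
        on \<open>De - T s n\<close> into the same bound on \<open>De\<close>.\<close>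
      show ?thesis
      proof (rule Lp_fatou(2)[OF Lp_diff(1)[OF p De Tn] _ _ p])
        show "De \<in> borel_measurable lebesgue" by (rule Lp_measurable[OF De])
        show "AE x in lebesgue. (\<lambda>n. De x - T s n x) \<longlonglongrightarrow> De x"
          using Tlim[OF s] by eventually_elim (auto intro: tendsto_eq_intros)
        show "\<forall>\<^sub>F n in sequentially. Lp_int p lebesgue (\<lambda>x. De x - T s n x) \<le> d"
          using le by (auto simp: eventually_sequentially)
      qed
    qed
    have "Lp_int p lebesgue De = 0"
    proof (rule antisym)
      show "Lp_int p lebesgue De \<le> 0" by (rule field_le_epsilon) (simp add: main)
    qed simp
    then have "AE x in lebesgue. norm (De x) powr p = 0"
      unfolding Lp_int_def using integral_nonneg_eq_0_iff_AE[OF Lp_integrable[OF De]] by simp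
    then show ?thesis by eventually_elim (simp add: De_def)
  qed
  then have "AE x in lebesgue. \<forall>e\<in>Basis. D x \<bullet> e = 0"
    by (intro AE_finite_allI) auto
  then show ?thesis by eventually_elim (simp add: euclidean_all_zero_iff)
qed

section \<open>The function space and the weighted measure\<close>

text \<open>The definition only asks for a measurable \<open>G\<close> and extended integrals. These
  are eventually finite, and gradients of test functions lie in \<open>Lp_space\<close>, so
  \<open>G\<close> does too and the convergence can be restated with real integrals.\<close>

lemma has_D1p_gradE:
  assumes "has_D1p_grad p u G" and p: "1 < p"
  obtains \<phi> where "\<And>n. test_function (\<phi> n)" "G \<in> Lp_space p lebesgue" "u \<in> borel_measurable lebesgue"
    "(\<lambda>n. Lp_int p lebesgue (\<lambda>x. classical_grad (\<phi> n) x - G x)) \<longlonglongrightarrow> 0"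
    "AE x in lebesgue. (\<lambda>n. \<phi> n x) \<longlonglongrightarrow> u x"
proof -
  obtain \<phi> where \<phi>: "\<And>n. test_function (\<phi> n)"
    and lim: "(\<lambda>n. \<integral>\<^sup>+ x. ennreal (norm (classical_grad (\<phi> n) x - G x) powr p) \<partial>lebesgue) \<longlonglongrightarrow> 0"
    and ae: "AE x in lebesgue. (\<lambda>n. \<phi> n x) \<longlonglongrightarrow> u x"
    and [measurable]: "u \<in> borel_measurable lebesgue" "G \<in> borel_measurable lebesgue"
    using assms unfolding has_D1p_grad_def by auto
  note [measurable] = test_function_grad_measurable[OF \<phi>]
  have gL: "classical_grad (\<phi> n) \<in> Lp_space p lebesgue" for n using \<phi> p by (intro test_function_Lp) auto
  have "\<forall>\<^sub>F n in sequentially. (\<integral>\<^sup>+ x. ennreal (norm (classical_grad (\<phi> n) x - G x) powr p) \<partial>lebesgue) < 1"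
    by (rule order_tendstoD[OF lim]) simp
  then obtain n where "(\<integral>\<^sup>+ x. ennreal (norm (classical_grad (\<phi> n) x - G x) powr p) \<partial>lebesgue) < 1"
    by (auto simp: eventually_sequentially)
  then have "(\<lambda>x. classical_grad (\<phi> n) x - G x) \<in> Lp_space p lebesgue"
    by (intro Lp_spaceI_nn) (auto intro: less_trans)
  from Lp_diff(1)[OF p gL[of n] this] have G: "G \<in> Lp_space p lebesgue" by simp
  have "(\<lambda>n. ennreal (Lp_int p lebesgue (\<lambda>x. classical_grad (\<phi> n) x - G x))) \<longlonglongrightarrow> ennreal 0"
    using lim nn_integral_Lp[OF Lp_diff(1)[OF p gL G]] by simp
  then have "(\<lambda>n. Lp_int p lebesgue (\<lambda>x. classical_grad (\<phi> n) x - G x)) \<longlonglongrightarrow> 0"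
    by (subst (asm) tendsto_ennreal_iff) auto
  then show ?thesis using \<phi> G ae by (intro that) auto
qed

lemma has_D1p_gradI:
  assumes \<phi>: "\<And>n. test_function (\<phi> n)" and G: "G \<in> Lp_space p lebesgue" and u: "u \<in> borel_measurable lebesgue" and p: "1 < p"
    and lim: "(\<lambda>n. Lp_int p lebesgue (\<lambda>x. classical_grad (\<phi> n) x - G x)) \<longlonglongrightarrow> 0"
    and ae: "AE x in lebesgue. (\<lambda>n. \<phi> n x) \<longlonglongrightarrow> u x"
  shows "has_D1p_grad p u G"
proof -
  have gL: "classical_grad (\<phi> n) \<in> Lp_space p lebesgue" for n using \<phi> p by (intro test_function_Lp) auto
  have "(\<lambda>n. ennreal (Lp_int p lebesgue (\<lambda>x. classical_grad (\<phi> n) x - G x))) \<longlonglongrightarrow> ennreal 0"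
    by (rule tendsto_ennrealI[OF lim])
  then have "(\<lambda>n. \<integral>\<^sup>+ x. ennreal (norm (classical_grad (\<phi> n) x - G x) powr p) \<partial>lebesgue) \<longlonglongrightarrow> 0"
    using nn_integral_Lp[OF Lp_diff(1)[OF p gL G]] by simp
  then show ?thesis unfolding has_D1p_grad_def using \<phi> u Lp_measurable[OF G] ae by blast
qed

lemma test_function_has_D1p_grad:
  assumes "test_function f" "1 < p"
  shows "has_D1p_grad p f (classical_grad f)"
  by (rule has_D1p_gradI[where \<phi> = "\<lambda>_. f"])
    (use assms in \<open>auto intro: test_function_Lp Lp_measurable simp: Lp_int_def\<close>)

text \<open>The differences of two approximating sequences tend to 0 almost everywhere, so the limit
  of their gradients vanishes. This removes the arbitrariness of the choice in
  \<open>D1p_grad\<close>.\<close>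

lemma has_D1p_grad_unique:
  assumes G: "has_D1p_grad p u G" and H: "has_D1p_grad p u H" and p: "1 < p"
  shows "AE x in lebesgue. G x = H x"
proof -
  obtain \<phi> where \<phi>: "\<And>n. test_function (\<phi> n)" "G \<in> Lp_space p lebesgue"
    "(\<lambda>n. Lp_int p lebesgue (\<lambda>x. classical_grad (\<phi> n) x - G x)) \<longlonglongrightarrow> 0"
    "AE x in lebesgue. (\<lambda>n. \<phi> n x) \<longlonglongrightarrow> u x"
    by (rule has_D1p_gradE[OF G p]) blast
  obtain \<psi> where \<psi>: "\<And>n. test_function (\<psi> n)" "H \<in> Lp_space p lebesgue"
    "(\<lambda>n. Lp_int p lebesgue (\<lambda>x. classical_grad (\<psi> n) x - H x)) \<longlonglongrightarrow> 0"
    "AE x in lebesgue. (\<lambda>n. \<psi> n x) \<longlonglongrightarrow> u x"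
    by (rule has_D1p_gradE[OF H p]) blast
  have gL: "classical_grad (\<phi> n) \<in> Lp_space p lebesgue" "classical_grad (\<psi> n) \<in> Lp_space p lebesgue" for n
    using \<phi> \<psi> p by (auto intro: test_function_Lp)
  have "AE x in lebesgue. G x - H x = 0"
  proof (rule gradient_of_null_limit[where \<phi> = "\<lambda>n x. \<phi> n x - \<psi> n x", OF _ p])
    show "test_function (\<lambda>x. \<phi> n x - \<psi> n x)" for n by (intro test_function_diff \<phi> \<psi>)
    show "(\<lambda>x. G x - H x) \<in> Lp_space p lebesgue" by (intro Lp_diff p \<phi> \<psi>)
    show "AE x in lebesgue. (\<lambda>n. \<phi> n x - \<psi> n x) \<longlonglongrightarrow> 0"
      using \<phi>(4) \<psi>(4) by eventually_elim (auto intro: tendsto_eq_intros)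
    show "(\<lambda>n. Lp_int p lebesgue (\<lambda>x. classical_grad (\<lambda>x. \<phi> n x - \<psi> n x) x - (G x - H x))) \<longlonglongrightarrow> 0"
    proof (rule Lim_null_comparison)
      show "(\<lambda>n. 2 powr (p - 1) * (Lp_int p lebesgue (\<lambda>x. classical_grad (\<phi> n) x - G x) + Lp_int p lebesgue (\<lambda>x. classical_grad (\<psi> n) x - H x))) \<longlonglongrightarrow> 0"
        using \<phi>(3) \<psi>(3) by (auto intro!: tendsto_eq_intros)
      have "classical_grad (\<lambda>x. \<phi> n x - \<psi> n x) x - (G x - H x) = (classical_grad (\<phi> n) x - G x) - (classical_grad (\<psi> n) x - H x)" for n x
        by (simp add: test_function_grad_diff \<phi> \<psi>)
      then show "\<forall>\<^sub>F n in sequentially. norm (Lp_int p lebesgue (\<lambda>x. classical_grad (\<lambda>x. \<phi> n x - \<psi> n x) x - (G x - H x)))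
          \<le> 2 powr (p - 1) * (Lp_int p lebesgue (\<lambda>x. classical_grad (\<phi> n) x - G x) + Lp_int p lebesgue (\<lambda>x. classical_grad (\<psi> n) x - H x))"
        using Lp_diff(2)[OF p Lp_diff(1)[OF p gL(1) \<phi>(2)] Lp_diff(1)[OF p gL(2) \<psi>(2)]]
        by (intro always_eventually allI) (simp only: real_norm_def abs_of_nonneg Lp_int_nonneg)
    qed
  qed
  then show ?thesis by eventually_elim simp
qed

lemma D1p_grad_works: "u \<in> D1p p \<Longrightarrow> has_D1p_grad p u (D1p_grad p u)"
  unfolding D1p_def D1p_grad_def mem_Collect_eq by (erule someI_ex)

lemma D1p_norm_powr:
  assumes "has_D1p_grad p u G" "1 < p"
  shows "D1p_norm p u powr p = Lp_int p lebesgue G"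
proof -
  have u: "u \<in> D1p p" using assms by (auto simp: D1p_def)
  have "AE x in lebesgue. D1p_grad p u x = G x"
    by (rule has_D1p_grad_unique[OF D1p_grad_works[OF u] assms])
  then have "(\<integral>x. norm (D1p_grad p u x) powr p \<partial>lebesgue) = Lp_int p lebesgue G"
    unfolding Lp_int_def using D1p_grad_works[OF u] assms(1) unfolding has_D1p_grad_def
    by (intro integral_cong_AE) auto
  then show ?thesis using assms(2) by (simp add: D1p_norm_def powr_powr)
qed

text \<open>With the weight as a density the weighted space becomes an ordinary
  \<open>Lp_space\<close> over a finite measure; as the weight is positive, the null sets are those
  of Lebesgue measure.\<close>

definition decay_measure :: "real \<Rightarrow> 'a::euclidean_space measure" where
  "decay_measure \<alpha> = density lebesgue (\<lambda>x. ennreal (decay_weight \<alpha> x))"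

lemma decay_weight_measurable_lebesgue [measurable]: "decay_weight \<alpha> \<in> borel_measurable lebesgue"
  by (rule measurable_completion) simp

lemma space_decay_measure [simp]: "space (decay_measure \<alpha>) = UNIV"
  and sets_decay_measure [measurable_cong]: "sets (decay_measure \<alpha>) = sets lebesgue"
  by (auto simp: decay_measure_def)

lemma decay_measurable_iff [simp]: "f \<in> measurable (decay_measure \<alpha>) N \<longleftrightarrow> f \<in> measurable lebesgue N"
  by (rule measurable_cong_sets[THEN eqset_imp_iff]) (auto simp: decay_measure_def)

lemma AE_decay_measure [simp]: "(AE x in decay_measure \<alpha>. P x) \<longleftrightarrow> (AE x in lebesgue. P x)"
  unfolding decay_measure_def by (subst AE_density) (auto simp: decay_weight_pos)

lemma finite_decay_measure:
  assumes "0 < \<alpha>"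
  shows "finite_measure (decay_measure \<alpha> :: 'a::euclidean_space measure)"
proof (rule finite_measureI)
  have "emeasure (decay_measure \<alpha>) (space (decay_measure \<alpha> :: 'a measure)) = (\<integral>\<^sup>+x. ennreal (decay_weight \<alpha> (x::'a)) \<partial>lborel)"
    by (simp add: decay_measure_def emeasure_density nn_integral_completion)
  then show "emeasure (decay_measure \<alpha>) (space (decay_measure \<alpha> :: 'a measure)) \<noteq> \<infinity>"
    using nn_integral_decay_finite[OF assms, where 'a = 'a] by simp
qed

lemma nn_integral_decay_measure:
  fixes f :: "'a::euclidean_space \<Rightarrow> real"
  assumes "f \<in> borel_measurable borel"
  shows "(\<integral>\<^sup>+x. ennreal (norm (f x) powr p) \<partial>decay_measure \<alpha>) = (\<integral>\<^sup>+x. ennreal (decay_weight \<alpha> x * \<bar>f x\<bar> powr p) \<partial>lborel)"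
proof -
  have [measurable]: "f \<in> borel_measurable lebesgue" by (rule measurable_completion) (simp add: assms)
  show ?thesis unfolding decay_measure_def
    by (subst nn_integral_density)
      (auto simp: nn_integral_completion ennreal_mult less_imp_le[OF decay_weight_pos])
qed

lemma Lp_int_decay_measure:
  fixes f :: "'a::euclidean_space \<Rightarrow> real"
  assumes [measurable]: "f \<in> borel_measurable lebesgue"
  shows "Lp_int p (decay_measure \<alpha>) f = (\<integral>x. decay_weight \<alpha> x * \<bar>f x\<bar> powr p \<partial>lebesgue)"
  unfolding Lp_int_def decay_measure_def
  by (subst integral_density) (auto simp: less_imp_le[OF decay_weight_pos])

text \<open>With N the dimension, \<open>N + \<alpha> - p\<close> is the decay left over after
  paying for the Hardy weight. For \<open>R = 0\<close> this gives the embedding, for large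
  \<open>R\<close> a small factor on the tail, the source of compactness at infinity.\<close>

lemma decay_weight_le_hardy:
  fixes x :: "'a::euclidean_space"
  assumes "0 < \<alpha>" "p < real DIM('a)" "0 \<le> R" "R \<le> norm x"
  shows "decay_weight \<alpha> x \<le> 2 powr (real DIM('a) + \<alpha>) * (1 + R) powr (p - (real DIM('a) + \<alpha>)) * (1 + norm x) powr - p"
proof -
  define b where "b = real DIM('a) + \<alpha>"
  have "(1 + norm x) powr (p - b) \<le> (1 + R) powr (p - b)"
    using assms by (intro powr_mono2') (auto simp: b_def)
  then have "(1 + norm x) powr (p - b) * (1 + norm x) powr - p \<le> (1 + R) powr (p - b) * (1 + norm x) powr - p"
    by (rule mult_right_mono) simp
  then have "(1 + norm x) powr - b \<le> (1 + R) powr (p - b) * (1 + norm x) powr - p"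
    by (simp add: powr_add[symmetric])
  then have "2 powr b * (1 + norm x) powr - b \<le> 2 powr b * ((1 + R) powr (p - b) * (1 + norm x) powr - p)"
    by (rule mult_left_mono) simp
  with decay_weight_le[OF assms(1), of x, folded b_def] show ?thesis
    unfolding b_def[symmetric] mult.assoc by (rule order_trans)
qed

text \<open>A crude constant, used for finiteness and continuity; the sharp one is recovered from
  \<open>embedding_norm\<close> afterwards.\<close>

lemma embedding_inequality:
  assumes p: "1 < p" "p < real DIM('a::euclidean_space)" and \<alpha>: "0 < \<alpha>"
  obtains K where "0 < K" "\<And>f :: 'a \<Rightarrow> real. test_function f \<Longrightarrow>
    f \<in> Lp_space p (decay_measure \<alpha>) \<and> Lp_int p (decay_measure \<alpha>) f \<le> K * grad_int p f"
proof -
  obtain C where C: "0 < C" "\<And>f :: 'a \<Rightarrow> real. test_function f \<Longrightarrow>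
    hardy_int p f \<le> ennreal (C * grad_int p f)"
    by (rule hardy_inequality[OF p]) blast
  define c where "c = 2 powr (real DIM('a) + \<alpha>)"
  have c: "0 < c" by (simp add: c_def)
  have "f \<in> Lp_space p (decay_measure \<alpha>) \<and> Lp_int p (decay_measure \<alpha>) f \<le> c * C * grad_int p f"
    if f: "test_function f" for f :: "'a \<Rightarrow> real"
  proof -
    note [measurable] = test_function_measurable[OF f]
    have "(\<integral>\<^sup>+x. ennreal (norm (f x) powr p) \<partial>decay_measure \<alpha>)
        \<le> (\<integral>\<^sup>+x. ennreal c * ennreal ((1 + norm x) powr - p * \<bar>f x\<bar> powr p) \<partial>lborel)"
      unfolding nn_integral_decay_measure[OF test_function_measurable(1)[OF f]]
    proof (rule nn_integral_mono)
      fix x :: 'a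
      have "decay_weight \<alpha> x * \<bar>f x\<bar> powr p \<le> c * (1 + norm x) powr - p * \<bar>f x\<bar> powr p"
        using decay_weight_le_hardy[OF \<alpha> p(2), of 0 x] by (intro mult_right_mono) (auto simp: c_def)
      then show "ennreal (decay_weight \<alpha> x * \<bar>f x\<bar> powr p) \<le> ennreal c * ennreal ((1 + norm x) powr - p * \<bar>f x\<bar> powr p)"
        using c by (simp add: ennreal_mult[symmetric] ennreal_leI mult.assoc)
    qed
    also have "\<dots> = ennreal c * hardy_int p f"
      by (rule nn_integral_cmult) measurable
    also have "\<dots> \<le> ennreal c * ennreal (C * grad_int p f)" by (intro mult_left_mono C f) auto
    also have "\<dots> = ennreal (c * C * grad_int p f)" using c C by (simp add: ennreal_mult mult.assoc)
    finally have le: "(\<integral>\<^sup>+x. ennreal (norm (f x) powr p) \<partial>decay_measure \<alpha>) \<le> ennreal (c * C * grad_int p f)" .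
    then have "f \<in> Lp_space p (decay_measure \<alpha>)"
      by (intro Lp_spaceI_nn) (auto simp: le_less_trans)
    moreover from nn_integral_Lp[OF this] le have "Lp_int p (decay_measure \<alpha>) f \<le> c * C * grad_int p f"
      using c C by (simp add: ennreal_le_iff)
    ultimately show ?thesis by blast
  qed
  then show ?thesis using c C(1) by (intro that[of "c * C"]) auto
qed

text \<open>By the embedding a gradient-Cauchy sequence is Cauchy in the weighted space, and its
  limit there must agree with the almost everywhere limit \<open>u\<close>. Statements about test
  functions can hence be passed to all of \<open>D1p\<close>.\<close>

lemma D1p_approximation:
  fixes u :: "'a::euclidean_space \<Rightarrow> real"
  assumes u: "has_D1p_grad p u G" and p: "1 < p" "p < real DIM('a)" and \<alpha>: "0 < \<alpha>"
  obtains \<phi> where "\<And>n. test_function (\<phi> n)" "G \<in> Lp_space p lebesgue" "u \<in> Lp_space p (decay_measure \<alpha>)"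
    "(\<lambda>n. Lp_int p lebesgue (\<lambda>x. classical_grad (\<phi> n) x - G x)) \<longlonglongrightarrow> 0"
    "(\<lambda>n. Lp_int p (decay_measure \<alpha>) (\<lambda>x. \<phi> n x - u x)) \<longlonglongrightarrow> 0"
proof -
  obtain K where K: "0 < K" "\<And>f :: 'a \<Rightarrow> real. test_function f \<Longrightarrow>
    f \<in> Lp_space p (decay_measure \<alpha>) \<and> Lp_int p (decay_measure \<alpha>) f \<le> K * grad_int p f"
    by (rule embedding_inequality[OF p \<alpha>]) blast
  obtain \<phi> where \<phi>: "\<And>n. test_function (\<phi> n)" and G: "G \<in> Lp_space p lebesgue" and um: "u \<in> borel_measurable lebesgue"
    and lim: "(\<lambda>n. Lp_int p lebesgue (\<lambda>x. classical_grad (\<phi> n) x - G x)) \<longlonglongrightarrow> 0"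
    and ae: "AE x in lebesgue. (\<lambda>n. \<phi> n x) \<longlonglongrightarrow> u x"
    by (rule has_D1p_gradE[OF u p(1)]) blast
  have gL: "classical_grad (\<phi> n) \<in> Lp_space p lebesgue" for n using \<phi> p by (intro test_function_Lp) auto
  have \<phi>L: "\<phi> n \<in> Lp_space p (decay_measure \<alpha>)" for n using K \<phi> by blast
  have Cg: "Lp_Cauchy p lebesgue (\<lambda>n. classical_grad (\<phi> n))"
    by (rule Lp_CauchyI[OF gL G p(1) lim])
  have CC: "Lp_Cauchy p (decay_measure \<alpha>) \<phi>"
    unfolding Lp_Cauchy_def
  proof (intro allI impI)
    fix e :: real assume "0 < e"
    then have "\<exists>N. \<forall>m\<ge>N. \<forall>n\<ge>N. Lp_int p lebesgue (\<lambda>x. classical_grad (\<phi> m) x - classical_grad (\<phi> n) x) < e / K"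
      using Cg K(1) unfolding Lp_Cauchy_def by simp
    then obtain N where N: "\<And>m n. m \<ge> N \<Longrightarrow> n \<ge> N \<Longrightarrow> Lp_int p lebesgue (\<lambda>x. classical_grad (\<phi> m) x - classical_grad (\<phi> n) x) < e / K"
      by auto
    have "Lp_int p (decay_measure \<alpha>) (\<lambda>x. \<phi> m x - \<phi> n x) < e" if "m \<ge> N" "n \<ge> N" for m n
    proof -
      have "Lp_int p (decay_measure \<alpha>) (\<lambda>x. \<phi> m x - \<phi> n x) \<le> K * grad_int p (\<lambda>x. \<phi> m x - \<phi> n x)"
        using K(2)[OF test_function_diff[OF \<phi>[of m] \<phi>[of n]]] by blast
      also have "grad_int p (\<lambda>x. \<phi> m x - \<phi> n x) = Lp_int p lebesgue (\<lambda>x. classical_grad (\<phi> m) x - classical_grad (\<phi> n) x)"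
        by (simp add: test_function_grad_diff \<phi> Lp_int_def)
      also have "K * \<dots> < e" using N[OF that] K(1) by (simp add: field_simps)
      finally show ?thesis .
    qed
    then show "\<exists>N. \<forall>m\<ge>N. \<forall>n\<ge>N. Lp_int p (decay_measure \<alpha>) (\<lambda>x. \<phi> m x - \<phi> n x) < e" by blast
  qed
  obtain v and r :: "nat \<Rightarrow> nat" where v: "v \<in> Lp_space p (decay_measure \<alpha>)"
    "(\<lambda>n. Lp_int p (decay_measure \<alpha>) (\<lambda>x. \<phi> n x - v x)) \<longlonglongrightarrow> 0" "strict_mono r"
    "AE x in decay_measure \<alpha>. (\<lambda>n. \<phi> (r n) x) \<longlonglongrightarrow> v x"
    by (rule Lp_complete[OF \<phi>L p(1) CC]) blast
  have "AE x in lebesgue. (\<lambda>n. \<phi> (r n) x) \<longlonglongrightarrow> v x" using v(4) by simp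
  with ae have uv: "AE x in lebesgue. u x = v x"
  proof eventually_elim
    fix x assume "(\<lambda>n. \<phi> n x) \<longlonglongrightarrow> u x" and *: "(\<lambda>n. \<phi> (r n) x) \<longlonglongrightarrow> v x"
    then have "(\<lambda>n. \<phi> (r n) x) \<longlonglongrightarrow> u x" using LIMSEQ_subseq_LIMSEQ[OF _ v(3)] by (force simp: o_def)
    then show "u x = v x" using * by (rule LIMSEQ_unique)
  qed
  then have uv': "AE x in decay_measure \<alpha>. u x = v x" by simp
  have vm: "v \<in> borel_measurable lebesgue" using Lp_measurable[OF v(1)] by simp
  have uL: "u \<in> Lp_space p (decay_measure \<alpha>)"
  proof (rule Lp_spaceI_nn)
    show "u \<in> borel_measurable (decay_measure \<alpha>)" using um by simp
    have "(\<integral>\<^sup>+x. ennreal (norm (u x) powr p) \<partial>decay_measure \<alpha>) = (\<integral>\<^sup>+x. ennreal (norm (v x) powr p) \<partial>decay_measure \<alpha>)"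
      by (rule nn_integral_cong_AE) (use uv' in eventually_elim, simp)
    then show "(\<integral>\<^sup>+x. ennreal (norm (u x) powr p) \<partial>decay_measure \<alpha>) < \<infinity>" using nn_integral_Lp[OF v(1)] by simp
  qed
  have "Lp_int p (decay_measure \<alpha>) (\<lambda>x. \<phi> n x - u x) = Lp_int p (decay_measure \<alpha>) (\<lambda>x. \<phi> n x - v x)" for n
  proof -
    have "AE x in decay_measure \<alpha>. norm (\<phi> n x - u x) powr p = norm (\<phi> n x - v x) powr p"
      using uv' by eventually_elim simp
    then show ?thesis unfolding Lp_int_def
      using um vm test_function_measurable(3)[OF \<phi>[of n]] by (intro integral_cong_AE) auto
  qed
  with v(2) show ?thesis using \<phi> G uL lim by (intro that[of \<phi>]) auto
qed

section \<open>Compactness of the embedding\<close>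

text \<open>The shift sits inside the argument of \<open>f\<close>, so that differences of averages
  are averages of increments, to which the translation estimate applies.\<close>

definition ball_average :: "real \<Rightarrow> ('a::euclidean_space \<Rightarrow> real) \<Rightarrow> 'a \<Rightarrow> real" where
  "ball_average h f x = (\<integral>z. indicator (cball 0 h) z *\<^sub>R f (x + z) \<partial>lborel) / measure lborel (cball (0::'a) h)"

text \<open>Jensen's factor \<open>m powr (p - 1)\<close> and the normalisation
  \<open>m powr - p\<close> combine to \<open>1 / m\<close>.\<close>

lemma average_powr_le:
  fixes g :: "'a::euclidean_space \<Rightarrow> real"
  assumes "0 < h" "1 < p" "continuous_on UNIV g"
  shows "ennreal (\<bar>(\<integral>z. indicator (cball 0 h) z *\<^sub>R g z \<partial>lborel) / measure lborel (cball (0::'a) h)\<bar> powr p)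
    \<le> ennreal (1 / measure lborel (cball (0::'a) h)) * (\<integral>\<^sup>+z. indicator (cball 0 h) z * ennreal (\<bar>g z\<bar> powr p) \<partial>lborel)"
proof -
  define m where "m = measure lborel (cball (0::'a) h)"
  define I where "I = (\<integral>z. indicator (cball 0 h) z *\<^sub>R g z \<partial>lborel)"
  define J where "J = (\<integral>\<^sup>+z. indicator (cball 0 h) z * ennreal (\<bar>g z\<bar> powr p) \<partial>lborel)"
  have m: "0 < m" unfolding m_def by (rule content_cball_pos[OF assms(1)])
  have "ennreal (\<bar>I\<bar> powr p) \<le> ennreal (m powr (p - 1)) * J"
    unfolding I_def J_def m_def
    by (rule jensen_powr_compact) (use assms m in \<open>auto simp: m_def intro: continuous_on_subset\<close>)
  then have "ennreal (m powr - p) * ennreal (\<bar>I\<bar> powr p) \<le> ennreal (m powr - p) * (ennreal (m powr (p - 1)) * J)"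
    by (rule mult_left_mono) simp
  moreover have "m powr - p * \<bar>I\<bar> powr p = \<bar>I / m\<bar> powr p"
    using m by (simp add: powr_divide powr_minus_divide)
  moreover have "m powr - p * m powr (p - 1) = 1 / m"
    using m powr_minus_divide[of m 1] by (simp add: powr_add[symmetric])
  ultimately show ?thesis
    unfolding I_def[symmetric] J_def[symmetric] m_def[symmetric]
    by (simp add: mult.assoc[symmetric] ennreal_mult[symmetric])
qed

text \<open>The difference of two averages is an average of increments by \<open>x - y\<close>. The
  constant depends on \<open>f\<close> only through \<open>grad_int\<close>, which is the
  equicontinuity needed for the Arzela-Ascoli theorem.\<close>

lemma ball_average_lipschitz:
  fixes f :: "'a::euclidean_space \<Rightarrow> real"
  assumes f: "test_function f" and h: "0 < h" and p: "1 < p"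
  shows "\<bar>ball_average h f x - ball_average h f y\<bar> powr p
    \<le> norm (x - y) powr p * grad_int p f / measure lborel (cball (0::'a) h)"
proof -
  note [measurable] = test_function_measurable[OF f]
  note cf = test_function_continuous[OF f]
  define m where "m = measure lborel (cball (0::'a) h)"
  have m: "0 < m" unfolding m_def by (rule content_cball_pos[OF h])
  have cg: "continuous_on UNIV (\<lambda>z. f (x + z) - f (y + z))"
    by (intro continuous_intros continuous_on_compose2[OF cf]) auto
  have i: "integrable lborel (\<lambda>z. indicator (cball 0 h) z *\<^sub>R f (x + z))" for x
    by (intro borel_integrable_compact continuous_on_compose2[OF cf] continuous_intros) auto
  have "ball_average h f x - ball_average h f y = (\<integral>z. indicator (cball 0 h) z *\<^sub>R (f (x + z) - f (y + z)) \<partial>lborel) / m"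
    unfolding ball_average_def m_def diff_divide_distrib[symmetric] scaleR_diff_right
    by (simp only: Bochner_Integration.integral_diff[OF i i])
  then have "ennreal (\<bar>ball_average h f x - ball_average h f y\<bar> powr p)
      \<le> ennreal (1 / m) * (\<integral>\<^sup>+z. indicator (cball 0 h) z * ennreal (\<bar>f (x + z) - f (y + z)\<bar> powr p) \<partial>lborel)"
    using average_powr_le[OF h p cg] by (simp only: m_def)
  also have "\<dots> \<le> ennreal (1 / m) * (\<integral>\<^sup>+z. ennreal (\<bar>f ((z + y) + (x - y)) - f (z + y)\<bar> powr p) \<partial>lborel)"
    by (intro mult_left_mono nn_integral_mono) (auto simp: indicator_def algebra_simps)
  also have "(\<integral>\<^sup>+z. ennreal (\<bar>f ((z + y) + (x - y)) - f (z + y)\<bar> powr p) \<partial>lborel)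
      = (\<integral>\<^sup>+z. ennreal (\<bar>f (z + (x - y)) - f z\<bar> powr p) \<partial>lborel)"
    by (rule nn_integral_lborel_translate[where f = "\<lambda>z. ennreal (\<bar>f (z + (x - y)) - f z\<bar> powr p)"]) measurable
  also have "ennreal (1 / m) * \<dots> \<le> ennreal (1 / m) * ennreal (norm (x - y) powr p * grad_int p f)"
    by (intro mult_left_mono test_function_translation f p) auto
  also have "\<dots> = ennreal (norm (x - y) powr p * grad_int p f / m)"
    using m by (simp add: ennreal_mult[symmetric])
  finally show ?thesis
    using m by (subst (asm) ennreal_le_iff) (auto simp: m_def[symmetric] intro!: divide_nonneg_pos mult_nonneg_nonneg)
qed

text \<open>On the ball of radius \<open>R + h\<close> the Hardy weight is bounded below, so the
  Hardy integral controls the averages over balls inside it.\<close>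

lemma ball_average_bound:
  fixes f :: "'a::euclidean_space \<Rightarrow> real"
  assumes f: "test_function f" and h: "0 < h" and p: "1 < p" and x: "norm x \<le> R"
    and H: "hardy_int p f \<le> ennreal c" and c: "0 \<le> c"
  shows "\<bar>ball_average h f x\<bar> powr p \<le> (1 + (R + h)) powr p * c / measure lborel (cball (0::'a) h)"
proof -
  note [measurable] = test_function_measurable[OF f]
  define m where "m = measure lborel (cball (0::'a) h)"
  have m: "0 < m" unfolding m_def by (rule content_cball_pos[OF h])
  have cg: "continuous_on UNIV (\<lambda>z. f (x + z))"
    by (intro continuous_intros continuous_on_compose2[OF test_function_continuous[OF f]]) auto
  have "ennreal (\<bar>ball_average h f x\<bar> powr p) \<le> ennreal (1 / m) * (\<integral>\<^sup>+z. indicator (cball 0 h) z * ennreal (\<bar>f (x + z)\<bar> powr p) \<partial>lborel)"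
    unfolding ball_average_def m_def by (rule average_powr_le[OF h p cg])
  also have "\<dots> \<le> ennreal (1 / m) * (\<integral>\<^sup>+z. ennreal ((1 + (R + h)) powr p) * ennreal ((1 + norm (z + x)) powr - p * \<bar>f (z + x)\<bar> powr p) \<partial>lborel)"
  proof (intro mult_left_mono nn_integral_mono)
    fix z :: 'a
    show "indicator (cball 0 h) z * ennreal (\<bar>f (x + z)\<bar> powr p)
      \<le> ennreal ((1 + (R + h)) powr p) * ennreal ((1 + norm (z + x)) powr - p * \<bar>f (z + x)\<bar> powr p)"
    proof (cases "z \<in> cball 0 h")
      case True
      have pos: "0 < 1 + norm (z + x)" by (simp add: add_pos_nonneg)
      have "norm (z + x) \<le> R + h" using True x norm_triangle_ineq[of z x] by simp
      then have "(1 + norm (z + x)) powr p \<le> (1 + (R + h)) powr p" using p by (intro powr_mono2) auto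
      then have "1 \<le> (1 + (R + h)) powr p * (1 + norm (z + x)) powr - p"
        using pos by (simp add: powr_minus_divide field_simps)
      then have "1 * \<bar>f (z + x)\<bar> powr p \<le> (1 + (R + h)) powr p * (1 + norm (z + x)) powr - p * \<bar>f (z + x)\<bar> powr p"
        by (rule mult_right_mono) simp
      then show ?thesis using True by (simp add: ennreal_mult[symmetric] ennreal_leI add.commute mult.assoc)
    qed simp
  qed simp
  also have "(\<integral>\<^sup>+z. ennreal ((1 + (R + h)) powr p) * ennreal ((1 + norm (z + x)) powr - p * \<bar>f (z + x)\<bar> powr p) \<partial>lborel)
      = ennreal ((1 + (R + h)) powr p) * (\<integral>\<^sup>+z. ennreal ((1 + norm (z + x)) powr - p * \<bar>f (z + x)\<bar> powr p) \<partial>lborel)"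
    by (rule nn_integral_cmult) measurable
  also have "(\<integral>\<^sup>+z. ennreal ((1 + norm (z + x)) powr - p * \<bar>f (z + x)\<bar> powr p) \<partial>lborel)
      = hardy_int p f"
    by (rule nn_integral_lborel_translate[where f = "\<lambda>z. ennreal ((1 + norm z) powr - p * \<bar>f z\<bar> powr p)"]) measurable
  also have "ennreal (1 / m) * (ennreal ((1 + (R + h)) powr p) * \<dots>) \<le> ennreal (1 / m) * (ennreal ((1 + (R + h)) powr p) * ennreal c)"
    by (intro mult_left_mono H) auto
  also have "\<dots> = ennreal ((1 + (R + h)) powr p * c / m)"
    using m c by (simp add: ennreal_mult[symmetric])
  finally show ?thesis
    using m c by (subst (asm) ennreal_le_iff) (auto simp: m_def[symmetric] intro!: divide_nonneg_pos mult_nonneg_nonneg)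
qed

text \<open>The exponent 2 is a convenience: the gradient of a test function is integrable to every
  positive power, and with 2 the Lipschitz constant is a square root.\<close>

lemma ball_average_continuous:
  fixes f :: "'a::euclidean_space \<Rightarrow> real"
  assumes f: "test_function f" and h: "0 < h"
  shows "continuous_on UNIV (ball_average h f)"
proof -
  define L where "L = grad_int 2 f / measure lborel (cball (0::'a) h)"
  have L: "0 \<le> L" by (simp add: L_def)
  have "\<bar>ball_average h f x - ball_average h f y\<bar> \<le> sqrt L * norm (x - y)" for x y
  proof -
    have "\<bar>ball_average h f x - ball_average h f y\<bar> powr 2 \<le> norm (x - y) powr 2 * L"
      using ball_average_lipschitz[OF f h, of 2 x y] by (simp add: L_def)
    then have "\<bar>ball_average h f x - ball_average h f y\<bar>\<^sup>2 \<le> (sqrt L * norm (x - y))\<^sup>2"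
      using L by (simp add: power_mult_distrib mult.commute)
    then show ?thesis by (rule power2_le_imp_le) (use L in simp)
  qed
  then show ?thesis
    by (intro lipschitz_on_continuous_on[of "sqrt L"] lipschitz_onI) (auto simp: dist_norm L)
qed

text \<open>By Tonelli each \<open>z\<close> in the ball contributes a translation integral, and its
  bound is at most the one for \<open>norm z = h\<close>.\<close>

lemma ball_average_approx:
  fixes f :: "'a::euclidean_space \<Rightarrow> real"
  assumes f: "test_function f" and h: "0 < h" and p: "1 < p"
  shows "(\<integral>\<^sup>+x. ennreal (\<bar>f x - ball_average h f x\<bar> powr p) \<partial>lborel) \<le> ennreal (h powr p * grad_int p f)"
proof -
  note [measurable] = test_function_measurable[OF f]
  note cf = test_function_continuous[OF f]
  define B where "B = cball (0::'a) h"
  have [measurable]: "B \<in> sets borel" by (simp add: B_def)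
  define m where "m = measure lborel B"
  have m: "0 < m" unfolding m_def B_def by (rule content_cball_pos[OF h])
  have eB: "emeasure lborel B = ennreal m"
    unfolding m_def B_def using emeasure_compact_finite[OF compact_cball, of "0::'a" h]
    by (intro emeasure_eq_ennreal_measure) auto
  have "(\<integral>\<^sup>+x. ennreal (\<bar>f x - ball_average h f x\<bar> powr p) \<partial>lborel)
    \<le> (\<integral>\<^sup>+x. ennreal (1 / m) * (\<integral>\<^sup>+z. indicator B z * ennreal (\<bar>f (x + z) - f x\<bar> powr p) \<partial>lborel) \<partial>lborel)"
  proof (rule nn_integral_mono)
    fix x :: 'a
    have cg: "continuous_on UNIV (\<lambda>z. f (x + z) - f x)"
      by (intro continuous_intros continuous_on_compose2[OF cf]) auto
    have i: "integrable lborel (\<lambda>z. indicator B z *\<^sub>R f (x + z))"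
      unfolding B_def by (intro borel_integrable_compact continuous_on_compose2[OF cf] continuous_intros) auto
    have j: "integrable lborel (\<lambda>z. indicator B z *\<^sub>R f x)"
      unfolding B_def by (intro borel_integrable_compact) auto
    have "(\<integral>z. indicator B z *\<^sub>R f x \<partial>lborel) = m * f x" by (simp add: m_def)
    then have "ball_average h f x - f x = (\<integral>z. indicator B z *\<^sub>R (f (x + z) - f x) \<partial>lborel) / m"
      unfolding ball_average_def scaleR_diff_right Bochner_Integration.integral_diff[OF i j]
      using m by (simp add: B_def[symmetric] m_def[symmetric] diff_divide_distrib)
    then have "\<bar>f x - ball_average h f x\<bar> = \<bar>(\<integral>z. indicator B z *\<^sub>R (f (x + z) - f x) \<partial>lborel) / m\<bar>"
      by (metis abs_minus_commute)
    then show "ennreal (\<bar>f x - ball_average h f x\<bar> powr p)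
        \<le> ennreal (1 / m) * (\<integral>\<^sup>+z. indicator B z * ennreal (\<bar>f (x + z) - f x\<bar> powr p) \<partial>lborel)"
      using average_powr_le[OF h p cg] by (simp only: m_def B_def)
  qed
  also have "\<dots> = ennreal (1 / m) * (\<integral>\<^sup>+x. \<integral>\<^sup>+z. indicator B z * ennreal (\<bar>f (x + z) - f x\<bar> powr p) \<partial>lborel \<partial>lborel)"
    by (rule nn_integral_cmult) measurable
  also have "(\<integral>\<^sup>+x. \<integral>\<^sup>+z. indicator B z * ennreal (\<bar>f (x + z) - f x\<bar> powr p) \<partial>lborel \<partial>lborel)
      = (\<integral>\<^sup>+z. \<integral>\<^sup>+x. indicator B z * ennreal (\<bar>f (x + z) - f x\<bar> powr p) \<partial>lborel \<partial>lborel)"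
    by (rule lborel_pair.Fubini'[symmetric]) measurable
  also have "\<dots> \<le> (\<integral>\<^sup>+z. indicator B z * ennreal (h powr p * grad_int p f) \<partial>lborel)"
  proof (rule nn_integral_mono)
    fix z :: 'a
    show "(\<integral>\<^sup>+x. indicator B z * ennreal (\<bar>f (x + z) - f x\<bar> powr p) \<partial>lborel) \<le> indicator B z * ennreal (h powr p * grad_int p f)"
    proof (cases "z \<in> B")
      case True
      have "(\<integral>\<^sup>+x. ennreal (\<bar>f (x + z) - f x\<bar> powr p) \<partial>lborel) \<le> ennreal (norm z powr p * grad_int p f)"
        by (rule test_function_translation[OF f p])
      also have "\<dots> \<le> ennreal (h powr p * grad_int p f)"
        using True p by (intro ennreal_leI mult_right_mono powr_mono2) (auto simp: B_def)
      finally show ?thesis using True by simp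
    qed simp
  qed
  also have "\<dots> = ennreal m * ennreal (h powr p * grad_int p f)"
    by (simp add: nn_integral_multc eB)
  also have "ennreal (1 / m) * \<dots> = ennreal (h powr p * grad_int p f)"
    using m by (simp add: mult.assoc[symmetric] ennreal_mult[symmetric])
  finally show ?thesis by (simp add: mult_left_mono)
qed

lemma ball_average_diff:
  fixes f g :: "'a::euclidean_space \<Rightarrow> real"
  assumes f: "test_function f" and g: "test_function g"
  shows "ball_average h (\<lambda>x. f x - g x) x = ball_average h f x - ball_average h g x"
proof -
  have i: "integrable lborel (\<lambda>z. indicator (cball 0 h) z *\<^sub>R u (x + z))" if "test_function u" for u :: "'a \<Rightarrow> real"
    by (intro borel_integrable_compact continuous_on_compose2[OF test_function_continuous[OF that]] continuous_intros) auto
  show ?thesis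
    unfolding ball_average_def scaleR_diff_right Bochner_Integration.integral_diff[OF i[OF f] i[OF g]]
    by (rule diff_divide_distrib)
qed

lemma grad_int_diff_le:
  assumes "test_function f" "test_function g" and p: "1 < p" and "grad_int p f \<le> M" "grad_int p g \<le> M"
  shows "grad_int p (\<lambda>x. f x - g x) \<le> 2 powr p * M"
proof -
  have "grad_int p (\<lambda>x. f x - g x) = Lp_int p lebesgue (\<lambda>x. classical_grad f x - classical_grad g x)"
    by (simp add: test_function_grad_diff assms Lp_int_def)
  also have "\<dots> \<le> 2 powr (p - 1) * (grad_int p f + grad_int p g)"
    using p by (intro Lp_diff(2) test_function_Lp assms) auto
  also have "\<dots> \<le> 2 powr (p - 1) * (M + M)" using assms by (intro mult_left_mono add_mono) auto
  also have "\<dots> = 2 powr p * M" by (simp add: powr_diff)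
  finally show ?thesis .
qed

text \<open>Splitting the weighted integral into a ball, where \<open>f\<close> is compared with its average,
  and the complement, where the weight is a small multiple of the Hardy weight.\<close>

lemma decay_norm_split:
  fixes f :: "'a::euclidean_space \<Rightarrow> real"
  assumes f: "test_function f" and p: "1 < p" "p < real DIM('a)" and \<alpha>: "0 < \<alpha>" and h: "0 < h" and R: "0 \<le> R"
    and H: "hardy_int p f \<le> ennreal c" and c: "0 \<le> c"
    and d: "0 \<le> d" "\<And>x. x \<in> cball 0 R \<Longrightarrow> \<bar>ball_average h f x\<bar> \<le> d"
  shows "f \<in> Lp_space p (decay_measure \<alpha>)"
    "Lp_int p (decay_measure \<alpha>) f \<le> 2 powr (p - 1) * (h powr p * grad_int p f + d powr p * measure lborel (cball (0::'a) R))
      + 2 powr (real DIM('a) + \<alpha>) * (1 + R) powr (p - (real DIM('a) + \<alpha>)) * c"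
proof -
  note [measurable] = test_function_measurable[OF f] continuous_UNIV_measurable(1)[OF ball_average_continuous[OF f h]]
  define t where "t = 2 powr (real DIM('a) + \<alpha>) * (1 + R) powr (p - (real DIM('a) + \<alpha>))"
  define k where "k = (2::real) powr (p - 1)"
  define m where "m = measure lborel (cball (0::'a) R)"
  have t: "0 \<le> t" and k: "0 \<le> k" and m: "0 \<le> m" by (auto simp: t_def k_def m_def)
  have em: "emeasure lborel (cball (0::'a) R) = ennreal m"
    unfolding m_def using emeasure_compact_finite[OF compact_cball, of "0::'a" R]
    by (intro emeasure_eq_ennreal_measure) auto
  define B where "B = k * (h powr p * grad_int p f + d powr p * m) + t * c"
  have B: "0 \<le> B" using t k m c by (auto simp: B_def intro!: add_nonneg_nonneg mult_nonneg_nonneg)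
  have "(\<integral>\<^sup>+x. ennreal (norm (f x) powr p) \<partial>decay_measure \<alpha>)
    \<le> (\<integral>\<^sup>+x. ennreal k * (ennreal (\<bar>f x - ball_average h f x\<bar> powr p) + ennreal (d powr p) * indicator (cball 0 R) x)
       + ennreal t * ennreal ((1 + norm x) powr - p * \<bar>f x\<bar> powr p) \<partial>lborel)"
    unfolding nn_integral_decay_measure[OF test_function_measurable(1)[OF f]]
  proof (rule nn_integral_mono)
    fix x :: 'a
    show "ennreal (decay_weight \<alpha> x * \<bar>f x\<bar> powr p)
      \<le> ennreal k * (ennreal (\<bar>f x - ball_average h f x\<bar> powr p) + ennreal (d powr p) * indicator (cball 0 R) x)
       + ennreal t * ennreal ((1 + norm x) powr - p * \<bar>f x\<bar> powr p)"
    proof (cases "x \<in> cball 0 R")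
      case True
      have "decay_weight \<alpha> x * \<bar>f x\<bar> powr p \<le> \<bar>f x\<bar> powr p"
        using decay_weight_le_1[of \<alpha> x] decay_weight_pos[of \<alpha> x] by (intro mult_left_le_one_le) auto
      also have "\<dots> \<le> k * (\<bar>f x - ball_average h f x\<bar> powr p + \<bar>ball_average h f x\<bar> powr p)"
        using norm_add_powr_le2[OF p(1), of "f x - ball_average h f x" "ball_average h f x"] by (simp add: k_def)
      also have "\<dots> \<le> k * (\<bar>f x - ball_average h f x\<bar> powr p + d powr p)"
        using d(2)[OF True] p k by (intro mult_left_mono add_left_mono powr_mono2) auto
      finally have "ennreal (decay_weight \<alpha> x * \<bar>f x\<bar> powr p) \<le> ennreal (k * (\<bar>f x - ball_average h f x\<bar> powr p + d powr p))"
        by (rule ennreal_leI)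
      then show ?thesis using True k by (intro add_increasing2) (auto simp: ennreal_mult ennreal_plus)
    next
      case False
      have "decay_weight \<alpha> x \<le> t * (1 + norm x) powr - p"
        unfolding t_def using False by (intro decay_weight_le_hardy \<alpha> p R) auto
      then have "decay_weight \<alpha> x * \<bar>f x\<bar> powr p \<le> t * (1 + norm x) powr - p * \<bar>f x\<bar> powr p"
        by (rule mult_right_mono) simp
      then have "ennreal (decay_weight \<alpha> x * \<bar>f x\<bar> powr p) \<le> ennreal t * ennreal ((1 + norm x) powr - p * \<bar>f x\<bar> powr p)"
        using t by (simp add: ennreal_mult[symmetric] ennreal_leI mult.assoc)
      then show ?thesis by (intro add_increasing) auto
    qed
  qed
  also have "\<dots> = ennreal k * ((\<integral>\<^sup>+x. ennreal (\<bar>f x - ball_average h f x\<bar> powr p) \<partial>lborel) + ennreal (d powr p) * ennreal m)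
       + ennreal t * hardy_int p f"
  proof -
    have eq: "(\<integral>\<^sup>+x. k * (A x + c * D x) + t * E x \<partial>lborel) = k * ((\<integral>\<^sup>+x. A x \<partial>lborel) + c * (\<integral>\<^sup>+x. D x \<partial>lborel)) + t * (\<integral>\<^sup>+x. E x \<partial>lborel)"
      if [measurable]: "A \<in> borel_measurable lborel" "D \<in> borel_measurable lborel" "E \<in> borel_measurable lborel"
      for A D E :: "'a \<Rightarrow> ennreal" and k c t :: ennreal
      by (simp add: nn_integral_add nn_integral_cmult)
    have D: "(\<lambda>x::'a. indicator (cball 0 R) x :: ennreal) \<in> borel_measurable lborel"
      by (rule borel_measurable_indicator) simp
    show ?thesis
      by (subst eq) (use D in \<open>simp_all add: em\<close>)
  qed
  also have "\<dots> \<le> ennreal k * (ennreal (h powr p * grad_int p f) + ennreal (d powr p) * ennreal m) + ennreal t * ennreal c"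
    by (intro add_mono mult_left_mono ball_average_approx f h p H) auto
  also have "\<dots> = ennreal B"
    using t k m c by (simp add: B_def ennreal_mult ennreal_plus)
  finally have le: "(\<integral>\<^sup>+x. ennreal (norm (f x) powr p) \<partial>decay_measure \<alpha>) \<le> ennreal B" .
  show L: "f \<in> Lp_space p (decay_measure \<alpha>)"
    by (rule Lp_spaceI_nn) (use le in \<open>auto simp: le_less_trans\<close>)
  have "Lp_int p (decay_measure \<alpha>) f \<le> B"
    using le B unfolding nn_integral_Lp[OF L] by (simp only: ennreal_le_iff)
  then show "Lp_int p (decay_measure \<alpha>) f \<le> 2 powr (p - 1) * (h powr p * grad_int p f + d powr p * measure lborel (cball (0::'a) R))
      + 2 powr (real DIM('a) + \<alpha>) * (1 + R) powr (p - (real DIM('a) + \<alpha>)) * c"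
    by (simp add: B_def k_def m_def t_def)
qed

lemma powr_le_imp_le_root:
  fixes a b p :: real
  assumes "a powr p \<le> b" "0 \<le> a" "0 < p"
  shows "a \<le> b powr (1 / p)"
proof -
  have "(a powr p) powr (1 / p) \<le> b powr (1 / p)" using assms by (intro powr_mono2) auto
  then show ?thesis using assms by (simp add: powr_powr)
qed

lemma tendsto_powr_0:
  assumes "0 < p"
  shows "((\<lambda>h::real. h powr p) \<longlongrightarrow> 0) (at_right 0)"
proof -
  have "((\<lambda>h::real. h powr p) \<longlongrightarrow> 0 powr p) (at_right 0)"
    using assms by (intro tendsto_powr' tendsto_ident_at) (auto simp: eventually_at_right_less less_imp_le eventually_at_filter)
  then show ?thesis by simp
qed

text \<open>Compactness up to one fixed tolerance \<open>e\<close>. First \<open>R\<close> makes the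
  tail small, then \<open>h\<close> makes the averages close to the functions; \<open>d\<close>,
  adapted to the volume of the ball of radius \<open>R\<close>, is the uniform closeness that
  Arzela-Ascoli provides for averages at the fixed scale \<open>h\<close>.\<close>

lemma embedding_almost_compact:
  fixes \<phi> :: "nat \<Rightarrow> 'a::euclidean_space \<Rightarrow> real"
  assumes p: "1 < p" "p < real DIM('a)" and \<alpha>: "0 < \<alpha>" and \<phi>: "\<And>n. test_function (\<phi> n)"
    and M: "\<And>n. grad_int p (\<phi> n) \<le> M" and e: "0 < e"
  obtains r :: "nat \<Rightarrow> nat" and N where "strict_mono r"
    "\<And>m n. m \<ge> N \<Longrightarrow> n \<ge> N \<Longrightarrow> Lp_int p (decay_measure \<alpha>) (\<lambda>x. \<phi> (r m) x - \<phi> (r n) x) < e"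
proof -
  obtain C where C: "0 < C" "\<And>f :: 'a \<Rightarrow> real. test_function f \<Longrightarrow>
    hardy_int p f \<le> ennreal (C * grad_int p f)"
    by (rule hardy_inequality[OF p]) blast
  have M0: "0 \<le> M" using M[of 0] Lp_int_nonneg order_trans by blast
  \<comment> \<open>Bounds the gradient integral of the difference of any two members, to which the
    splitting is applied.\<close>
  define M' where "M' = 2 powr p * M"
  have M': "0 \<le> M'" using M0 by (simp add: M'_def)
  define b where "b = real DIM('a) + \<alpha>"
  define k where "k = (2::real) powr (p - 1)"
  have k: "0 < k" by (simp add: k_def)
  have "((\<lambda>R. 2 powr b * (1 + R) powr (p - b) * (C * M')) \<longlongrightarrow> 2 powr b * 0 * (C * M')) at_top"
  proof (intro tendsto_intros)
    have "filterlim (\<lambda>R::real. 1 + R) at_top at_top" by (rule filterlim_tendsto_add_at_top[OF tendsto_const filterlim_ident])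
    then show "((\<lambda>R. (1 + R) powr (p - b)) \<longlongrightarrow> 0) at_top"
      using p \<alpha> by (intro tendsto_neg_powr) (auto simp: b_def)
  qed
  then have "\<forall>\<^sub>F R in at_top. 2 powr b * (1 + R) powr (p - b) * (C * M') < e / 4"
    using e by (intro order_tendstoD) auto
  then have "\<forall>\<^sub>F R in at_top. 0 \<le> R \<and> 2 powr b * (1 + R) powr (p - b) * (C * M') < e / 4"
    using eventually_ge_at_top[of 0] by eventually_elim auto
  then obtain R where R: "0 \<le> R" "2 powr b * (1 + R) powr (p - b) * (C * M') < e / 4"
    using eventually_happens[of _ "at_top :: real filter"] by auto
  have "((\<lambda>h. k * (h powr p * M')) \<longlongrightarrow> k * (0 * M')) (at_right 0)"
    using p by (intro tendsto_intros tendsto_powr_0) auto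
  then have "\<forall>\<^sub>F h in at_right 0. k * (h powr p * M') < e / 4"
    using e by (intro order_tendstoD) auto
  then have "\<forall>\<^sub>F h in at_right 0. 0 < h \<and> k * (h powr p * M') < e / 4"
    using eventually_at_right_less[of "0::real"] by eventually_elim auto
  then obtain h where h: "0 < h" "k * (h powr p * M') < e / 4"
    using eventually_happens[of _ "at_right (0::real)"] by auto
  define m where "m = measure lborel (cball (0::'a) R)"
  have "((\<lambda>d. k * (d powr p * m)) \<longlongrightarrow> k * (0 * m)) (at_right 0)"
    using p by (intro tendsto_intros tendsto_powr_0) auto
  then have "\<forall>\<^sub>F d in at_right 0. k * (d powr p * m) < e / 4"
    using e by (intro order_tendstoD) auto
  then have "\<forall>\<^sub>F d in at_right 0. 0 < d \<and> k * (d powr p * m) < e / 4"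
    using eventually_at_right_less[of "0::real"] by eventually_elim auto
  then obtain d where d: "0 < d" "k * (d powr p * m) < e / 4"
    using eventually_happens[of _ "at_right (0::real)"] by auto
  define mh where "mh = measure lborel (cball (0::'a) h)"
  have mh: "0 < mh" unfolding mh_def by (rule content_cball_pos[OF h(1)])
  have bound: "norm (ball_average h (\<phi> n) x) \<le> ((1 + (R + h)) powr p * (C * M) / mh) powr (1 / p)" if "x \<in> cball 0 R" for n x
  proof -
    have "C * grad_int p (\<phi> n) \<le> C * M" using C M by (intro mult_left_mono) auto
    with C(2)[OF \<phi>[of n]] have "hardy_int p (\<phi> n) \<le> ennreal (C * M)"
      by (meson ennreal_leI order_trans)
    from ball_average_bound[OF \<phi> h(1) p(1) _ this] that C M0
    have "\<bar>ball_average h (\<phi> n) x\<bar> powr p \<le> (1 + (R + h)) powr p * (C * M) / mh" by (simp add: mh_def)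
    then show ?thesis using p unfolding real_norm_def by (intro powr_le_imp_le_root) auto
  qed
  have equi: "\<exists>\<delta>>0. \<forall>n y. y \<in> cball 0 R \<and> norm (x - y) < \<delta> \<longrightarrow> norm (ball_average h (\<phi> n) x - ball_average h (\<phi> n) y) < \<epsilon>"
    if \<epsilon>: "0 < \<epsilon>" for x :: 'a and \<epsilon>
  proof -
    \<comment> \<open>The added 1 keeps \<open>L\<close> positive even if \<open>M\<close> is
      0.\<close>
    define L where "L = M / mh + 1"
    have L: "0 < L" "M / mh < L" using M0 mh by (auto simp: L_def add_nonneg_pos)
    define \<delta> where "\<delta> = (\<epsilon> powr p / L) powr (1 / p)"
    have \<delta>: "0 < \<delta>" using \<epsilon> L by (simp add: \<delta>_def)
    have \<delta>p: "\<delta> powr p = \<epsilon> powr p / L" using \<epsilon> L p by (simp add: \<delta>_def powr_powr)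
    have "norm (ball_average h (\<phi> n) x - ball_average h (\<phi> n) y) < \<epsilon>" if y: "norm (x - y) < \<delta>" for n y
    proof -
      have "\<bar>ball_average h (\<phi> n) x - ball_average h (\<phi> n) y\<bar> powr p \<le> norm (x - y) powr p * grad_int p (\<phi> n) / mh"
        unfolding mh_def by (rule ball_average_lipschitz[OF \<phi> h(1) p(1)])
      also have "\<dots> \<le> norm (x - y) powr p * L"
      proof -
        have "grad_int p (\<phi> n) / mh \<le> L" using M[of n] mh L by (intro order_trans[OF divide_right_mono less_imp_le]) auto
        then show ?thesis using mult_left_mono[of "grad_int p (\<phi> n) / mh" L "norm (x - y) powr p"] by simp
      qed
      also have "\<dots> < \<delta> powr p * L" using y L p by (intro mult_strict_right_mono powr_less_mono2) auto
      also have "\<dots> = \<epsilon> powr p" using L by (simp add: \<delta>p)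
      finally have *: "\<bar>ball_average h (\<phi> n) x - ball_average h (\<phi> n) y\<bar> powr p < \<epsilon> powr p" .
      show ?thesis
      proof (rule ccontr)
        assume "\<not> ?thesis"
        then have "\<epsilon> powr p \<le> \<bar>ball_average h (\<phi> n) x - ball_average h (\<phi> n) y\<bar> powr p"
          using \<epsilon> p by (intro powr_mono2) auto
        with * show False by simp
      qed
    qed
    then show ?thesis using \<delta> by blast
  qed
  obtain g and r :: "nat \<Rightarrow> nat" where r: "strict_mono r"
    and g: "\<And>\<epsilon>. 0 < \<epsilon> \<Longrightarrow> \<exists>N. \<forall>n x. n \<ge> N \<and> x \<in> cball 0 R \<longrightarrow> norm (ball_average h (\<phi> (r n)) x - g x) < \<epsilon>"
    by (rule Arzela_Ascoli[where \<F> = "\<lambda>n. ball_average h (\<phi> n)", OF compact_cball[of "0::'a" R] bound equi]) blast+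
  obtain N where N: "\<And>n x. n \<ge> N \<Longrightarrow> x \<in> cball 0 R \<Longrightarrow> norm (ball_average h (\<phi> (r n)) x - g x) < d / 2"
    using g[of "d / 2"] d by auto
  have "Lp_int p (decay_measure \<alpha>) (\<lambda>x. \<phi> (r i) x - \<phi> (r j) x) < e" if "i \<ge> N" "j \<ge> N" for i j
  proof -
    define f where "f = (\<lambda>x. \<phi> (r i) x - \<phi> (r j) x)"
    have f: "test_function f" unfolding f_def by (intro test_function_diff \<phi>)
    have gf: "grad_int p f \<le> M'" unfolding f_def M'_def by (intro grad_int_diff_le \<phi> p M)
    then have "C * grad_int p f \<le> C * M'" using C by (intro mult_left_mono) auto
    with C(2)[OF f] have H: "hardy_int p f \<le> ennreal (C * M')"
      by (meson ennreal_leI order_trans)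
    have avg: "\<bar>ball_average h f x\<bar> \<le> d" if x: "x \<in> cball 0 R" for x
    proof -
      have "ball_average h f x = (ball_average h (\<phi> (r i)) x - g x) - (ball_average h (\<phi> (r j)) x - g x)"
        unfolding f_def by (simp add: ball_average_diff \<phi>)
      also have "norm \<dots> \<le> d / 2 + d / 2"
        by (intro order_trans[OF norm_triangle_ineq4] add_mono less_imp_le N x \<open>i \<ge> N\<close> \<open>j \<ge> N\<close>)
      finally show ?thesis by simp
    qed
    have "Lp_int p (decay_measure \<alpha>) f \<le> k * (h powr p * grad_int p f + d powr p * m) + 2 powr b * (1 + R) powr (p - b) * (C * M')"
      unfolding k_def m_def b_def
      by (rule decay_norm_split(2)[OF f p \<alpha> h(1) R(1) H _ less_imp_le[OF d(1)] avg]) (use C M' in auto)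
    also have "\<dots> \<le> k * (h powr p * M' + d powr p * m) + 2 powr b * (1 + R) powr (p - b) * (C * M')"
      using gf k by (intro add_right_mono mult_left_mono) auto
    also have "\<dots> < e" using h(2) d(2) R(2) e by (simp add: distrib_left)
    finally show ?thesis by (simp add: f_def)
  qed
  with r that show ?thesis by blast
qed

text \<open>A diagonal sequence over the tolerances \<open>1 / (k + 1)\<close>. Only past its first
  \<open>k + 1\<close> terms is it a subsequence of the sequence selected for the k-th tolerance,
  hence the shift by \<open>Suc k\<close>. The property \<open>P k\<close> speaks of all large
  indices and so is inherited by subsequences.\<close>

lemma embedding_compact:
  fixes \<phi> :: "nat \<Rightarrow> 'a::euclidean_space \<Rightarrow> real"
  assumes p: "1 < p" "p < real DIM('a)" and \<alpha>: "0 < \<alpha>" and \<phi>: "\<And>n. test_function (\<phi> n)"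
    and M: "\<And>n. grad_int p (\<phi> n) \<le> M"
  obtains r :: "nat \<Rightarrow> nat" where "strict_mono r" "Lp_Cauchy p (decay_measure \<alpha>) (\<lambda>n. \<phi> (r n))"
proof -
  define P where "P k s \<longleftrightarrow> (\<exists>N. \<forall>m\<ge>N. \<forall>n\<ge>N. Lp_int p (decay_measure \<alpha>) (\<lambda>x. \<phi> (s m) x - \<phi> (s n) x) < 1 / real (Suc k))"
    for k and s :: "nat \<Rightarrow> nat"
  interpret subseqs P
  proof
    fix k and s :: "nat \<Rightarrow> nat" assume "strict_mono s"
    obtain r :: "nat \<Rightarrow> nat" and N where "strict_mono r"
      "\<And>m n. m \<ge> N \<Longrightarrow> n \<ge> N \<Longrightarrow> Lp_int p (decay_measure \<alpha>) (\<lambda>x. \<phi> (s (r m)) x - \<phi> (s (r n)) x) < 1 / real (Suc k)"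
      by (rule embedding_almost_compact[OF p \<alpha>, of "\<lambda>n. \<phi> (s n)" M "1 / real (Suc k)"]) (use \<phi> M in auto)
    then show "\<exists>r. strict_mono r \<and> P k (s \<circ> r)" unfolding P_def o_def by blast
  qed
  have holds: "P k (diagseq \<circ> ((+) (Suc k)))" for k
  proof (rule diagseq_holds)
    fix r s :: "nat \<Rightarrow> nat" and n assume r: "strict_mono r" and "P n s"
    then obtain N where N: "\<And>i j. i \<ge> N \<Longrightarrow> j \<ge> N \<Longrightarrow> Lp_int p (decay_measure \<alpha>) (\<lambda>x. \<phi> (s i) x - \<phi> (s j) x) < 1 / real (Suc n)"
      unfolding P_def by blast
    have "r i \<ge> N" if "i \<ge> N" for i using seq_suble[OF r, of i] that by simp
    then show "P n (s \<circ> r)" unfolding P_def o_def using N by blast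
  qed
  have "Lp_Cauchy p (decay_measure \<alpha>) (\<lambda>n. \<phi> (diagseq n))"
    unfolding Lp_Cauchy_def
  proof (intro allI impI)
    fix e :: real assume "0 < e"
    then obtain k where k: "1 / real (Suc k) < e" using nat_approx_posE by blast
    obtain N where N: "\<And>m n. m \<ge> N \<Longrightarrow> n \<ge> N \<Longrightarrow> Lp_int p (decay_measure \<alpha>) (\<lambda>x. \<phi> (diagseq (Suc k + m)) x - \<phi> (diagseq (Suc k + n)) x) < 1 / real (Suc k)"
      using holds[of k] unfolding P_def o_def by blast
    have "Lp_int p (decay_measure \<alpha>) (\<lambda>x. \<phi> (diagseq m) x - \<phi> (diagseq n) x) < e"
      if "m \<ge> Suc k + N" "n \<ge> Suc k + N" for m n
    proof -
      have "m = Suc k + (m - Suc k)" "n = Suc k + (n - Suc k)" "m - Suc k \<ge> N" "n - Suc k \<ge> N" using that by auto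
      then show ?thesis using N[of "m - Suc k" "n - Suc k"] k by (metis less_trans)
    qed
    then show "\<exists>N. \<forall>m\<ge>N. \<forall>n\<ge>N. Lp_int p (decay_measure \<alpha>) (\<lambda>x. \<phi> (diagseq m) x - \<phi> (diagseq n) x) < e" by blast
  qed
  then show ?thesis using subseq_diagseq that by blast
qed

section \<open>The nonlinear term\<close>

text \<open>Continuity and growth are required at every point; the exceptional null set is dealt
  with when the locale is applied. \<open>A\<close> and \<open>B\<close> are kept apart because only
  \<open>B\<close> enters the smallness condition.\<close>

locale caratheodory_growth = finite_measure M for M :: "'x measure" +
  fixes f :: "'x \<Rightarrow> real \<Rightarrow> real" and A B p :: real
  assumes p: "1 < p" and A: "0 \<le> A" and B: "0 \<le> B"
    and meas: "\<And>s. (\<lambda>x. f x s) \<in> borel_measurable M"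
    and cont: "\<And>x. continuous_on UNIV (f x)"
    and growth: "\<And>x s. \<bar>f x s\<bar> \<le> A + B * \<bar>s\<bar> powr (p - 1)"
begin

text \<open>\<open>v\<close> is approximated by functions with countably many values, for which
  measurability in the first variable suffices; continuity in the second passes to the limit. The
  map \<open>h\<close> allows \<open>N\<close> to be a product space, as the parameter integral
  \<open>F\<close> requires.\<close>

lemma measurable_caratheodory_comp:
  assumes [measurable]: "v \<in> borel_measurable N" "h \<in> measurable N M"
  shows "(\<lambda>y. f (h y) (v y)) \<in> borel_measurable N"
proof (rule borel_measurable_LIMSEQ_real)
  let ?g = "\<lambda>k y. real_of_int \<lfloor>v y * real (Suc k)\<rfloor> / real (Suc k)"
  show "(\<lambda>k. f (h y) (?g k y)) \<longlonglongrightarrow> f (h y) (v y)" for y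
  proof -
    have "(\<lambda>k. ?g k y) \<longlonglongrightarrow> v y"
    proof (rule real_tendsto_sandwich[of "\<lambda>k. v y - 1 / real (Suc k)" _ _ "\<lambda>k. v y"])
      have "(\<lambda>k. v y - 1 / real (Suc k)) \<longlonglongrightarrow> v y - 0"
        by (intro tendsto_intros LIMSEQ_Suc[OF lim_1_over_n])
      then show "(\<lambda>k. v y - 1 / real (Suc k)) \<longlonglongrightarrow> v y" by simp
      show "\<forall>\<^sub>F k in sequentially. v y - 1 / real (Suc k) \<le> ?g k y"
      proof (intro always_eventually allI)
        fix k
        have "v y * real (Suc k) - 1 \<le> real_of_int \<lfloor>v y * real (Suc k)\<rfloor>" by linarith
        then have "(v y * real (Suc k) - 1) / real (Suc k) \<le> ?g k y" by (rule divide_right_mono) simp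
        then show "v y - 1 / real (Suc k) \<le> ?g k y" by (simp add: diff_divide_distrib)
      qed
      show "\<forall>\<^sub>F k in sequentially. ?g k y \<le> v y"
      proof (intro always_eventually allI)
        fix k
        have "?g k y \<le> v y * real (Suc k) / real (Suc k)" by (intro divide_right_mono) auto
        then show "?g k y \<le> v y" by simp
      qed
    qed simp
    moreover have "isCont (f (h y)) (v y)" using cont continuous_on_eq_continuous_at[OF open_UNIV] by blast
    ultimately show ?thesis by (rule isCont_tendsto_compose[rotated])
  qed
  show "(\<lambda>y. f (h y) (?g k y)) \<in> borel_measurable N" for k
  proof -
    have "(\<lambda>y. f (h y) (real_of_int i / real (Suc k))) \<in> borel_measurable N" for i
      by (rule measurable_compose[OF _ meas]) measurable
    then show ?thesis
      by (rule measurable_compose_countable[where f = "\<lambda>i y. f (h y) (real_of_int i / real (Suc k))" and g = "\<lambda>y. \<lfloor>v y * real (Suc k)\<rfloor>"]) measurable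
  qed
qed

text \<open>The primitive of \<open>f x\<close> vanishing at 0, with the path from 0 to
  \<open>s\<close> rescaled to the unit interval: the domain of integration is fixed, so
  measurability is that of a parameter integral, and the sign of \<open>s\<close> makes no
  difference.\<close>

definition F :: "'x \<Rightarrow> real \<Rightarrow> real" where
  "F x s = (\<integral>r. indicator {0..1} r *\<^sub>R (f x (r * s) * s) \<partial>lborel)"

lemma measurable_F [measurable]:
  assumes [measurable]: "v \<in> borel_measurable M"
  shows "(\<lambda>x. F x (v x)) \<in> borel_measurable M"
proof -
  have [measurable]: "(\<lambda>(x, r). f x (r * v x)) \<in> borel_measurable (M \<Otimes>\<^sub>M lborel)"
    using measurable_caratheodory_comp[where N = "M \<Otimes>\<^sub>M lborel" and h = fst and v = "\<lambda>y. snd y * v (fst y)"]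
    by (simp add: case_prod_beta')
  show ?thesis unfolding F_def by measurable
qed

lemma F_derivative: "(F x has_real_derivative f x s) (at s)"
proof -
  have c: "isCont (f x) y" for y using cont continuous_on_eq_continuous_at[OF open_UNIV] by blast
  \<comment> \<open>Continuity gives an antiderivative \<open>P\<close> on the whole line. The
    rescaled integral turns out to be \<open>P - P 0\<close>, so no integral has to be
    differentiated in its parameter.\<close>
  have "\<exists>P. \<forall>y. (-\<infinity>) < ereal y \<longrightarrow> ereal y < \<infinity> \<longrightarrow> (P has_vector_derivative f x y) (at y)"
    by (rule einterval_antiderivative) (auto intro: c)
  then obtain P where P: "\<And>y. (P has_real_derivative f x y) (at y)"
    by (auto simp: has_real_derivative_iff_has_vector_derivative)
  have "F x y = P y - P 0" for y
  proof -
    have "(\<integral>r. indicator {0..1} r *\<^sub>R (f x (r * y) * y) \<partial>lborel) = P (1 * y) - P (0 * y)"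
    proof (rule integral_FTC_atLeastAtMost)
      show "continuous_on {0..1} (\<lambda>r. f x (r * y) * y)"
        by (intro continuous_intros continuous_on_compose2[OF cont]) auto
      have "((\<lambda>r. P (r * y)) has_real_derivative f x (r * y) * y) (at r)" for r
        by (rule DERIV_chain2[OF P]) (auto intro!: derivative_eq_intros)
      then show "((\<lambda>r. P (r * y)) has_vector_derivative f x (r * y) * y) (at r within {0..1})" for r
        by (simp add: has_real_derivative_iff_has_vector_derivative has_vector_derivative_at_within)
    qed simp
    then show ?thesis by (simp add: F_def)
  qed
  then have "F x = (\<lambda>y. P y - P 0)" by auto
  then show ?thesis using P by (auto intro!: derivative_eq_intros)
qed

lemma F_0 [simp]: "F x 0 = 0" by (simp add: F_def)

text \<open>The mean value theorem, with \<open>\<bar>s\<bar> + \<bar>t\<bar>\<close> bounding every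
  intermediate point.\<close>

lemma F_lipschitz: "\<bar>F x s - F x t\<bar> \<le> (A + B * (\<bar>s\<bar> + \<bar>t\<bar>) powr (p - 1)) * \<bar>s - t\<bar>"
proof -
  have *: "\<bar>F x b - F x a\<bar> \<le> (A + B * (\<bar>a\<bar> + \<bar>b\<bar>) powr (p - 1)) * (b - a)" if ab: "a < b" for a b
  proof -
    obtain z where z: "a < z" "z < b" "F x b - F x a = (b - a) * f x z"
      using MVT2[OF ab, of "F x" "f x"] F_derivative by blast
    have "\<bar>f x z\<bar> \<le> A + B * \<bar>z\<bar> powr (p - 1)" by (rule growth)
    also have "\<dots> \<le> A + B * (\<bar>a\<bar> + \<bar>b\<bar>) powr (p - 1)"
      using z p B by (intro add_left_mono mult_left_mono powr_mono2) auto
    finally have "(b - a) * \<bar>f x z\<bar> \<le> (b - a) * (A + B * (\<bar>a\<bar> + \<bar>b\<bar>) powr (p - 1))"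
      using ab by (intro mult_left_mono) auto
    then show ?thesis using ab z(3) by (simp add: abs_mult mult.commute)
  qed
  consider "s < t" | "s = t" | "t < s" by linarith
  then show ?thesis using *[of s t] *[of t s] by cases (auto simp: add.commute abs_minus_commute)
qed

lemma F_abs_le: "\<bar>F x s\<bar> \<le> A * \<bar>s\<bar> + B * \<bar>s\<bar> powr p"
proof -
  have "\<bar>F x s\<bar> \<le> (A + B * \<bar>s\<bar> powr (p - 1)) * \<bar>s\<bar>" using F_lipschitz[of x s 0] by simp
  also have "\<dots> = A * \<bar>s\<bar> + B * \<bar>s\<bar> powr p"
    by (cases "s = 0") (use p in \<open>auto simp: distrib_right powr_diff\<close>)
  finally show ?thesis .
qed

text \<open>The factor \<open>1/p\<close> is what makes the smallness condition on the growth constant sharp.\<close>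

lemma F_le: "F x s \<le> A * \<bar>s\<bar> + B / p * \<bar>s\<bar> powr p"
proof -
  have *: "g s \<le> A * s + B / p * s powr p"
    if s: "0 \<le> s" and g0: "g 0 = 0" and g: "\<And>y. (g has_real_derivative g' y) (at y)" and le: "\<And>y::real. 0 < y \<Longrightarrow> g' y \<le> A + B * y powr (p - 1)"
    for s and g g' :: "real \<Rightarrow> real"
  proof -
    define k where "k y = A * y + B / p * y powr p - g y" for y
    have "k 0 \<le> k s"
    proof (rule DERIV_nonneg_imp_increasing_open[OF s])
      have "continuous_on {0..s} g" using g by (meson DERIV_isCont continuous_at_imp_continuous_on)
      then show "continuous_on {0..s} k"
        unfolding k_def using p by (intro continuous_intros continuous_on_powr') auto
      fix y :: real assume "0 < y"
      have "(k has_real_derivative A + B / p * (p * y powr (p - 1)) - g' y) (at y)"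
        unfolding k_def using \<open>0 < y\<close> by (auto intro!: derivative_eq_intros g)
      moreover have "A + B / p * (p * y powr (p - 1)) - g' y \<ge> 0" using le[OF \<open>0 < y\<close>] p by simp
      ultimately show "\<exists>d. (k has_real_derivative d) (at y) \<and> 0 \<le> d" by blast
    qed
    then show ?thesis using g0 p by (simp add: k_def)
  qed
  show ?thesis
  proof (cases "0 \<le> s")
    case True
    have "F x s \<le> A * s + B / p * s powr p"
    proof (rule *[OF True, of "F x" "f x"])
      show "f x y \<le> A + B * y powr (p - 1)" if "0 < y" for y using growth[of x y] that by simp
    qed (auto intro: F_derivative)
    then show ?thesis using True by simp
  next
    case False
    have "F x (- (- s)) \<le> A * (- s) + B / p * (- s) powr p"
    proof (rule *[of "- s" "\<lambda>y. F x (- y)" "\<lambda>y. - f x (- y)"])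
      show "- f x (- y) \<le> A + B * y powr (p - 1)" if "0 < y" for y using growth[of x "- y"] that by simp
      show "((\<lambda>y. F x (- y)) has_real_derivative - f x (- y)) (at y)" for y
      proof -
        have "((\<lambda>y. F x (- y)) has_real_derivative f x (- y) * (- 1)) (at y)"
          by (rule DERIV_chain2[OF F_derivative]) (auto intro!: derivative_eq_intros)
        then show ?thesis by simp
      qed
    qed (use False in auto)
    then show ?thesis using False by simp
  qed
qed

lemma abs_le_one_plus_powr: "\<bar>s :: real\<bar> \<le> 1 + \<bar>s\<bar> powr p"
proof (cases "\<bar>s\<bar> \<le> 1")
  case False
  then have "\<bar>s\<bar> powr 1 \<le> \<bar>s\<bar> powr p" using p by (intro powr_mono) auto
  then show ?thesis using False by simp
qed (smt (verit) powr_ge_zero)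

lemma F_integrable:
  assumes "v \<in> Lp_space p M"
  shows "integrable M (\<lambda>x. F x (v x))"
proof (rule Bochner_Integration.integrable_bound)
  note [measurable] = Lp_measurable[OF assms]
  show "integrable M (\<lambda>x. A * (1 + norm (v x) powr p) + B * norm (v x) powr p)"
    using Lp_integrable[OF assms] by auto
  show "(\<lambda>x. F x (v x)) \<in> borel_measurable M" by measurable
  show "AE x in M. norm (F x (v x)) \<le> norm (A * (1 + norm (v x) powr p) + B * norm (v x) powr p)"
  proof (rule AE_I2)
    fix x
    have "norm (F x (v x)) \<le> A * \<bar>v x\<bar> + B * \<bar>v x\<bar> powr p" using F_abs_le by simp
    also have "\<dots> \<le> A * (1 + norm (v x) powr p) + B * norm (v x) powr p"
      using A B abs_le_one_plus_powr[of "v x"] by (intro add_mono mult_left_mono) auto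
    also have "\<dots> \<le> norm \<dots>" by simp
    finally show "norm (F x (v x)) \<le> norm (A * (1 + norm (v x) powr p) + B * norm (v x) powr p)" .
  qed
qed

section \<open>The integral functional of the primitive\<close>

definition Phi :: "('x \<Rightarrow> real) \<Rightarrow> real" where
  "Phi v = (\<integral>x. F x (v x) \<partial>M)"

text \<open>The linear term is absorbed through \<open>\<bar>s\<bar> \<le> e + e powr (1 - p) *
  \<bar>s\<bar> powr p\<close>. For large \<open>e\<close> its share of the p-th power is as small
  as desired, and the coefficient comes down to nearly \<open>B / p\<close>.\<close>

lemma Phi_le:
  assumes v: "v \<in> Lp_space p M" and e: "0 < e"
  shows "Phi v \<le> A * e * measure M (space M) + (A * e powr (1 - p) + B / p) * Lp_int p M v"
proof -
  have "Phi v \<le> (\<integral>x. A * e + (A * e powr (1 - p) + B / p) * norm (v x) powr p \<partial>M)"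
    unfolding Phi_def
  proof (rule integral_mono[OF F_integrable[OF v]])
    show "integrable M (\<lambda>x. A * e + (A * e powr (1 - p) + B / p) * norm (v x) powr p)"
      using Lp_integrable[OF v] by auto
    fix x
    have "\<bar>v x\<bar> \<le> e + e powr (1 - p) * \<bar>v x\<bar> powr p"
      using mult_powr_le_eps[OF p e, of 1 "\<bar>v x\<bar>"] by simp
    then have "A * \<bar>v x\<bar> \<le> A * (e + e powr (1 - p) * \<bar>v x\<bar> powr p)" using A by (rule mult_left_mono)
    then show "F x (v x) \<le> A * e + (A * e powr (1 - p) + B / p) * norm (v x) powr p"
      using F_le[of x "v x"] by (simp add: algebra_simps)
  qed
  also have "\<dots> = A * e * measure M (space M) + (A * e powr (1 - p) + B / p) * Lp_int p M v"
    using Lp_integrable[OF v] by (simp add: Lp_int_def)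
  finally show ?thesis .
qed

text \<open>Young's inequality applied to the Lipschitz bound of \<open>F\<close>. Here
  \<open>e\<close> is meant to be small: the first term is then small on bounded sets, and the
  second is controlled by the distance.\<close>

lemma Phi_diff_le:
  assumes u: "u \<in> Lp_space p M" and v: "v \<in> Lp_space p M" and e: "0 < e"
  shows "\<bar>Phi u - Phi v\<bar> \<le> e * (A * measure M (space M) + B * (2 powr (p - 1) * (Lp_int p M u + Lp_int p M v)))
    + (A + B) * e powr (1 - p) * Lp_int p M (\<lambda>x. u x - v x)"
proof -
  have uv: "(\<lambda>x. u x - v x) \<in> Lp_space p M" by (intro Lp_diff p u v)
  note I = Lp_integrable[OF u] Lp_integrable[OF v] Lp_integrable[OF uv]
  have "\<bar>Phi u - Phi v\<bar> = \<bar>\<integral>x. F x (u x) - F x (v x) \<partial>M\<bar>"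
    unfolding Phi_def using F_integrable[OF u] F_integrable[OF v] by simp
  also have "\<dots> \<le> (\<integral>x. \<bar>F x (u x) - F x (v x)\<bar> \<partial>M)" by (rule integral_abs_bound)
  also have "\<dots> \<le> (\<integral>x. e * (A + B * (2 powr (p - 1) * (norm (u x) powr p + norm (v x) powr p)))
    + (A + B) * e powr (1 - p) * norm (u x - v x) powr p \<partial>M)"
  proof (rule integral_mono)
    show "integrable M (\<lambda>x. \<bar>F x (u x) - F x (v x)\<bar>)"
      using F_integrable[OF u] F_integrable[OF v] by auto
    show "integrable M (\<lambda>x. e * (A + B * (2 powr (p - 1) * (norm (u x) powr p + norm (v x) powr p))) + (A + B) * e powr (1 - p) * norm (u x - v x) powr p)"
      using I by auto
    fix x
    define d where "d = \<bar>u x - v x\<bar>"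
    define w where "w = \<bar>u x\<bar> + \<bar>v x\<bar>"
    have 1: "d \<le> e + e powr (1 - p) * d powr p"
      using mult_powr_le_eps[OF p e, of 1 d] by (simp add: d_def)
    have "w powr p \<le> 2 powr (p - 1) * (\<bar>u x\<bar> powr p + \<bar>v x\<bar> powr p)"
      using norm_add_powr_le2[OF p, of "\<bar>u x\<bar>" "\<bar>v x\<bar>"] by (simp add: w_def)
    then have "e * w powr p \<le> e * (2 powr (p - 1) * (\<bar>u x\<bar> powr p + \<bar>v x\<bar> powr p))"
      using e by (intro mult_left_mono) auto
    then have 2: "w powr (p - 1) * d \<le> e * (2 powr (p - 1) * (\<bar>u x\<bar> powr p + \<bar>v x\<bar> powr p)) + e powr (1 - p) * d powr p"
      using mult_powr_le_eps[OF p e, of w d] by (simp add: d_def w_def)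
    have "\<bar>F x (u x) - F x (v x)\<bar> \<le> A * d + B * (w powr (p - 1) * d)"
      using F_lipschitz[of x "u x" "v x"] by (simp add: d_def w_def algebra_simps)
    also have "\<dots> \<le> A * (e + e powr (1 - p) * d powr p) + B * (e * (2 powr (p - 1) * (\<bar>u x\<bar> powr p + \<bar>v x\<bar> powr p)) + e powr (1 - p) * d powr p)"
      by (intro add_mono mult_left_mono 1 2 A B)
    finally show "\<bar>F x (u x) - F x (v x)\<bar> \<le> e * (A + B * (2 powr (p - 1) * (norm (u x) powr p + norm (v x) powr p))) + (A + B) * e powr (1 - p) * norm (u x - v x) powr p"
      by (simp add: d_def algebra_simps)
  qed
  also have "\<dots> = e * (A * measure M (space M) + B * (2 powr (p - 1) * (Lp_int p M u + Lp_int p M v)))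
    + (A + B) * e powr (1 - p) * Lp_int p M (\<lambda>x. u x - v x)"
    using I by (simp add: Lp_int_def algebra_simps)
  finally show ?thesis .
qed

text \<open>Continuity at a fixed point would not do: the minimisation compares two moving members
  of a sequence with their midpoint.\<close>

lemma Phi_uniformly_continuous:
  assumes "0 < e" "0 \<le> R"
  obtains d where "0 < d" "\<And>u v. u \<in> Lp_space p M \<Longrightarrow> v \<in> Lp_space p M \<Longrightarrow> Lp_int p M u \<le> R \<Longrightarrow> Lp_int p M v \<le> R
    \<Longrightarrow> Lp_int p M (\<lambda>x. u x - v x) < d \<Longrightarrow> \<bar>Phi u - Phi v\<bar> < e"
proof -
  define c where "c = A * measure M (space M) + B * (2 powr (p - 1) * (R + R))"
  have c: "0 \<le> c" using A B assms by (auto simp: c_def intro!: add_nonneg_nonneg mult_nonneg_nonneg)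
  define t where "t = e / (2 * (c + 1))"
  have t: "0 < t" "t * c < e / 2 + 0" using c assms by (auto simp: t_def field_simps)
  define k where "k = (A + B) * t powr (1 - p) + 1"
  have k: "0 < k" using A B by (auto simp: k_def intro!: add_nonneg_pos mult_nonneg_nonneg)
  have "\<bar>Phi u - Phi v\<bar> < e" if uv: "u \<in> Lp_space p M" "v \<in> Lp_space p M" and R: "Lp_int p M u \<le> R" "Lp_int p M v \<le> R"
    and d: "Lp_int p M (\<lambda>x. u x - v x) < e / 2 / k" for u v
  proof -
    have "t * (A * measure M (space M) + B * (2 powr (p - 1) * (Lp_int p M u + Lp_int p M v))) \<le> t * c"
      unfolding c_def using t R B by (intro mult_left_mono add_left_mono add_mono) auto
    moreover have "(A + B) * t powr (1 - p) * Lp_int p M (\<lambda>x. u x - v x) \<le> k * Lp_int p M (\<lambda>x. u x - v x)"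
      by (intro mult_right_mono) (auto simp: k_def)
    moreover have "k * Lp_int p M (\<lambda>x. u x - v x) < e / 2" using d k by (simp add: field_simps)
    ultimately show ?thesis using Phi_diff_le[OF uv t(1)] t(2) by linarith
  qed
  then show ?thesis using assms k by (intro that[of "e / 2 / k"]) auto
qed

lemma Phi_tendsto:
  assumes F: "\<And>n. v n \<in> Lp_space p M" and G: "u \<in> Lp_space p M"
    and lim: "(\<lambda>n. Lp_int p M (\<lambda>x. v n x - u x)) \<longlonglongrightarrow> 0"
  shows "(\<lambda>n. Phi (v n)) \<longlonglongrightarrow> Phi u"
proof (rule LIMSEQ_I)
  fix e :: real assume e: "0 < e"
  obtain d where d: "0 < d" "\<And>a b. a \<in> Lp_space p M \<Longrightarrow> b \<in> Lp_space p M \<Longrightarrow> Lp_int p M a \<le> Lp_int p M u + 1 \<Longrightarrow> Lp_int p M b \<le> Lp_int p M u + 1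
    \<Longrightarrow> Lp_int p M (\<lambda>x. a x - b x) < d \<Longrightarrow> \<bar>Phi a - Phi b\<bar> < e"
    by (rule Phi_uniformly_continuous[OF e, of "Lp_int p M u + 1"]) (auto simp: add_nonneg_nonneg)
  have "\<forall>\<^sub>F n in sequentially. Lp_int p M (v n) < Lp_int p M u + 1"
    by (rule order_tendstoD[OF Lp_int_tendsto[OF F G p lim]]) simp
  moreover have "\<forall>\<^sub>F n in sequentially. Lp_int p M (\<lambda>x. v n x - u x) < d"
    by (rule order_tendstoD(2)[OF lim d(1)])
  ultimately have "\<forall>\<^sub>F n in sequentially. norm (Phi (v n) - Phi u) < e"
    by eventually_elim (auto intro!: d F G)
  then show "\<exists>N. \<forall>n\<ge>N. norm (Phi (v n) - Phi u) < e" by (simp add: eventually_sequentially)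
qed

lemma growth_product_integrable:
  assumes u: "u \<in> Lp_space p M" and v: "v \<in> Lp_space p M"
  shows "integrable M (\<lambda>x. (A + B * \<bar>u x\<bar> powr (p - 1)) * \<bar>v x\<bar>)"
proof (rule Bochner_Integration.integrable_bound)
  note [measurable] = Lp_measurable[OF u] Lp_measurable[OF v]
  show "integrable M (\<lambda>x. A * (1 + norm (v x) powr p) + B * (norm (u x) powr p + norm (v x) powr p))"
    using Lp_integrable[OF u] Lp_integrable[OF v] by auto
  show "(\<lambda>x. (A + B * \<bar>u x\<bar> powr (p - 1)) * \<bar>v x\<bar>) \<in> borel_measurable M" by measurable
  show "AE x in M. norm ((A + B * \<bar>u x\<bar> powr (p - 1)) * \<bar>v x\<bar>) \<le> norm (A * (1 + norm (v x) powr p) + B * (norm (u x) powr p + norm (v x) powr p))"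
  proof (rule AE_I2)
    fix x
    have "norm ((A + B * \<bar>u x\<bar> powr (p - 1)) * \<bar>v x\<bar>) = A * \<bar>v x\<bar> + B * (\<bar>u x\<bar> powr (p - 1) * \<bar>v x\<bar>)"
      using A B by (simp add: abs_mult algebra_simps)
    also have "\<dots> \<le> A * (1 + norm (v x) powr p) + B * (norm (u x) powr p + norm (v x) powr p)"
      using abs_le_one_plus_powr[of "v x"] mult_powr_le_eps[OF p, of 1 "\<bar>u x\<bar>" "\<bar>v x\<bar>"] A B
      by (intro add_mono mult_left_mono) auto
    also have "\<dots> \<le> norm \<dots>" by simp
    finally show "norm ((A + B * \<bar>u x\<bar> powr (p - 1)) * \<bar>v x\<bar>) \<le> norm (A * (1 + norm (v x) powr p) + B * (norm (u x) powr p + norm (v x) powr p))" .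
  qed
qed

lemma f_product_integrable:
  assumes u: "u \<in> Lp_space p M" and v: "v \<in> Lp_space p M"
  shows "integrable M (\<lambda>x. f x (u x) * v x)"
proof (rule Bochner_Integration.integrable_bound[OF growth_product_integrable[OF u v]])
  note [measurable] = Lp_measurable[OF u] Lp_measurable[OF v] measurable_caratheodory_comp[OF Lp_measurable[OF u] measurable_ident_sets[OF refl]]
  show "(\<lambda>x. f x (u x) * v x) \<in> borel_measurable M" by measurable
  show "AE x in M. norm (f x (u x) * v x) \<le> norm ((A + B * \<bar>u x\<bar> powr (p - 1)) * \<bar>v x\<bar>)"
    using growth A B by (intro AE_I2) (auto simp: abs_mult intro!: mult_right_mono)
qed

text \<open>Dominated convergence for the difference quotients of \<open>F\<close>: as the steps are
  at most 1, the growth bound at \<open>2 * \<bar>u x\<bar> + \<bar>v x\<bar>\<close> dominates all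
  of them.\<close>

lemma Phi_directional_derivative:
  assumes u: "u \<in> Lp_space p M" and v: "v \<in> Lp_space p M"
    and t: "\<And>k. 0 < t k" "\<And>k. t k \<le> 1" "t \<longlonglongrightarrow> (0::real)"
  shows "(\<lambda>k. (Phi (\<lambda>x. u x + t k * v x) - Phi u) / t k) \<longlonglongrightarrow> (\<integral>x. f x (u x) * v x \<partial>M)"
proof -
  note [measurable] = Lp_measurable[OF u] Lp_measurable[OF v] measurable_caratheodory_comp[OF Lp_measurable[OF u] measurable_ident_sets[OF refl]]
  have w: "(\<lambda>x. 2 *\<^sub>R \<bar>u x\<bar> + \<bar>v x\<bar>) \<in> Lp_space p M"
    using u v by (intro Lp_add(1) Lp_scaleR p) (auto simp: Lp_space_def)
  have uv: "(\<lambda>x. u x + t k * v x) \<in> Lp_space p M" for k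
    using Lp_add(1)[OF p u Lp_scaleR[OF v, of "t k"]] by simp
  have "(\<lambda>k. \<integral>x. (F x (u x + t k * v x) - F x (u x)) / t k \<partial>M) \<longlonglongrightarrow> (\<integral>x. f x (u x) * v x \<partial>M)"
  proof (rule integral_dominated_convergence[OF _ _ growth_product_integrable[OF w v]])
    show "AE x in M. (\<lambda>k. (F x (u x + t k * v x) - F x (u x)) / t k) \<longlonglongrightarrow> f x (u x) * v x"
    proof (rule AE_I2)
      fix x
      have "((\<lambda>s. F x (u x + s * v x)) has_real_derivative f x (u x + 0 * v x) * v x) (at 0)"
        by (rule DERIV_chain2[OF F_derivative]) (auto intro!: derivative_eq_intros)
      then have "((\<lambda>s. (F x (u x + s * v x) - F x (u x)) / s) \<longlongrightarrow> f x (u x) * v x) (at 0)"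
        by (simp add: DERIV_def)
      moreover have "filterlim t (at 0) sequentially"
        using t(3)
      proof (rule filterlim_atI)
        show "\<forall>\<^sub>F k in sequentially. t k \<noteq> 0" using t(1) by (intro always_eventually allI) (metis less_irrefl)
      qed
      ultimately show "(\<lambda>k. (F x (u x + t k * v x) - F x (u x)) / t k) \<longlonglongrightarrow> f x (u x) * v x"
        by (rule filterlim_compose)
    qed
    show "AE x in M. norm ((F x (u x + t k * v x) - F x (u x)) / t k) \<le> (A + B * \<bar>2 *\<^sub>R \<bar>u x\<bar> + \<bar>v x\<bar>\<bar> powr (p - 1)) * \<bar>v x\<bar>" for k
    proof (rule AE_I2)
      fix x
      have tv: "\<bar>t k * v x\<bar> \<le> \<bar>v x\<bar>" using t(1,2)[of k] by (simp add: abs_mult mult_left_le_one_le)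
      have "\<bar>F x (u x + t k * v x) - F x (u x)\<bar> \<le> (A + B * (\<bar>u x + t k * v x\<bar> + \<bar>u x\<bar>) powr (p - 1)) * \<bar>t k * v x\<bar>"
        using F_lipschitz[of x "u x + t k * v x" "u x"] by simp
      also have "\<dots> \<le> (A + B * (2 * \<bar>u x\<bar> + \<bar>v x\<bar>) powr (p - 1)) * \<bar>t k * v x\<bar>"
        using tv p A B abs_triangle_ineq[of "u x" "t k * v x"] by (intro mult_right_mono add_left_mono mult_left_mono powr_mono2) auto
      finally have "\<bar>F x (u x + t k * v x) - F x (u x)\<bar> \<le> (A + B * (2 * \<bar>u x\<bar> + \<bar>v x\<bar>) powr (p - 1)) * \<bar>v x\<bar> * t k"
        using t(1)[of k] by (simp add: abs_mult mult_ac)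
      then show "norm ((F x (u x + t k * v x) - F x (u x)) / t k) \<le> (A + B * \<bar>2 *\<^sub>R \<bar>u x\<bar> + \<bar>v x\<bar>\<bar> powr (p - 1)) * \<bar>v x\<bar>"
        using t(1)[of k] by (simp add: abs_divide pos_divide_le_eq)
    qed
  qed measurable
  moreover have "(\<integral>x. (F x (u x + t k * v x) - F x (u x)) / t k \<partial>M) = (Phi (\<lambda>x. u x + t k * v x) - Phi u) / t k" for k
    unfolding Phi_def using F_integrable[OF u] F_integrable[OF uv[of k]] by simp
  ultimately show ?thesis by (simp only:)
qed

end

section \<open>Minimisation\<close>

text \<open>The pattern of the continuity proofs through Young's inequality: \<open>e\<close> is
  fixed first; the factor \<open>k e\<close> may blow up as \<open>e\<close> shrinks, yet it
  multiplies a null sequence.\<close>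

lemma null_sequence_eps:
  fixes X d :: "nat \<Rightarrow> real"
  assumes le: "\<And>n e. 0 < e \<Longrightarrow> \<bar>X n\<bar> \<le> e * c + k e * d n" and d: "d \<longlonglongrightarrow> 0"
  shows "X \<longlonglongrightarrow> 0"
proof (rule LIMSEQ_I)
  fix r :: real assume r: "0 < r"
  define e where "e = r / (2 * (\<bar>c\<bar> + 1))"
  have e: "0 < e" using r by (simp add: e_def)
  have "e * c \<le> e * (\<bar>c\<bar> + 1)" using e by (intro mult_left_mono) auto
  also have "\<dots> = r / 2" by (simp add: e_def field_simps)
  finally have ec: "e * c \<le> r / 2" .
  have "(\<lambda>n. k e * d n) \<longlonglongrightarrow> k e * 0" by (intro tendsto_intros d)
  then have "\<forall>\<^sub>F n in sequentially. k e * d n < r / 2" using r by (intro order_tendstoD) auto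
  then have "\<forall>\<^sub>F n in sequentially. norm (X n - 0) < r"
    by eventually_elim (use le[OF e] ec in \<open>simp, smt (verit)\<close>)
  then show "\<exists>N. \<forall>n\<ge>N. norm (X n - 0) < r" by (simp add: eventually_sequentially)
qed

text \<open>The flux of the p-Laplacian, in Euclidean space the gradient of
  \<open>norm a powr p / p\<close>. At \<open>a = 0\<close> the scalar factor multiplies the zero
  vector, so the value is 0 for every \<open>p\<close>.\<close>

definition p_dual :: "real \<Rightarrow> 'c::real_normed_vector \<Rightarrow> 'c" where
  "p_dual p a = norm a powr (p - 2) *\<^sub>R a"

lemma norm_p_dual: "1 < p \<Longrightarrow> norm (p_dual p a) = norm a powr (p - 1)"
  by (cases "a = 0") (auto simp: p_dual_def powr_diff power2_eq_square field_simps)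

text \<open>For \<open>p < 2\<close> the factor \<open>norm a powr (p - 2)\<close> is unbounded near
  0; there the formula for the norm of the flux gives continuity instead.\<close>

lemma tendsto_p_dual:
  assumes p: "1 < p" and X: "X \<longlonglongrightarrow> a"
  shows "(\<lambda>n. p_dual p (X n)) \<longlonglongrightarrow> p_dual p a"
proof (cases "a = 0")
  case True
  have "(\<lambda>n. norm (X n) powr (p - 1)) \<longlonglongrightarrow> norm a powr (p - 1)"
    using p by (intro tendsto_powr' tendsto_norm X tendsto_const) auto
  then have "(\<lambda>n. norm (p_dual p (X n))) \<longlonglongrightarrow> 0" using True p by (simp add: norm_p_dual)
  then have "(\<lambda>n. p_dual p (X n)) \<longlonglongrightarrow> 0" by (rule tendsto_norm_zero_cancel)
  then show ?thesis using True by (simp add: p_dual_def)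
next
  case False
  then show ?thesis unfolding p_dual_def by (intro tendsto_intros X) auto
qed

lemma p_dual_measurable [measurable]:
  fixes G :: "'x \<Rightarrow> 'c::euclidean_space"
  assumes [measurable]: "G \<in> borel_measurable M"
  shows "(\<lambda>x. p_dual p (G x)) \<in> borel_measurable M"
  unfolding p_dual_def by measurable

lemma p_dual_inner_le:
  fixes a b :: "'c::real_inner"
  assumes p: "1 < p" and e: "0 < e"
  shows "\<bar>p_dual p a \<bullet> b\<bar> \<le> e * norm a powr p + e powr (1 - p) * norm b powr p"
proof -
  have "\<bar>p_dual p a \<bullet> b\<bar> \<le> norm a powr (p - 1) * norm b"
    using Cauchy_Schwarz_ineq2[of "p_dual p a" b] p by (simp add: norm_p_dual)
  also have "\<dots> \<le> e * norm a powr p + e powr (1 - p) * norm b powr p"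
    by (rule mult_powr_le_eps) (use assms in auto)
  finally show ?thesis .
qed

lemma p_dual_integrable:
  assumes p: "1 < p" and G: "G \<in> Lp_space p M" and H: "H \<in> Lp_space p M"
  shows "integrable M (\<lambda>x. p_dual p (G x) \<bullet> H x)"
proof (rule Bochner_Integration.integrable_bound)
  note [measurable] = Lp_measurable[OF G] Lp_measurable[OF H]
  show "integrable M (\<lambda>x. norm (G x) powr p + norm (H x) powr p)"
    using Lp_integrable[OF G] Lp_integrable[OF H] by auto
  show "(\<lambda>x. p_dual p (G x) \<bullet> H x) \<in> borel_measurable M" by measurable
  show "AE x in M. norm (p_dual p (G x) \<bullet> H x) \<le> norm (norm (G x) powr p + norm (H x) powr p)"
    using p_dual_inner_le[OF p, of 1] by (intro AE_I2) simp
qed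

lemma p_dual_integral_tendsto:
  assumes p: "1 < p" and G: "G \<in> Lp_space p M" and H: "H \<in> Lp_space p M" and X: "\<And>n. X n \<in> Lp_space p M"
    and lim: "(\<lambda>n. Lp_int p M (\<lambda>x. X n x - H x)) \<longlonglongrightarrow> 0"
  shows "(\<lambda>n. \<integral>x. p_dual p (G x) \<bullet> X n x \<partial>M) \<longlonglongrightarrow> (\<integral>x. p_dual p (G x) \<bullet> H x \<partial>M)"
proof -
  have "(\<lambda>n. (\<integral>x. p_dual p (G x) \<bullet> X n x \<partial>M) - (\<integral>x. p_dual p (G x) \<bullet> H x \<partial>M)) \<longlonglongrightarrow> 0"
  proof (rule null_sequence_eps[OF _ lim])
    fix n and e :: real assume e: "0 < e"
    have XH: "(\<lambda>x. X n x - H x) \<in> Lp_space p M" by (intro Lp_diff p X H)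
    have "(\<integral>x. p_dual p (G x) \<bullet> X n x \<partial>M) - (\<integral>x. p_dual p (G x) \<bullet> H x \<partial>M) = (\<integral>x. p_dual p (G x) \<bullet> (X n x - H x) \<partial>M)"
      using p_dual_integrable[OF p G X[of n]] p_dual_integrable[OF p G H] by (simp add: inner_diff_right)
    also have "\<bar>\<dots>\<bar> \<le> (\<integral>x. \<bar>p_dual p (G x) \<bullet> (X n x - H x)\<bar> \<partial>M)" by (rule integral_abs_bound)
    also have "\<dots> \<le> (\<integral>x. e * norm (G x) powr p + e powr (1 - p) * norm (X n x - H x) powr p \<partial>M)"
      using p_dual_integrable[OF p G XH] Lp_integrable[OF G] Lp_integrable[OF XH] p_dual_inner_le[OF p e]
      by (intro integral_mono) auto
    also have "\<dots> = e * Lp_int p M G + e powr (1 - p) * Lp_int p M (\<lambda>x. X n x - H x)"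
      using Lp_integrable[OF G] Lp_integrable[OF XH] by (simp add: Lp_int_def)
    finally show "\<bar>(\<integral>x. p_dual p (G x) \<bullet> X n x \<partial>M) - (\<integral>x. p_dual p (G x) \<bullet> H x \<partial>M)\<bar>
      \<le> e * Lp_int p M G + e powr (1 - p) * Lp_int p M (\<lambda>x. X n x - H x)" .
  qed
  then show ?thesis by (simp add: LIM_zero_iff)
qed

text \<open>By convexity the difference quotient of \<open>\<bar>\<cdot>\<bar>\<^sup>p\<close> is dominated by the derivative at the far end,
  which converges by dominated convergence; no two-sided differentiability is needed.\<close>

lemma Lp_int_increment_le:
  assumes p: "1 < p" and G: "G \<in> Lp_space p M" and H: "H \<in> Lp_space p M"
  shows "Lp_int p M (\<lambda>x. G x + t *\<^sub>R H x) - Lp_int p M G \<le> p * t * (\<integral>x. p_dual p (G x + t *\<^sub>R H x) \<bullet> H x \<partial>M)"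
proof -
  have GH: "(\<lambda>x. G x + t *\<^sub>R H x) \<in> Lp_space p M" by (intro Lp_add Lp_scaleR p G H)
  have "Lp_int p M (\<lambda>x. G x + t *\<^sub>R H x) - p * t * (\<integral>x. p_dual p (G x + t *\<^sub>R H x) \<bullet> H x \<partial>M)
      = (\<integral>x. norm (G x + t *\<^sub>R H x) powr p - p * t * (p_dual p (G x + t *\<^sub>R H x) \<bullet> H x) \<partial>M)"
    using Lp_integrable[OF GH] p_dual_integrable[OF p GH H] by (simp add: Lp_int_def)
  also have "\<dots> \<le> Lp_int p M G"
    unfolding Lp_int_def
  proof (rule integral_mono)
    show "integrable M (\<lambda>x. norm (G x + t *\<^sub>R H x) powr p - p * t * (p_dual p (G x + t *\<^sub>R H x) \<bullet> H x))"
      using Lp_integrable[OF GH] p_dual_integrable[OF p GH H] by auto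
    show "integrable M (\<lambda>x. norm (G x) powr p)" by (rule Lp_integrable[OF G])
    fix x
    \<comment> \<open>The tangent inequality is taken at the far end
      \<open>G x + t *\<^sub>R H x\<close> and evaluated back at \<open>G x\<close>.\<close>
    show "norm (G x + t *\<^sub>R H x) powr p - p * t * (p_dual p (G x + t *\<^sub>R H x) \<bullet> H x) \<le> norm (G x) powr p"
      using norm_powr_tangent[OF p, of "G x + t *\<^sub>R H x" "- (t *\<^sub>R H x)"] by (simp add: p_dual_def mult.assoc)
  qed
  finally show ?thesis by simp
qed

text \<open>\<open>p_dual_inner_le\<close> with \<open>e = 1\<close> and steps of length at most 1
  supply one dominating function for all \<open>k\<close>.\<close>

lemma p_dual_perturbation_tendsto:
  assumes p: "1 < p" and G: "G \<in> Lp_space p M" and H: "H \<in> Lp_space p M"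
    and t: "\<And>k. 0 < t k" "\<And>k. t k \<le> 1" "t \<longlonglongrightarrow> (0::real)"
  shows "(\<lambda>k. \<integral>x. p_dual p (G x + t k *\<^sub>R H x) \<bullet> H x \<partial>M) \<longlonglongrightarrow> (\<integral>x. p_dual p (G x) \<bullet> H x \<partial>M)"
proof (rule integral_dominated_convergence[where w = "\<lambda>x. 2 powr (p - 1) * (norm (G x) powr p + norm (H x) powr p) + norm (H x) powr p"])
  note [measurable] = Lp_measurable[OF G] Lp_measurable[OF H]
  show "(\<lambda>x. p_dual p (G x) \<bullet> H x) \<in> borel_measurable M" "\<And>k. (\<lambda>x. p_dual p (G x + t k *\<^sub>R H x) \<bullet> H x) \<in> borel_measurable M"
    by measurable
  show "integrable M (\<lambda>x. 2 powr (p - 1) * (norm (G x) powr p + norm (H x) powr p) + norm (H x) powr p)"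
    using Lp_integrable[OF G] Lp_integrable[OF H] by auto
  show "AE x in M. (\<lambda>k. p_dual p (G x + t k *\<^sub>R H x) \<bullet> H x) \<longlonglongrightarrow> p_dual p (G x) \<bullet> H x"
  proof (rule AE_I2)
    fix x
    have "(\<lambda>k. G x + t k *\<^sub>R H x) \<longlonglongrightarrow> G x + 0 *\<^sub>R H x" by (intro tendsto_intros t)
    then show "(\<lambda>k. p_dual p (G x + t k *\<^sub>R H x) \<bullet> H x) \<longlonglongrightarrow> p_dual p (G x) \<bullet> H x"
      by (intro tendsto_intros tendsto_p_dual p) simp
  qed
  show "AE x in M. norm (p_dual p (G x + t k *\<^sub>R H x) \<bullet> H x)
      \<le> 2 powr (p - 1) * (norm (G x) powr p + norm (H x) powr p) + norm (H x) powr p" for k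
  proof (rule AE_I2)
    fix x
    have "norm (t k *\<^sub>R H x) \<le> norm (H x)" using t(1,2)[of k] by (simp add: mult_left_le_one_le)
    then have "norm (t k *\<^sub>R H x) powr p \<le> norm (H x) powr p" using p by (intro powr_mono2) auto
    then have "2 powr (p - 1) * (norm (G x) powr p + norm (t k *\<^sub>R H x) powr p) \<le> 2 powr (p - 1) * (norm (G x) powr p + norm (H x) powr p)"
      by (intro mult_left_mono add_left_mono) auto
    moreover have "\<bar>p_dual p (G x + t k *\<^sub>R H x) \<bullet> H x\<bar> \<le> norm (G x + t k *\<^sub>R H x) powr p + norm (H x) powr p"
      using p_dual_inner_le[OF p, of 1 "G x + t k *\<^sub>R H x" "H x"] by simp
    ultimately show "norm (p_dual p (G x + t k *\<^sub>R H x) \<bullet> H x) \<le> 2 powr (p - 1) * (norm (G x) powr p + norm (H x) powr p) + norm (H x) powr p"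
      using norm_add_powr_le2[OF p, of "G x" "t k *\<^sub>R H x"] unfolding real_norm_def by linarith
  qed
qed

text \<open>The pointwise inequality integrated. \<open>C\<close> does not depend on the functions,
  so in a bounded set a small midpoint defect forces closeness: \<open>e\<close> is fixed first,
  then the size of the defect.\<close>

lemma Lp_uniform_convexity:
  assumes "1 < p" "0 < e"
  obtains C where "0 < C" "\<And>f g :: 'x \<Rightarrow> 'c::euclidean_space. f \<in> Lp_space p M \<Longrightarrow> g \<in> Lp_space p M \<Longrightarrow>
    Lp_int p M (\<lambda>x. f x - g x) \<le> e * (Lp_int p M f + Lp_int p M g)
      + C * ((Lp_int p M f + Lp_int p M g) / 2 - Lp_int p M (\<lambda>x. (f x + g x) /\<^sub>R 2))"
proof -
  obtain C where C: "0 < C" "\<And>a b :: 'c. norm (a - b) powr p \<le> e * (norm a powr p + norm b powr p)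
      + C * ((norm a powr p + norm b powr p) / 2 - norm ((a + b) /\<^sub>R 2) powr p)"
    by (rule uniform_convexity_powr[OF assms, where 'c = 'c]) blast
  have "Lp_int p M (\<lambda>x. f x - g x) \<le> e * (Lp_int p M f + Lp_int p M g)
      + C * ((Lp_int p M f + Lp_int p M g) / 2 - Lp_int p M (\<lambda>x. (f x + g x) /\<^sub>R 2))"
    if f: "f \<in> Lp_space p M" and g: "g \<in> Lp_space p M" for f g :: "'x \<Rightarrow> 'c"
  proof -
    have fg: "(\<lambda>x. f x - g x) \<in> Lp_space p M" "(\<lambda>x. (f x + g x) /\<^sub>R 2) \<in> Lp_space p M"
      by (intro Lp_diff Lp_scaleR Lp_add assms f g)+
    note I = Lp_integrable[OF f] Lp_integrable[OF g] Lp_integrable[OF fg(1)] Lp_integrable[OF fg(2)]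
    have "Lp_int p M (\<lambda>x. f x - g x) \<le> (\<integral>x. e * (norm (f x) powr p + norm (g x) powr p)
      + C * ((norm (f x) powr p + norm (g x) powr p) / 2 - norm ((f x + g x) /\<^sub>R 2) powr p) \<partial>M)"
      unfolding Lp_int_def
    proof (rule integral_mono[OF I(3)])
      show "integrable M (\<lambda>x. e * (norm (f x) powr p + norm (g x) powr p)
      + C * ((norm (f x) powr p + norm (g x) powr p) / 2 - norm ((f x + g x) /\<^sub>R 2) powr p))"
        by (intro Bochner_Integration.integrable_add Bochner_Integration.integrable_diff integrable_mult_right integrable_divide I)
    qed (rule C)
    also have "\<dots> = e * (Lp_int p M f + Lp_int p M g)
      + C * ((Lp_int p M f + Lp_int p M g) / 2 - Lp_int p M (\<lambda>x. (f x + g x) /\<^sub>R 2))"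
      unfolding Lp_int_def using I by (simp del: norm_scaleR)
    finally show ?thesis .
  qed
  then show ?thesis using C(1) that by blast
qed

context caratheodory_growth begin

text \<open>Continuity in the test function of the right-hand side of the equation; it serves to
  extend the weak equation from test functions to \<open>D1p\<close>.\<close>

lemma f_integral_tendsto:
  assumes u: "u \<in> Lp_space p M" and v: "v \<in> Lp_space p M" and X: "\<And>n. X n \<in> Lp_space p M"
    and lim: "(\<lambda>n. Lp_int p M (\<lambda>x. X n x - v x)) \<longlonglongrightarrow> 0"
  shows "(\<lambda>n. \<integral>x. f x (u x) * X n x \<partial>M) \<longlonglongrightarrow> (\<integral>x. f x (u x) * v x \<partial>M)"
proof -
  have "(\<lambda>n. (\<integral>x. f x (u x) * X n x \<partial>M) - (\<integral>x. f x (u x) * v x \<partial>M)) \<longlonglongrightarrow> 0"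
  proof (rule null_sequence_eps[OF _ lim])
    fix n and e :: real assume e: "0 < e"
    have Xv: "(\<lambda>x. X n x - v x) \<in> Lp_space p M" by (intro Lp_diff p X v)
    note I = Lp_integrable[OF u] Lp_integrable[OF Xv]
    have "(\<integral>x. f x (u x) * X n x \<partial>M) - (\<integral>x. f x (u x) * v x \<partial>M) = (\<integral>x. f x (u x) * (X n x - v x) \<partial>M)"
      using f_product_integrable[OF u X[of n]] f_product_integrable[OF u v] by (simp add: right_diff_distrib)
    also have "\<bar>\<dots>\<bar> \<le> (\<integral>x. \<bar>f x (u x) * (X n x - v x)\<bar> \<partial>M)" by (rule integral_abs_bound)
    also have "\<dots> \<le> (\<integral>x. e * (A + B * norm (u x) powr p) + (A + B) * e powr (1 - p) * norm (X n x - v x) powr p \<partial>M)"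
    proof (rule integral_mono)
      show "integrable M (\<lambda>x. \<bar>f x (u x) * (X n x - v x)\<bar>)" using f_product_integrable[OF u Xv] by auto
      show "integrable M (\<lambda>x. e * (A + B * norm (u x) powr p) + (A + B) * e powr (1 - p) * norm (X n x - v x) powr p)"
        using I by auto
      fix x
      define d where "d = \<bar>X n x - v x\<bar>"
      have "\<bar>f x (u x) * (X n x - v x)\<bar> \<le> (A + B * \<bar>u x\<bar> powr (p - 1)) * d"
        using growth[of x "u x"] by (simp add: abs_mult d_def mult_right_mono)
      also have "\<dots> = A * d + B * (\<bar>u x\<bar> powr (p - 1) * d)" by (simp add: algebra_simps)
      also have "\<dots> \<le> A * (e + e powr (1 - p) * d powr p) + B * (e * \<bar>u x\<bar> powr p + e powr (1 - p) * d powr p)"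
        using mult_powr_le_eps[OF p e, of 1 d] mult_powr_le_eps[OF p e, of "\<bar>u x\<bar>" d] A B
        by (intro add_mono mult_left_mono) (auto simp: d_def)
      finally show "\<bar>f x (u x) * (X n x - v x)\<bar> \<le> e * (A + B * norm (u x) powr p) + (A + B) * e powr (1 - p) * norm (X n x - v x) powr p"
        by (simp add: d_def algebra_simps)
    qed
    also have "\<dots> = e * (A * measure M (space M) + B * Lp_int p M u) + (A + B) * e powr (1 - p) * Lp_int p M (\<lambda>x. X n x - v x)"
      using I by (simp add: Lp_int_def algebra_simps)
    finally show "\<bar>(\<integral>x. f x (u x) * X n x \<partial>M) - (\<integral>x. f x (u x) * v x \<partial>M)\<bar>
      \<le> e * (A * measure M (space M) + B * Lp_int p M u) + (A + B) * e powr (1 - p) * Lp_int p M (\<lambda>x. X n x - v x)" .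
  qed
  then show ?thesis by (simp add: LIM_zero_iff)
qed

end

lemma LIMSEQ_subseq:
  assumes "X \<longlonglongrightarrow> L" "strict_mono (r :: nat \<Rightarrow> nat)"
  shows "(\<lambda>n. X (r n)) \<longlonglongrightarrow> L"
  using LIMSEQ_subseq_LIMSEQ[OF assms] by (simp add: o_def)

text \<open>An infimum over test functions is enough: the competitors \<open>u + t * \<psi>\<close>
  with a test function \<open>\<psi>\<close> are limits of test functions along which both parts of
  the functional converge.\<close>

lemma exists_minimizer:
  fixes f :: "'a::euclidean_space \<Rightarrow> real \<Rightarrow> real"
  assumes dim: "p < real DIM('a)" and \<alpha>: "0 < \<alpha>"
    and cg: "caratheodory_growth (decay_measure \<alpha>) f A B p"
    and K: "\<And>\<phi> :: 'a \<Rightarrow> real. test_function \<phi> \<Longrightarrow> \<phi> \<in> Lp_space p (decay_measure \<alpha>) \<and> Lp_int p (decay_measure \<alpha>) \<phi> \<le> K * grad_int p \<phi>"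
    and K0: "0 \<le> K" and BK: "B * K < 1"
  obtains u G where "has_D1p_grad p u G" "u \<in> Lp_space p (decay_measure \<alpha>)" "G \<in> Lp_space p lebesgue"
    "\<And>\<psi> t. test_function \<psi> \<Longrightarrow> Lp_int p lebesgue G / p - caratheodory_growth.Phi (decay_measure \<alpha>) f u
      \<le> Lp_int p lebesgue (\<lambda>x. G x + t *\<^sub>R classical_grad \<psi> x) / p
        - caratheodory_growth.Phi (decay_measure \<alpha>) f (\<lambda>x. u x + t * \<psi> x)"
proof -
  interpret c: caratheodory_growth "decay_measure \<alpha>" f A B p by (rule cg)
  note p = c.p
  define W where "W = (decay_measure \<alpha> :: 'a measure)"
  define J where "J \<phi> = grad_int p \<phi> / p - c.Phi \<phi>" for \<phi> :: "'a \<Rightarrow> real"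
  define m where "m = measure W (space W)"
  have tL: "\<phi> \<in> Lp_space p W" "Lp_int p W \<phi> \<le> K * grad_int p \<phi>" if "test_function \<phi>" for \<phi>
    using K[OF that] by (auto simp: W_def)
  have gL: "classical_grad \<phi> \<in> Lp_space p lebesgue" if "test_function \<phi>" for \<phi> :: "'a \<Rightarrow> real"
    using that p by (intro test_function_Lp) auto
  \<comment> \<open>Half of the coercivity margin \<open>(1 - B * K) / p\<close>; the other half
    absorbs the linear growth term once \<open>e\<close> is large.\<close>
  define \<kappa> where "\<kappa> = (1 - B * K) / (2 * p)"
  have \<kappa>: "0 < \<kappa>" using BK p by (simp add: \<kappa>_def)
  have "((\<lambda>e. A * e powr (1 - p) * K) \<longlongrightarrow> A * 0 * K) at_top"
    using p by (intro tendsto_intros tendsto_neg_powr filterlim_ident) auto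
  then have "\<forall>\<^sub>F e in at_top. A * e powr (1 - p) * K < \<kappa>"
    using \<kappa> by (intro order_tendstoD) auto
  then have "\<forall>\<^sub>F e in at_top. 0 < e \<and> A * e powr (1 - p) * K < \<kappa>"
    using eventually_gt_at_top[of 0] by eventually_elim auto
  then obtain e where e: "0 < e" "A * e powr (1 - p) * K < \<kappa>"
    using eventually_happens[of _ "at_top :: real filter"] by auto
  have coer: "\<kappa> * grad_int p \<phi> - A * e * m \<le> J \<phi>" if \<phi>: "test_function \<phi>" for \<phi>
  proof -
    have "c.Phi \<phi> \<le> A * e * m + (A * e powr (1 - p) + B / p) * Lp_int p W \<phi>"
      using c.Phi_le[OF tL(1)[OF \<phi>, unfolded W_def] e(1)] by (simp add: W_def m_def)
    also have "(A * e powr (1 - p) + B / p) * Lp_int p W \<phi> \<le> (A * e powr (1 - p) + B / p) * (K * grad_int p \<phi>)"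
      using c.A c.B p tL(2)[OF \<phi>] by (intro mult_left_mono) (auto intro!: add_nonneg_nonneg)
    also have "\<dots> = (A * e powr (1 - p) * K + B * K / p) * grad_int p \<phi>" by (simp add: algebra_simps)
    also have "\<dots> \<le> (\<kappa> + B * K / p) * grad_int p \<phi>"
      using e(2) by (intro mult_right_mono) auto
    finally have "c.Phi \<phi> \<le> A * e * m + (\<kappa> + B * K / p) * grad_int p \<phi>" by simp
    moreover have "\<kappa> + B * K / p = 1 / p - \<kappa>" using p by (simp add: \<kappa>_def field_simps)
    ultimately have "c.Phi \<phi> \<le> A * e * m + (1 / p - \<kappa>) * grad_int p \<phi>" by simp
    then show ?thesis by (simp add: J_def algebra_simps)
  qed
  define T where "T = {\<phi> :: 'a \<Rightarrow> real. test_function \<phi>}"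
  define j where "j = Inf (J ` T)"
  have bdd: "bdd_below (J ` T)"
  proof (rule bdd_belowI2)
    fix \<phi> :: "'a \<Rightarrow> real" assume "\<phi> \<in> T"
    then have "test_function \<phi>" by (simp add: T_def)
    moreover have "0 \<le> \<kappa> * grad_int p \<phi>" using \<kappa> by simp
    ultimately show "- (A * e * m) \<le> J \<phi>" using coer[of \<phi>] by linarith
  qed
  have jle: "j \<le> J \<phi>" if "test_function \<phi>" for \<phi>
    unfolding j_def by (rule cInf_lower[OF _ bdd]) (use that in \<open>auto simp: T_def\<close>)
  have "\<exists>\<phi>. test_function \<phi> \<and> J \<phi> < j + 1 / real (Suc n)" for n
  proof -
    have "J ` T \<noteq> {}" using test_function_zero by (auto simp: T_def)
    then have "\<exists>y\<in>J ` T. y < j + 1 / real (Suc n)"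
      by (intro cInf_lessD) (auto simp: j_def)
    then show ?thesis by (auto simp: T_def)
  qed
  then obtain \<phi> where \<phi>: "\<And>n. test_function (\<phi> n)" "\<And>n. J (\<phi> n) < j + 1 / real (Suc n)" by metis
  define M where "M = (j + 1 + A * e * m) / \<kappa>"
  have M: "grad_int p (\<phi> n) \<le> M" for n
  proof -
    have "1 / real (Suc n) \<le> 1" by simp
    then have "\<kappa> * grad_int p (\<phi> n) \<le> j + 1 + A * e * m"
      using coer[OF \<phi>(1)[of n]] \<phi>(2)[of n] by linarith
    then show ?thesis using \<kappa> by (simp add: M_def field_simps)
  qed
  have M0: "0 \<le> M" using M[of 0] by (rule order_trans[OF Lp_int_nonneg])
  obtain r :: "nat \<Rightarrow> nat" where r: "strict_mono r" and CW: "Lp_Cauchy p W (\<lambda>n. \<phi> (r n))"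
    unfolding W_def by (rule embedding_compact[where \<phi> = \<phi>, OF p dim \<alpha> \<phi>(1) M]) blast
  define \<psi> where "\<psi> n = \<phi> (r n)" for n
  have \<psi>: "test_function (\<psi> n)" for n by (simp add: \<psi>_def \<phi>)
  have M\<psi>: "grad_int p (\<psi> n) \<le> M" for n by (simp add: \<psi>_def M)
  have J\<psi>: "J (\<psi> n) < j + 1 / real (Suc n)" for n
  proof -
    have "1 / real (Suc (r n)) \<le> 1 / real (Suc n)" using seq_suble[OF r, of n] by (simp add: frac_le)
    then show ?thesis using \<phi>(2)[of "r n"] by (simp add: \<psi>_def)
  qed
  have C\<psi>: "Lp_Cauchy p W \<psi>" using CW by (simp add: \<psi>_def[abs_def])
  have W\<psi>: "Lp_int p W (\<psi> n) \<le> K * M" for n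
    using order_trans[OF tL(2)[OF \<psi>] mult_left_mono[OF M\<psi> K0]] .
  have Cg: "Lp_Cauchy p lebesgue (\<lambda>n. classical_grad (\<psi> n))"
    unfolding Lp_Cauchy_def
  proof (intro allI impI)
    fix \<epsilon> :: real assume \<epsilon>: "0 < \<epsilon>"
    \<comment> \<open>As both gradient integrals are at most \<open>M\<close>, the first term of the
      uniform convexity estimate stays within \<open>\<epsilon> / 2\<close>.\<close>
    define \<delta> where "\<delta> = \<epsilon> / (4 * (M + 1))"
    have \<delta>: "0 < \<delta>" "\<delta> * (M + M) \<le> \<epsilon> / 2" using \<epsilon> M0 by (auto simp: \<delta>_def field_simps)
    obtain C where C: "0 < C" "\<And>f g :: 'a \<Rightarrow> 'a. f \<in> Lp_space p lebesgue \<Longrightarrow> g \<in> Lp_space p lebesgue \<Longrightarrow>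
      Lp_int p lebesgue (\<lambda>x. f x - g x) \<le> \<delta> * (Lp_int p lebesgue f + Lp_int p lebesgue g)
      + C * ((Lp_int p lebesgue f + Lp_int p lebesgue g) / 2 - Lp_int p lebesgue (\<lambda>x. (f x + g x) /\<^sub>R 2))"
      by (rule Lp_uniform_convexity[OF p \<delta>(1), where 'x = 'a and 'c = 'a and M = lebesgue]) blast
    \<comment> \<open>Makes \<open>C\<close> times the largest possible midpoint defect,
      \<open>p * (2 * \<eta>)\<close>, equal to \<open>\<epsilon> / 4\<close>.\<close>
    define \<eta> where "\<eta> = \<epsilon> / (8 * C * p)"
    have \<eta>: "0 < \<eta>" "C * (p * (2 * \<eta>)) = \<epsilon> / 4" using \<epsilon> C p by (auto simp: \<eta>_def field_simps)
    have "0 \<le> K * M" using K0 M0 by simp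
    obtain d where d: "0 < d" "\<And>u v. u \<in> Lp_space p W \<Longrightarrow> v \<in> Lp_space p W \<Longrightarrow> Lp_int p W u \<le> K * M \<Longrightarrow> Lp_int p W v \<le> K * M
      \<Longrightarrow> Lp_int p W (\<lambda>x. u x - v x) < d \<Longrightarrow> \<bar>c.Phi u - c.Phi v\<bar> < \<eta>"
      unfolding W_def by (rule c.Phi_uniformly_continuous[OF \<eta>(1) \<open>0 \<le> K * M\<close>]) blast
    have "\<exists>N. \<forall>m\<ge>N. \<forall>n\<ge>N. Lp_int p W (\<lambda>x. \<psi> m x - \<psi> n x) < d"
      using C\<psi> d(1) by (simp add: Lp_Cauchy_def)
    then obtain N1 where N1: "\<And>m n. m \<ge> N1 \<Longrightarrow> n \<ge> N1 \<Longrightarrow> Lp_int p W (\<lambda>x. \<psi> m x - \<psi> n x) < d" by auto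
    obtain N2 where N2: "1 / real (Suc N2) < \<eta>" using nat_approx_posE[OF \<eta>(1)] by blast
    have "Lp_int p lebesgue (\<lambda>x. classical_grad (\<psi> i) x - classical_grad (\<psi> k) x) < \<epsilon>"
      if i: "i \<ge> max N1 N2" and k: "k \<ge> max N1 N2" for i k
    proof -
      \<comment> \<open>The midpoint is again a test function, so \<open>J\<close> is at least
        \<open>j\<close> there.\<close>
      define \<mu> where "\<mu> x = (1 / 2) * (\<psi> i x + \<psi> k x)" for x
      have \<mu>: "test_function \<mu>" unfolding \<mu>_def by (intro test_function_cmult test_function_add \<psi>)
      have g\<mu>: "classical_grad \<mu> = (\<lambda>x. (classical_grad (\<psi> i) x + classical_grad (\<psi> k) x) /\<^sub>R 2)"
      proof
        fix x
        have "classical_grad \<mu> x = (1 / 2) *\<^sub>R classical_grad (\<lambda>x. \<psi> i x + \<psi> k x) x"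
          unfolding \<mu>_def by (rule test_function_grad_cmult[OF test_function_add[OF \<psi> \<psi>]])
        then show "classical_grad \<mu> x = (classical_grad (\<psi> i) x + classical_grad (\<psi> k) x) /\<^sub>R 2"
          by (simp add: test_function_grad_add[OF \<psi> \<psi>])
      qed
      have h: "(1 / 2 :: real) powr p * 2 powr (p - 1) = 1 / 2"
        by (simp add: powr_divide powr_diff)
      have "Lp_int p W \<mu> = (1 / 2) powr p * Lp_int p W (\<lambda>x. \<psi> i x + \<psi> k x)"
        using Lp_int_scaleR[of p W "1 / 2" "\<lambda>x. \<psi> i x + \<psi> k x"] by (simp add: \<mu>_def[abs_def])
      also have "\<dots> \<le> (1 / 2) powr p * (2 powr (p - 1) * (Lp_int p W (\<psi> i) + Lp_int p W (\<psi> k)))"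
        by (intro mult_left_mono Lp_add(2) p tL \<psi>) auto
      also have "\<dots> = (Lp_int p W (\<psi> i) + Lp_int p W (\<psi> k)) / 2"
        unfolding mult.assoc[symmetric] h by simp
      also have "\<dots> \<le> K * M" using W\<psi>[of i] W\<psi>[of k] by simp
      finally have W\<mu>: "Lp_int p W \<mu> \<le> K * M" .
      have close: "Lp_int p W (\<lambda>x. \<psi> l x - \<mu> x) < d" if l: "l = i \<or> l = k" for l
      proof -
        define s :: real where "s = (if l = i then 1 / 2 else - 1 / 2)"
        have "\<bar>s\<bar> = 1 / 2" by (simp add: s_def)
        then have s1: "\<bar>s\<bar> powr p \<le> 1" using p by (simp add: powr_le1)
        have "(\<lambda>x. \<psi> l x - \<mu> x) = (\<lambda>x. s *\<^sub>R (\<psi> i x - \<psi> k x))"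
          using l by (auto simp: s_def \<mu>_def field_simps)
        then have "Lp_int p W (\<lambda>x. \<psi> l x - \<mu> x) = \<bar>s\<bar> powr p * Lp_int p W (\<lambda>x. \<psi> i x - \<psi> k x)"
          by (simp only: Lp_int_scaleR)
        also have "\<dots> \<le> Lp_int p W (\<lambda>x. \<psi> i x - \<psi> k x)" using s1 by (intro mult_left_le_one_le) auto
        also have "\<dots> < d" using N1 i k by simp
        finally show ?thesis .
      qed
      have Ph: "\<bar>c.Phi (\<psi> l) - c.Phi \<mu>\<bar> < \<eta>" if "l = i \<or> l = k" for l
        by (rule d(2)[OF tL(1)[OF \<psi>] tL(1)[OF \<mu>] W\<psi> W\<mu> close[OF that]])
      have Jl: "J (\<psi> l) < j + \<eta>" if "l = i \<or> l = k" for l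
      proof -
        have "1 / real (Suc l) \<le> 1 / real (Suc N2)" using that i k by (auto intro!: frac_le)
        then show ?thesis using J\<psi>[of l] N2 by linarith
      qed
      \<comment> \<open>At both ends \<open>J\<close> exceeds the infimum by less than
        \<open>\<eta>\<close>, and \<open>Phi\<close> differs by less than \<open>\<eta>\<close>
        from its midpoint value; this leaves a midpoint defect of at most \<open>2 * \<eta>\<close>
        for the gradient terms.\<close>
      have "grad_int p \<mu> / p \<ge> j + c.Phi \<mu>" using jle[OF \<mu>] by (simp add: J_def)
      moreover have "grad_int p (\<psi> i) / p < j + \<eta> + (c.Phi \<mu> + \<eta>)" "grad_int p (\<psi> k) / p < j + \<eta> + (c.Phi \<mu> + \<eta>)"
        using Jl[of i] Ph[of i] Jl[of k] Ph[of k] by (auto simp: J_def)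
      moreover have "(a + b) / 2 - c \<le> 2 * \<eta>"
        if "j + P \<le> c" "a < j + \<eta> + (P + \<eta>)" "b < j + \<eta> + (P + \<eta>)" for a b c P :: real
        using that by (simp add: field_simps)
      ultimately have "(grad_int p (\<psi> i) / p + grad_int p (\<psi> k) / p) / 2 - grad_int p \<mu> / p \<le> 2 * \<eta>" by blast
      moreover have "(grad_int p (\<psi> i) / p + grad_int p (\<psi> k) / p) / 2 - grad_int p \<mu> / p
        = ((grad_int p (\<psi> i) + grad_int p (\<psi> k)) / 2 - grad_int p \<mu>) / p"
        using p by (simp add: field_simps)
      ultimately have "(grad_int p (\<psi> i) + grad_int p (\<psi> k)) / 2 - grad_int p \<mu> \<le> p * (2 * \<eta>)"
        using p by (simp add: divide_le_eq mult.commute)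
      then have "C * ((grad_int p (\<psi> i) + grad_int p (\<psi> k)) / 2 - grad_int p \<mu>) \<le> \<epsilon> / 4"
        unfolding \<eta>(2)[symmetric] using C(1) by (intro mult_left_mono) auto
      moreover have "\<delta> * (grad_int p (\<psi> i) + grad_int p (\<psi> k)) \<le> \<epsilon> / 2"
        using M\<psi>[of i] M\<psi>[of k] \<delta> by (intro order_trans[OF mult_left_mono \<delta>(2)]) auto
      ultimately show ?thesis
        using C(2)[OF gL[OF \<psi>[of i]] gL[OF \<psi>[of k]]] \<epsilon> unfolding g\<mu> by linarith
    qed
    then show "\<exists>N. \<forall>m\<ge>N. \<forall>n\<ge>N. Lp_int p lebesgue (\<lambda>x. classical_grad (\<psi> m) x - classical_grad (\<psi> n) x) < \<epsilon>" by blast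
  qed
  obtain G where G: "G \<in> Lp_space p lebesgue" "(\<lambda>n. Lp_int p lebesgue (\<lambda>x. classical_grad (\<psi> n) x - G x)) \<longlonglongrightarrow> 0"
    by (rule Lp_complete[where F = "\<lambda>n. classical_grad (\<psi> n)", OF gL[OF \<psi>] p Cg]) blast
  \<comment> \<open>Pointwise convergence is provided along \<open>s\<close> only; the gradients
    converge along the whole sequence, hence along \<open>s\<close> as well.\<close>
  obtain u and s :: "nat \<Rightarrow> nat" where u: "u \<in> Lp_space p W" "(\<lambda>n. Lp_int p W (\<lambda>x. \<psi> n x - u x)) \<longlonglongrightarrow> 0"
    "strict_mono s" "AE x in W. (\<lambda>n. \<psi> (s n) x) \<longlonglongrightarrow> u x"
    by (rule Lp_complete[where F = \<psi>, OF tL(1)[OF \<psi>] p C\<psi>]) blast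
  have hG: "has_D1p_grad p u G"
  proof (rule has_D1p_gradI[where \<phi> = "\<lambda>n. \<psi> (s n)", OF \<psi> G(1) _ p])
    show "u \<in> borel_measurable lebesgue" using Lp_measurable[OF u(1)] by (simp add: W_def)
    show "(\<lambda>n. Lp_int p lebesgue (\<lambda>x. classical_grad (\<psi> (s n)) x - G x)) \<longlonglongrightarrow> 0"
      by (rule LIMSEQ_subseq[OF G(2) u(3)])
    show "AE x in lebesgue. (\<lambda>n. \<psi> (s n) x) \<longlonglongrightarrow> u x" using u(4) unfolding W_def AE_decay_measure .
  qed
  have Jlim: "(\<lambda>n. J (\<psi> n)) \<longlonglongrightarrow> Lp_int p lebesgue G / p - c.Phi u"
    unfolding J_def using p
    by (intro tendsto_intros Lp_int_tendsto[OF gL[OF \<psi>] G(1) p G(2)] c.Phi_tendsto[OF tL(1)[OF \<psi>, unfolded W_def] u(1)[unfolded W_def] u(2)[unfolded W_def]]) auto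
  have "(\<lambda>n. J (\<psi> n)) \<longlonglongrightarrow> j"
  proof (rule real_tendsto_sandwich[of "\<lambda>_. j" _ _ "\<lambda>n. j + 1 / real (Suc n)"])
    have "(\<lambda>n. j + 1 / real (Suc n)) \<longlonglongrightarrow> j + 0" by (intro tendsto_intros LIMSEQ_Suc[OF lim_1_over_n])
    then show "(\<lambda>n. j + 1 / real (Suc n)) \<longlonglongrightarrow> j" by simp
  qed (use jle[OF \<psi>] J\<psi> in \<open>auto intro!: always_eventually less_imp_le\<close>)
  then have jeq: "Lp_int p lebesgue G / p - c.Phi u = j" by (rule LIMSEQ_unique[OF Jlim])
  have min: "Lp_int p lebesgue G / p - c.Phi u \<le> Lp_int p lebesgue (\<lambda>x. G x + t *\<^sub>R classical_grad \<theta> x) / p - c.Phi (\<lambda>x. u x + t * \<theta> x)"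
    if \<theta>: "test_function \<theta>" for \<theta> t
  proof -
    define \<xi> where "\<xi> n x = \<psi> n x + t * \<theta> x" for n x
    have \<xi>: "test_function (\<xi> n)" for n unfolding \<xi>_def by (intro test_function_add test_function_cmult \<psi> \<theta>)
    have g\<xi>: "classical_grad (\<xi> n) x = classical_grad (\<psi> n) x + t *\<^sub>R classical_grad \<theta> x" for n x
      unfolding \<xi>_def by (simp add: test_function_grad_add[OF \<psi> test_function_cmult[OF \<theta>]] test_function_grad_cmult[OF \<theta>])
    have Gt: "(\<lambda>x. G x + t *\<^sub>R classical_grad \<theta> x) \<in> Lp_space p lebesgue"
      by (intro Lp_add Lp_scaleR p G gL \<theta>)
    have ut: "(\<lambda>x. u x + t * \<theta> x) \<in> Lp_space p W"
      using Lp_add(1)[OF p u(1) Lp_scaleR[OF tL(1)[OF \<theta>], of t]] by simp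
    have 1: "(\<lambda>n. grad_int p (\<xi> n)) \<longlonglongrightarrow> Lp_int p lebesgue (\<lambda>x. G x + t *\<^sub>R classical_grad \<theta> x)"
    proof (rule Lp_int_tendsto[OF gL[OF \<xi>] Gt p])
      show "(\<lambda>n. Lp_int p lebesgue (\<lambda>x. classical_grad (\<xi> n) x - (G x + t *\<^sub>R classical_grad \<theta> x))) \<longlonglongrightarrow> 0"
        using G(2) by (simp add: g\<xi>)
    qed
    have 2: "(\<lambda>n. c.Phi (\<xi> n)) \<longlonglongrightarrow> c.Phi (\<lambda>x. u x + t * \<theta> x)"
    proof (rule c.Phi_tendsto[OF tL(1)[OF \<xi>, unfolded W_def] ut[unfolded W_def]])
      show "(\<lambda>n. Lp_int p (decay_measure \<alpha>) (\<lambda>x. \<xi> n x - (u x + t * \<theta> x))) \<longlonglongrightarrow> 0"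
        using u(2) by (simp add: \<xi>_def W_def)
    qed
    have "(\<lambda>n. J (\<xi> n)) \<longlonglongrightarrow> Lp_int p lebesgue (\<lambda>x. G x + t *\<^sub>R classical_grad \<theta> x) / p - c.Phi (\<lambda>x. u x + t * \<theta> x)"
      unfolding J_def using p by (intro tendsto_intros 1 2) auto
    then have "j \<le> Lp_int p lebesgue (\<lambda>x. G x + t *\<^sub>R classical_grad \<theta> x) / p - c.Phi (\<lambda>x. u x + t * \<theta> x)"
      by (rule LIMSEQ_le_const) (use jle[OF \<xi>] in auto)
    then show ?thesis using jeq by simp
  qed
  show ?thesis by (rule that[OF hG u(1)[unfolded W_def] G(1) min])
qed

text \<open>Minimality along positive steps gives one inequality only, since the convexity bound on
  the gradient term points in one direction; the directions \<open>- v\<close> and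
  \<open>- H\<close> give the other.\<close>

lemma euler_lagrange:
  fixes f :: "'a::euclidean_space \<Rightarrow> real \<Rightarrow> real"
  assumes cg: "caratheodory_growth W f A B p"
    and u: "u \<in> Lp_space p W" and G: "G \<in> Lp_space p M" and v: "v \<in> Lp_space p W" and H: "H \<in> Lp_space p M"
    and min: "\<And>t. Lp_int p M G / p - caratheodory_growth.Phi W f u
      \<le> Lp_int p M (\<lambda>x. G x + t *\<^sub>R H x) / p - caratheodory_growth.Phi W f (\<lambda>x. u x + t * v x)"
  shows "(\<integral>x. p_dual p (G x) \<bullet> H x \<partial>M) = (\<integral>x. f x (u x) * v x \<partial>W)"
proof -
  interpret c: caratheodory_growth W f A B p by (rule cg)
  note p = c.p
  have *: "(\<integral>x. f x (u x) * v x \<partial>W) \<le> (\<integral>x. p_dual p (G x) \<bullet> H x \<partial>M)"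
    if v: "v \<in> Lp_space p W" and H: "H \<in> Lp_space p M"
      and min: "\<And>t. Lp_int p M G / p - c.Phi u \<le> Lp_int p M (\<lambda>x. G x + t *\<^sub>R H x) / p - c.Phi (\<lambda>x. u x + t * v x)"
    for v H
  proof -
    define t where "t k = 1 / real (Suc k)" for k
    have t: "0 < t k" "t k \<le> 1" for k by (auto simp: t_def field_simps)
    have t0: "t \<longlonglongrightarrow> 0" unfolding t_def by (rule LIMSEQ_Suc[OF lim_1_over_n])
    show ?thesis
    proof (rule LIMSEQ_le[OF c.Phi_directional_derivative[OF u v t t0] p_dual_perturbation_tendsto[OF p G H t t0]])
      have "(c.Phi (\<lambda>x. u x + t k * v x) - c.Phi u) / t k \<le> (\<integral>x. p_dual p (G x + t k *\<^sub>R H x) \<bullet> H x \<partial>M)" for k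
      proof -
        define I where "I = (\<integral>x. p_dual p (G x + t k *\<^sub>R H x) \<bullet> H x \<partial>M)"
        have "(Lp_int p M (\<lambda>x. G x + t k *\<^sub>R H x) - Lp_int p M G) / p \<le> (p * t k * I) / p"
          unfolding I_def using p by (intro divide_right_mono Lp_int_increment_le[OF p G H]) auto
        also have "\<dots> = t k * I" using p by simp
        finally have "c.Phi (\<lambda>x. u x + t k * v x) - c.Phi u \<le> t k * I"
          using min[of "t k"] by (simp add: diff_divide_distrib)
        then show ?thesis unfolding I_def[symmetric] using t(1)[of k] by (simp add: pos_divide_le_eq mult.commute)
      qed
      then show "\<exists>N. \<forall>k\<ge>N. (c.Phi (\<lambda>x. u x + t k * v x) - c.Phi u) / t k \<le> (\<integral>x. p_dual p (G x + t k *\<^sub>R H x) \<bullet> H x \<partial>M)"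
        by blast
    qed
  qed
  have "(\<integral>x. f x (u x) * (- 1 *\<^sub>R v x) \<partial>W) \<le> (\<integral>x. p_dual p (G x) \<bullet> (- 1 *\<^sub>R H x) \<partial>M)"
  proof (rule *[OF Lp_scaleR[OF v] Lp_scaleR[OF H]])
    show "Lp_int p M G / p - c.Phi u \<le> Lp_int p M (\<lambda>x. G x + t *\<^sub>R (- 1 *\<^sub>R H x)) / p - c.Phi (\<lambda>x. u x + t * (- 1 *\<^sub>R v x))" for t
      using min[of "- t"] by simp
  qed
  then have "(\<integral>x. p_dual p (G x) \<bullet> H x \<partial>M) \<le> (\<integral>x. f x (u x) * v x \<partial>W)" by simp
  with *[OF v H min] show ?thesis by simp
qed

section \<open>Existence\<close>

lemma weighted_Lnorm_powr:
  assumes "u \<in> borel_measurable lebesgue" "1 < p"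
  shows "weighted_Lnorm p (decay_weight \<alpha>) u powr p = Lp_int p (decay_measure \<alpha>) u"
proof -
  have "(\<integral>x. decay_weight \<alpha> x * \<bar>u x\<bar> powr p \<partial>lebesgue) = Lp_int p (decay_measure \<alpha>) u"
    by (rule Lp_int_decay_measure[OF assms(1), symmetric])
  then show ?thesis using assms(2) by (simp add: weighted_Lnorm_def powr_powr)
qed

text \<open>A crude constant first shows that the set under the \<open>Sup\<close> is bounded above;
  only then does the supremum bound its members, and scaling to gradient norm 1 brings in the sharp
  constant.\<close>

lemma embedding_norm_inequality:
  fixes \<phi> :: "'a::euclidean_space \<Rightarrow> real"
  assumes p: "1 < p" "p < real DIM('a)" and \<alpha>: "0 < \<alpha>" and \<phi>: "test_function \<phi>"
  shows "Lp_int p (decay_measure \<alpha>) \<phi> \<le> embedding_norm p (decay_weight \<alpha> :: 'a \<Rightarrow> real) powr p * grad_int p \<phi>"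
proof -
  obtain K where K: "0 < K" "\<And>f :: 'a \<Rightarrow> real. test_function f \<Longrightarrow>
    f \<in> Lp_space p (decay_measure \<alpha>) \<and> Lp_int p (decay_measure \<alpha>) f \<le> K * grad_int p f"
    by (rule embedding_inequality[OF p \<alpha>]) blast
  define S where "S = {weighted_Lnorm p (decay_weight \<alpha> :: 'a \<Rightarrow> real) u | u. u \<in> D1p p \<and> D1p_norm p u \<le> 1}"
  define E where "E = embedding_norm p (decay_weight \<alpha> :: 'a \<Rightarrow> real)"
  have E: "E = Sup S" by (simp add: E_def embedding_norm_def S_def)
  have bound: "weighted_Lnorm p (decay_weight \<alpha>) u \<le> K powr (1 / p)"
    if u: "u \<in> D1p p" and n: "D1p_norm p u \<le> 1" for u :: "'a \<Rightarrow> real"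
  proof -
    obtain \<phi> where \<phi>: "\<And>n. test_function (\<phi> n)" and G: "D1p_grad p u \<in> Lp_space p lebesgue" and uL: "u \<in> Lp_space p (decay_measure \<alpha>)"
      and lim: "(\<lambda>n. Lp_int p lebesgue (\<lambda>x. classical_grad (\<phi> n) x - D1p_grad p u x)) \<longlonglongrightarrow> 0"
        "(\<lambda>n. Lp_int p (decay_measure \<alpha>) (\<lambda>x. \<phi> n x - u x)) \<longlonglongrightarrow> 0"
      by (rule D1p_approximation[OF D1p_grad_works[OF u] p \<alpha>]) blast
    have gL: "classical_grad (\<phi> n) \<in> Lp_space p lebesgue" for n using \<phi> p by (intro test_function_Lp) auto
    have \<phi>L: "\<phi> n \<in> Lp_space p (decay_measure \<alpha>)" for n using K(2)[OF \<phi>] by blast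
    have "Lp_int p (decay_measure \<alpha>) u \<le> K * Lp_int p lebesgue (D1p_grad p u)"
    proof (rule LIMSEQ_le)
      show "(\<lambda>n. Lp_int p (decay_measure \<alpha>) (\<phi> n)) \<longlonglongrightarrow> Lp_int p (decay_measure \<alpha>) u"
        by (rule Lp_int_tendsto[OF \<phi>L uL p(1) lim(2)])
      show "(\<lambda>n. K * grad_int p (\<phi> n)) \<longlonglongrightarrow> K * Lp_int p lebesgue (D1p_grad p u)"
        by (intro tendsto_intros Lp_int_tendsto[OF gL G p(1) lim(1)])
      show "\<exists>N. \<forall>n\<ge>N. Lp_int p (decay_measure \<alpha>) (\<phi> n) \<le> K * grad_int p (\<phi> n)" using K(2)[OF \<phi>] by blast
    qed
    also have "Lp_int p lebesgue (D1p_grad p u) = D1p_norm p u powr p"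
      by (rule D1p_norm_powr[OF D1p_grad_works[OF u] p(1), symmetric])
    also have "D1p_norm p u powr p \<le> 1"
      using n p by (intro powr_le1) (auto simp: D1p_norm_def)
    finally have "weighted_Lnorm p (decay_weight \<alpha>) u powr p \<le> K"
      using weighted_Lnorm_powr[of u p \<alpha>] Lp_measurable[OF uL] p K(1) by simp
    then show ?thesis using p by (intro powr_le_imp_le_root) (auto simp: weighted_Lnorm_def)
  qed
  then have bdd: "bdd_above S" unfolding S_def bdd_above_def by blast
  show ?thesis
  proof (cases "grad_int p \<phi> = 0")
    \<comment> \<open>A vanishing gradient cannot be normalised, but here the crude inequality
      already bounds the left-hand side by zero.\<close>
    case True
    then show ?thesis using K(2)[OF \<phi>] by simp
  next
    case False
    define I where "I = grad_int p \<phi>"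
    have I: "0 < I" using False Lp_int_nonneg[of p lebesgue "classical_grad \<phi>"] unfolding I_def by linarith
    define c where "c = I powr (- 1 / p)"
    have c: "0 < c" using I by (simp add: c_def)
    have cp: "c powr p = 1 / I" using I p powr_minus_divide[of I 1] unfolding c_def powr_powr by simp
    define \<psi> where "\<psi> x = c * \<phi> x" for x
    have \<psi>: "test_function \<psi>" unfolding \<psi>_def by (rule test_function_cmult[OF \<phi>])
    have "grad_int p \<psi> = \<bar>c\<bar> powr p * I"
    proof -
      have "classical_grad \<psi> = (\<lambda>x. c *\<^sub>R classical_grad \<phi> x)"
        unfolding \<psi>_def by (rule ext) (rule test_function_grad_cmult[OF \<phi>])
      then show ?thesis by (simp only: Lp_int_scaleR I_def)
    qed
    then have "D1p_norm p \<psi> powr p = 1"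
      using D1p_norm_powr[OF test_function_has_D1p_grad[OF \<psi> p(1)] p(1)] c cp I by simp
    then have "D1p_norm p \<psi> \<le> 1 powr (1 / p)"
      using p by (intro powr_le_imp_le_root) (auto simp: D1p_norm_def)
    then have "weighted_Lnorm p (decay_weight \<alpha>) \<psi> \<in> S"
      using test_function_has_D1p_grad[OF \<psi> p(1)] unfolding S_def D1p_def by auto
    then have "weighted_Lnorm p (decay_weight \<alpha>) \<psi> \<le> E" unfolding E by (rule cSup_upper[OF _ bdd])
    then have "weighted_Lnorm p (decay_weight \<alpha>) \<psi> powr p \<le> E powr p"
      using p by (intro powr_mono2) (auto simp: weighted_Lnorm_def)
    then have "Lp_int p (decay_measure \<alpha>) \<psi> \<le> E powr p"
      using weighted_Lnorm_powr[OF test_function_measurable(3)[OF \<psi>] p(1)] by simp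
    moreover have "Lp_int p (decay_measure \<alpha>) \<psi> = \<bar>c\<bar> powr p * Lp_int p (decay_measure \<alpha>) \<phi>"
      using Lp_int_scaleR[of p "decay_measure \<alpha>" c \<phi>] by (simp add: \<psi>_def[abs_def])
    ultimately have "Lp_int p (decay_measure \<alpha>) \<phi> / I \<le> E powr p" using c cp by simp
    then show ?thesis using I unfolding I_def E_def by (simp add: divide_le_eq)
  qed
qed

text \<open>Minimality yields the Euler-Lagrange identity for test functions; both of its sides are
  continuous along the sequences of \<open>D1p_approximation\<close>, which extends it to
  \<open>D1p\<close>. The integrals against \<open>decay_measure\<close> then become weighted
  Lebesgue integrals.\<close>

lemma weak_solution_of_growth:
  fixes f :: "'a::euclidean_space \<Rightarrow> real \<Rightarrow> real"
  assumes dim: "p < real DIM('a)" and \<alpha>: "0 < \<alpha>"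
    and cg: "caratheodory_growth (decay_measure \<alpha>) f A B p"
    and K: "\<And>\<phi> :: 'a \<Rightarrow> real. test_function \<phi> \<Longrightarrow> Lp_int p (decay_measure \<alpha>) \<phi> \<le> K * grad_int p \<phi>"
    and K0: "0 \<le> K" and BK: "B * K < 1"
  obtains u where "u \<in> borel_measurable lebesgue" "p_laplace_solution p (\<lambda>x s. decay_weight \<alpha> x * f x s) u"
proof -
  interpret c: caratheodory_growth "decay_measure \<alpha>" f A B p by (rule cg)
  note p = c.p
  define W where "W = (decay_measure \<alpha> :: 'a measure)"
  have tL: "\<phi> \<in> Lp_space p W" if "test_function \<phi>" for \<phi>
    using embedding_inequality[OF p dim \<alpha>] that unfolding W_def by metis
  have gL: "classical_grad \<phi> \<in> Lp_space p lebesgue" if "test_function \<phi>" for \<phi> :: "'a \<Rightarrow> real"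
    using that p by (intro test_function_Lp) auto
  have K': "\<phi> \<in> Lp_space p (decay_measure \<alpha>) \<and> Lp_int p (decay_measure \<alpha>) \<phi> \<le> K * grad_int p \<phi>"
    if "test_function \<phi>" for \<phi> :: "'a \<Rightarrow> real"
    using tL[OF that] K[OF that] by (simp add: W_def)
  obtain u G where hu: "has_D1p_grad p u G" and u: "u \<in> Lp_space p W" and G: "G \<in> Lp_space p lebesgue"
    and min: "\<And>\<psi> t. test_function \<psi> \<Longrightarrow> Lp_int p lebesgue G / p - c.Phi u
      \<le> Lp_int p lebesgue (\<lambda>x. G x + t *\<^sub>R classical_grad \<psi> x) / p - c.Phi (\<lambda>x. u x + t * \<psi> x)"
    unfolding W_def by (rule exists_minimizer[OF dim \<alpha> cg K' K0 BK]) blast+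
  have EL: "(\<integral>x. p_dual p (G x) \<bullet> classical_grad \<psi> x \<partial>lebesgue) = (\<integral>x. f x (u x) * \<psi> x \<partial>W)" if "test_function \<psi>" for \<psi>
    unfolding W_def by (rule euler_lagrange[OF cg u[unfolded W_def] G tL[OF that, unfolded W_def] gL[OF that] min[OF that]])
  have um: "u \<in> borel_measurable lebesgue" using Lp_measurable[OF u] by (simp add: W_def)
  have uD: "u \<in> D1p p" using hu by (auto simp: D1p_def)
  have DG: "AE x in lebesgue. D1p_grad p u x = G x"
    by (rule has_D1p_grad_unique[OF D1p_grad_works[OF uD] hu p])
  have Dm: "D1p_grad p u \<in> borel_measurable lebesgue"
    using D1p_grad_works[OF uD] by (simp add: has_D1p_grad_def)
  have "p_laplace_solution p (\<lambda>x s. decay_weight \<alpha> x * f x s) u"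
    unfolding p_laplace_solution_def p_dual_def[symmetric]
  proof (intro conjI ballI uD)
    fix v :: "'a \<Rightarrow> real" assume v: "v \<in> D1p p"
    define H where "H = D1p_grad p v"
    obtain \<phi> where \<phi>: "\<And>n. test_function (\<phi> n)" and H: "H \<in> Lp_space p lebesgue" and vL: "v \<in> Lp_space p W"
      and lim: "(\<lambda>n. Lp_int p lebesgue (\<lambda>x. classical_grad (\<phi> n) x - H x)) \<longlonglongrightarrow> 0" "(\<lambda>n. Lp_int p W (\<lambda>x. \<phi> n x - v x)) \<longlonglongrightarrow> 0"
      unfolding H_def W_def by (rule D1p_approximation[OF D1p_grad_works[OF v] p dim \<alpha>]) blast
    note [measurable] = Dm Lp_measurable[OF H] Lp_measurable[OF G]
    have vm: "v \<in> borel_measurable lebesgue" using Lp_measurable[OF vL] by (simp add: W_def)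
    have fuv: "(\<lambda>x. f x (u x) * v x) \<in> borel_measurable lebesgue"
      using borel_measurable_integrable[OF c.f_product_integrable[OF u[unfolded W_def] vL[unfolded W_def]]] by simp
    have "(\<lambda>n. \<integral>x. p_dual p (G x) \<bullet> classical_grad (\<phi> n) x \<partial>lebesgue) \<longlonglongrightarrow> (\<integral>x. p_dual p (G x) \<bullet> H x \<partial>lebesgue)"
      by (rule p_dual_integral_tendsto[OF p G H gL[OF \<phi>] lim(1)])
    then have "(\<lambda>n. \<integral>x. f x (u x) * \<phi> n x \<partial>W) \<longlonglongrightarrow> (\<integral>x. p_dual p (G x) \<bullet> H x \<partial>lebesgue)"
      by (simp only: EL[OF \<phi>])
    moreover have "(\<lambda>n. \<integral>x. f x (u x) * \<phi> n x \<partial>W) \<longlonglongrightarrow> (\<integral>x. f x (u x) * v x \<partial>W)"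
      unfolding W_def
      by (rule c.f_integral_tendsto[OF u[unfolded W_def] vL[unfolded W_def] tL[OF \<phi>, unfolded W_def] lim(2)[unfolded W_def]])
    ultimately have eq: "(\<integral>x. p_dual p (G x) \<bullet> H x \<partial>lebesgue) = (\<integral>x. f x (u x) * v x \<partial>W)"
      by (rule LIMSEQ_unique)
    \<comment> \<open>\<open>D1p_grad p u\<close> need not be the \<open>G\<close> of the minimiser,
      but agrees with it almost everywhere.\<close>
    have ae: "AE x in lebesgue. p_dual p (D1p_grad p u x) \<bullet> H x = p_dual p (G x) \<bullet> H x"
      using DG by eventually_elim simp
    have "integrable lebesgue (\<lambda>x. p_dual p (G x) \<bullet> H x)" by (rule p_dual_integrable[OF p G H])
    then show "integrable lebesgue (\<lambda>x. p_dual p (D1p_grad p u x) \<bullet> D1p_grad p v x)"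
      unfolding H_def[symmetric] by (subst integrable_cong_AE[OF _ _ ae]) measurable
    have w: "AE x in lebesgue. 0 \<le> decay_weight \<alpha> (x::'a)" by (simp add: less_imp_le[OF decay_weight_pos])
    have "integrable W (\<lambda>x. f x (u x) * v x)"
      unfolding W_def by (rule c.f_product_integrable[OF u[unfolded W_def] vL[unfolded W_def]])
    then show "integrable lebesgue (\<lambda>x. decay_weight \<alpha> x * f x (u x) * v x)"
      unfolding W_def decay_measure_def
      by (subst (asm) integrable_density[OF fuv decay_weight_measurable_lebesgue w]) (simp add: mult.assoc)
    have "(\<integral>x. f x (u x) * v x \<partial>W) = (\<integral>x. decay_weight \<alpha> x * f x (u x) * v x \<partial>lebesgue)"
      unfolding W_def decay_measure_def
      by (subst integral_density[OF fuv decay_weight_measurable_lebesgue w]) (simp add: mult.assoc)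
    moreover have "(\<integral>x. p_dual p (D1p_grad p u x) \<bullet> H x \<partial>lebesgue) = (\<integral>x. p_dual p (G x) \<bullet> H x \<partial>lebesgue)"
      by (rule integral_cong_AE[OF _ _ ae]) measurable
    ultimately show "(\<integral>x. p_dual p (D1p_grad p u x) \<bullet> D1p_grad p v x \<partial>lebesgue) = (\<integral>x. decay_weight \<alpha> x * f x (u x) * v x \<partial>lebesgue)"
      using eq by (simp add: H_def)
  qed
  with um show ?thesis by (rule that)
qed

lemma p_laplace_solution_cong_AE:
  fixes u :: "'a::euclidean_space \<Rightarrow> real"
  assumes sol: "p_laplace_solution p h u" and ae: "AE x in lebesgue. \<forall>s. h x s = k x s"
  shows "p_laplace_solution p k u"
  unfolding p_laplace_solution_def
proof (intro conjI ballI)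
  show "u \<in> D1p p" using sol by (simp add: p_laplace_solution_def)
  fix v :: "'a \<Rightarrow> real" assume v: "v \<in> D1p p"
  let ?L = "\<lambda>x. (norm (D1p_grad p u x) powr (p - 2) *\<^sub>R D1p_grad p u x) \<bullet> D1p_grad p v x"
  have i: "integrable lebesgue ?L" "integrable lebesgue (\<lambda>x. h x (u x) * v x)"
    "(\<integral>x. ?L x \<partial>lebesgue) = (\<integral>x. h x (u x) * v x \<partial>lebesgue)"
    using sol v by (auto simp: p_laplace_solution_def)
  have ae': "AE x in lebesgue. h x (u x) * v x = k x (u x) * v x"
    using ae by eventually_elim simp
  have m: "(\<lambda>x. h x (u x) * v x) \<in> borel_measurable lebesgue" by (rule borel_measurable_integrable[OF i(2)])
  have m': "(\<lambda>x. k x (u x) * v x) \<in> borel_measurable lebesgue"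
    by (rule borel_measurable_AE[OF m ae'])
  show "integrable lebesgue ?L" by (rule i)
  show "integrable lebesgue (\<lambda>x. k x (u x) * v x)"
    using i(2) integrable_cong_AE[OF m m' ae'] by simp
  show "(\<integral>x. ?L x \<partial>lebesgue) = (\<integral>x. k x (u x) * v x \<partial>lebesgue)"
    unfolding i(3) by (rule integral_cong_AE[OF m m' ae'])
qed

text \<open>The common form of the two growth conditions: \<open>A\<close> may be arbitrarily large,
  and only \<open>B\<close> is subject to the smallness condition.\<close>

lemma existence_from_growth:
  fixes a :: "'a::euclidean_space \<Rightarrow> real" and g :: "'a \<Rightarrow> real \<Rightarrow> real"
  assumes p: "1 < p" "p < real DIM('a)" and \<alpha>: "0 < \<alpha>" and ca: "0 < c\<^sub>a"
    and am [measurable]: "a \<in> borel_measurable lebesgue"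
    and a: "\<And>x. \<bar>a x\<bar> \<le> c\<^sub>a * decay_weight \<alpha> x"
    and g: "caratheodory g"
    and growth: "AE x in lebesgue. \<forall>s. \<bar>g x s\<bar> \<le> A + B * \<bar>s\<bar> powr (p - 1)" and A: "0 \<le> A" and B: "0 \<le> B"
    and K: "\<And>\<phi> :: 'a \<Rightarrow> real. test_function \<phi> \<Longrightarrow> Lp_int p (decay_measure \<alpha>) \<phi> \<le> K * grad_int p \<phi>"
    and K0: "0 \<le> K" and BK: "c\<^sub>a * B * K < 1"
  shows "\<exists>u. p_laplace_solution p (\<lambda>x s. a x * g x s) u"
proof -
  have "AE x in lebesgue. continuous_on UNIV (g x) \<and> (\<forall>s. \<bar>g x s\<bar> \<le> A + B * \<bar>s\<bar> powr (p - 1))"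
    using g growth by (auto simp: caratheodory_def)
  then obtain N where N: "N \<in> null_sets lebesgue"
    "{x \<in> space lebesgue. \<not> (continuous_on UNIV (g x) \<and> (\<forall>s. \<bar>g x s\<bar> \<le> A + B * \<bar>s\<bar> powr (p - 1)))} \<subseteq> N"
    unfolding eventually_ae_filter by auto
  have good: "continuous_on UNIV (g x)" "\<bar>g x s\<bar> \<le> A + B * \<bar>s\<bar> powr (p - 1)" if "x \<notin> N" for x s
    using N(2) that by auto
  have [measurable]: "N \<in> sets lebesgue" using N(1) by auto
  have [measurable]: "(\<lambda>x. g x s) \<in> borel_measurable lebesgue" for s using g by (simp add: caratheodory_def)
  \<comment> \<open>Dividing by the weight prepares the integration against
    \<open>decay_measure\<close> and leaves a coefficient bounded by \<open>c\<^sub>a\<close>. The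
    value 0 on \<open>N\<close> gives continuity and growth at every point, at the cost of a change
    on a null set.\<close>
  define f where "f x s = (if x \<in> N then 0 else a x / decay_weight \<alpha> x * g x s)" for x s
  have "caratheodory_growth (decay_measure \<alpha>) f (c\<^sub>a * A) (c\<^sub>a * B) p"
  proof (intro caratheodory_growth.intro caratheodory_growth_axioms.intro finite_decay_measure \<alpha> p)
    show "0 \<le> c\<^sub>a * A" "0 \<le> c\<^sub>a * B" using ca A B by auto
    show "(\<lambda>x. f x s) \<in> borel_measurable (decay_measure \<alpha>)" for s
      unfolding f_def by simp
    show "continuous_on UNIV (f x)" for x
      unfolding f_def using good(1)[of x] less_imp_neq[OF decay_weight_pos[of \<alpha> x]]
      by (cases "x \<in> N") (auto intro!: continuous_intros)
    show "\<bar>f x s\<bar> \<le> c\<^sub>a * A + c\<^sub>a * B * \<bar>s\<bar> powr (p - 1)" for x s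
    proof (cases "x \<in> N")
      case True
      then show ?thesis using ca A B by (simp add: f_def)
    next
      case False
      have "\<bar>a x / decay_weight \<alpha> x\<bar> \<le> c\<^sub>a"
        using a[of x] decay_weight_pos[of \<alpha> x] by (simp add: abs_divide divide_le_eq)
      then have "\<bar>a x / decay_weight \<alpha> x\<bar> * \<bar>g x s\<bar> \<le> c\<^sub>a * (A + B * \<bar>s\<bar> powr (p - 1))"
        using good(2)[OF False] ca by (intro mult_mono) auto
      then show ?thesis using False by (simp add: f_def abs_mult algebra_simps)
    qed
  qed
  then obtain u where "p_laplace_solution p (\<lambda>x s. decay_weight \<alpha> x * f x s) u"
    by (rule weak_solution_of_growth[OF p(2) \<alpha> _ K K0 BK]) blast+
  then have "p_laplace_solution p (\<lambda>x s. a x * g x s) u"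
  proof (rule p_laplace_solution_cong_AE)
    show "AE x in lebesgue. \<forall>s. decay_weight \<alpha> x * f x s = a x * g x s"
      using AE_not_in[OF N(1)]
    proof eventually_elim
      fix x assume "x \<notin> N"
      then show "\<forall>s. decay_weight \<alpha> x * f x s = a x * g x s"
        using less_imp_neq[OF decay_weight_pos[of \<alpha> x]] by (simp add: f_def)
    qed
  qed
  then show ?thesis by blast
qed

lemma powr_absorb:
  fixes q p d :: real
  assumes "1 < q" "q < p" "0 < d"
  obtains C where "0 \<le> C" "\<And>s::real. 0 \<le> s \<Longrightarrow> s powr (q - 1) \<le> C + d * s powr (p - 1)"
proof -
  \<comment> \<open>The point where \<open>d * s powr (p - 1)\<close> overtakes
    \<open>s powr (q - 1)\<close>: up to it the constant suffices, beyond it the higher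
    power.\<close>
  define S where "S = d powr (1 / (q - p))"
  have S: "0 < S" using assms by (simp add: S_def)
  have Sd: "S powr (q - p) = d" using assms by (simp add: S_def powr_powr)
  have "s powr (q - 1) \<le> S powr (q - 1) + d * s powr (p - 1)" if s: "0 \<le> s" for s
  proof (cases "s \<le> S")
    case True
    then have "s powr (q - 1) \<le> S powr (q - 1)" using s assms by (intro powr_mono2) auto
    then show ?thesis using assms by (simp add: add_increasing2)
  next
    case False
    then have "s powr (q - p) \<le> S powr (q - p)" using S assms by (intro powr_mono2') auto
    then have "s powr (q - p) * s powr (p - 1) \<le> d * s powr (p - 1)" unfolding Sd by (rule mult_right_mono) simp
    also have "s powr (q - p) * s powr (p - 1) = s powr (q - 1)" by (simp add: powr_add[symmetric])
    finally show ?thesis by (simp add: add_increasing)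
  qed
  then show ?thesis by (intro that[of "S powr (q - 1)"]) auto
qed

theorem theorem3p6:
  fixes p c\<^sub>a \<alpha> :: real
    and a :: "'a::euclidean_space \<Rightarrow> real"
    and g :: "'a \<Rightarrow> real \<Rightarrow> real"
  assumes "1 < p" and "p < real DIM('a)"
    and "c\<^sub>a > 0" and "\<alpha> > 0"
    and "a \<in> borel_measurable lebesgue"
    and "\<And>x. \<bar>a x\<bar> \<le> c\<^sub>a * (1 / (1 + norm x powr (real DIM('a) + \<alpha>)))"
    and "caratheodory g"
    and "(\<exists>q c\<^sub>g. 1 < q \<and> q < p \<and> c\<^sub>g > 0 \<and>
            (AE x in lebesgue. \<forall>s. \<bar>g x s\<bar> \<le> c\<^sub>g * (1 + \<bar>s\<bar> powr (q - 1)))) \<or>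
         (\<exists>c\<^sub>g. c\<^sub>g > 0 \<and>
            (AE x in lebesgue. \<forall>s. \<bar>g x s\<bar> \<le> c\<^sub>g * (1 + \<bar>s\<bar> powr (p - 1))) \<and>
            c\<^sub>a * c\<^sub>g < 1 / embedding_norm p (decay_weight \<alpha> :: 'a \<Rightarrow> real) powr p)"
  shows "\<exists>u. p_laplace_solution p (\<lambda>x s. a x * g x s) u"
proof -
  define K where "K = embedding_norm p (decay_weight \<alpha> :: 'a \<Rightarrow> real) powr p"
  have K0: "0 \<le> K" by (simp add: K_def)
  have a: "\<bar>a x\<bar> \<le> c\<^sub>a * decay_weight \<alpha> x" for x using assms(6) by (simp add: decay_weight_def)
  have K: "Lp_int p (decay_measure \<alpha>) \<phi> \<le> K * grad_int p \<phi>" if "test_function \<phi>" for \<phi> :: "'a \<Rightarrow> real"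
    unfolding K_def by (rule embedding_norm_inequality[OF assms(1,2,4) that])
  note ex = existence_from_growth[OF assms(1,2,4,3,5) a assms(7) _ _ _ K K0]
  from assms(8) show ?thesis
  proof (elim disjE exE conjE)
    fix q c\<^sub>g
    assume q: "1 < q" "q < p" and cg: "c\<^sub>g > 0"
      and growth: "AE x in lebesgue. \<forall>s. \<bar>g x s\<bar> \<le> c\<^sub>g * (1 + \<bar>s\<bar> powr (q - 1))"
    \<comment> \<open>With this \<open>d\<close> the product that has to be below 1 becomes
      \<open>K / (2 * (K + 1))\<close>; the added 1 covers \<open>K = 0\<close>.\<close>
    define d where "d = 1 / (2 * c\<^sub>a * c\<^sub>g * (K + 1))"
    have d: "0 < d" using assms(3) cg K0 by (simp add: d_def)
    obtain C where C: "0 \<le> C" "\<And>s::real. 0 \<le> s \<Longrightarrow> s powr (q - 1) \<le> C + d * s powr (p - 1)"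
      by (rule powr_absorb[OF q d]) blast
    show ?thesis
    proof (rule ex)
      show "AE x in lebesgue. \<forall>s. \<bar>g x s\<bar> \<le> c\<^sub>g * (1 + C) + c\<^sub>g * d * \<bar>s\<bar> powr (p - 1)"
        using growth
      proof (eventually_elim, intro allI)
        fix x s assume "\<forall>s. \<bar>g x s\<bar> \<le> c\<^sub>g * (1 + \<bar>s\<bar> powr (q - 1))"
        then have "\<bar>g x s\<bar> \<le> c\<^sub>g * (1 + \<bar>s\<bar> powr (q - 1))" by blast
        also have "\<dots> \<le> c\<^sub>g * (1 + (C + d * \<bar>s\<bar> powr (p - 1)))"
          using C(2)[of "\<bar>s\<bar>"] cg by (intro mult_left_mono add_left_mono) auto
        finally show "\<bar>g x s\<bar> \<le> c\<^sub>g * (1 + C) + c\<^sub>g * d * \<bar>s\<bar> powr (p - 1)" by (simp add: algebra_simps)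
      qed
      show "0 \<le> c\<^sub>g * (1 + C)" "0 \<le> c\<^sub>g * d" using cg C d by auto
      have "c\<^sub>a * (c\<^sub>g * d) * K = K / (2 * (K + 1))"
        using assms(3) cg by (simp add: d_def)
      also have "\<dots> < 1" using K0 by (simp add: divide_less_eq)
      finally show "c\<^sub>a * (c\<^sub>g * d) * K < 1" .
    qed
  next
    fix c\<^sub>g
    assume cg: "c\<^sub>g > 0" and growth: "AE x in lebesgue. \<forall>s. \<bar>g x s\<bar> \<le> c\<^sub>g * (1 + \<bar>s\<bar> powr (p - 1))"
      and small: "c\<^sub>a * c\<^sub>g < 1 / embedding_norm p (decay_weight \<alpha> :: 'a \<Rightarrow> real) powr p"
    show ?thesis
    proof (rule ex)
      show "AE x in lebesgue. \<forall>s. \<bar>g x s\<bar> \<le> c\<^sub>g + c\<^sub>g * \<bar>s\<bar> powr (p - 1)"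
        using growth by (simp add: distrib_left)
      show "0 \<le> c\<^sub>g" "0 \<le> c\<^sub>g" using cg by auto
      \<comment> \<open>Division by zero yields 0, so \<open>K = 0\<close> would turn the smallness
        hypothesis into \<open>c\<^sub>a * c\<^sub>g < 0\<close>.\<close>
      have "0 < c\<^sub>a * c\<^sub>g" using assms(3) cg by simp
      then have "K \<noteq> 0" using small by (auto simp: K_def)
      then show "c\<^sub>a * c\<^sub>g * K < 1" using small K0 by (simp add: K_def[symmetric] less_divide_eq)
    qed
  qed
qed

end
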